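(* Let $T>0$, $c_v>0$, and $\Omega=\mathbb{R}\times\mathcal{T}^1$, where $\mathcal{T}^1=[0,1]|_{\{0,1\}}$ is the one-dimensional flat torus. Let $R_L,R_R,\Theta_L,\Theta_R>0$ and $U_L,U_R\in\mathbb{R}$ be Riemann data, and let $[\varrho,\vartheta,\mathbf{u}]$ be a weak solution (in the sense of the context) of the full Euler system $$\partial_t \varrho + \mathrm{div}_x(\varrho \mathbf{u})=0,\qquad \partial_t(\varrho\mathbf{u})+\mathrm{div}_x(\varrho\mathbf{u}\otimes\mathbf{u})+\nabla_x(\varrho\vartheta)=0,$$ $$\partial_t\left[\tfrac12\varrho|\mathbf{u}|^2+c_v\varrho\vartheta\right]+\mathrm{div}_x\left[\left(\tfrac12\varrho|\mathbf{u}|^2+c_v\varrho\vartheta+\varrho\vartheta\right)\mathbf{u}\right]=0,$$ with the entropy inequality $$\partial_t(\varrho s)+\mathrm{div}_x(\varrho s\mathbf{u})\ge 0,\qquad s=s(\varrho,\vartheta)=\log\left(\frac{\vartheta^{c_v}}{\varrho}\right),$$ in $(0,T)\times\Omega$, originating from the Riemann data $$\varrho(0,x_1,x_2)=R_0(x_1),\quad \vartheta(0,x_1,x_2)=\Theta_0(x_1),\quad u^1(0,x_1,x_2)=U_0(x_1),\quad u^2(0,x_1,x_2)=0,$$ where $(R_0,\Theta_0,U_0)(x_1)=(R_L,\Theta_L,U_L)$ for $x_1\le 0$ and $(R_0,\Theta_0,U_0)(x_1)=(R_R,\Theta_R,U_R)$ for $x_1>0$, and satisfying the far field conditions $$\lim_{x_1\to-\infty}\int_0^T\!\!\int_{\mathcal{T}^1}\left(|\varrho-R_L|+|\vartheta-\Theta_L|+|u^1-U_L|+|u^2|\right)(t,x_1,x_2)\,\mathrm{d}x_2\,\mathrm{d}t=0,$$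 $$\lim_{x_1\to+\infty}\int_0^T\!\!\int_{\mathcal{T}^1}\left(|\varrho-R_R|+|\vartheta-\Theta_R|+|u^1-U_R|+|u^2|\right)(t,x_1,x_2)\,\mathrm{d}x_2\,\mathrm{d}t=0.$$ Suppose in addition that the Riemann data give rise to a shock-free solution $[R,\Theta,U]$ of the 1-D Riemann problem (in the sense of the context). Then $$\varrho=R,\qquad \vartheta=\Theta,\qquad \mathbf{u}=[U,0]\qquad\text{a.a. in }(0,T)\times\Omega.$$
   Context: Points of $\Omega=\mathbb{R}\times\mathcal{T}^1$ are $x=(x_1,x_2)$; functions on $\Omega$ are functions on $\mathbb{R}^2$ that are 1-periodic in $x_2$. Here $\varrho$ is the density, $\vartheta$ the absolute temperature, and $\mathbf{u}=[u^1,u^2]$ the velocity (with values in $\mathbb{R}^2$). "a.a." means almost all/almost everywhere. **Weak solution.** With initial data $\varrho_0=R_0$, $\vartheta_0=\Theta_0$, $\mathbf{u}_0=[U_0,0]$, a trio $[\varrho,\vartheta,\mathbf{u}]$ of bounded measurable functions on $[0,T]\times\Omega$ is a weak solution of the Euler system if the following hold. (i) There are constants $\overline{\varrho},\overline{\vartheta},\overline{s},\overline{u}$ such that for a.a. $(t,x)\in(0,T)\times\Omega$: $0<\varrho\le\overline{\varrho}$, $0<\vartheta\le\overline{\vartheta}$, $|s(\varrho,\vartheta)|<\overline{s}$, $|\mathbf{u}|<\overline{u}$. (ii) For any $0\le\tau\le T$ and any $\varphi\in C^1_c([0,T]\times\Omega)$, $$\int_\Omega\left[\varrho(\tau,\cdot)\varphi(\tau,\cdot)-\varrho_0\varphi(0,\cdot)\right]\mathrm{d}x=\int_0^\tau\!\!\int_\Omega\left[\varrho\,\partial_t\varphi+\varrho\mathbf{u}\cdot\nabla_x\varphi\right]\mathrm{d}x\,\mathrm{d}t.$$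 (iii) For any $0\le\tau\le T$ and any $\varphi\in C^1_c([0,T]\times\Omega;\mathbb{R}^2)$, $$\int_\Omega\left[(\varrho\mathbf{u})(\tau,\cdot)\cdot\varphi(\tau,\cdot)-\varrho_0\mathbf{u}_0\cdot\varphi(0,\cdot)\right]\mathrm{d}x=\int_0^\tau\!\!\int_\Omega\left[\varrho\mathbf{u}\cdot\partial_t\varphi+\varrho[\mathbf{u}\otimes\mathbf{u}]:\nabla_x\varphi+\varrho\vartheta\,\mathrm{div}_x\varphi\right]\mathrm{d}x\,\mathrm{d}t.$$ (iv) For any $0\le\tau\le T$ and any $\varphi\in C^1_c([0,T]\times\Omega)$, $$\int_\Omega\left[\left(\tfrac12\varrho|\mathbf{u}|^2+c_v\varrho\vartheta\right)(\tau,\cdot)\varphi(\tau,\cdot)-\left(\tfrac12\varrho_0|\mathbf{u}_0|^2+c_v\varrho_0\vartheta_0\right)\varphi(0,\cdot)\right]\mathrm{d}x$$ $$=\int_0^\tau\!\!\int_\Omega\left[\left(\tfrac12\varrho|\mathbf{u}|^2+c_v\varrho\vartheta\right)\partial_t\varphi+\left(\tfrac12\varrho|\mathbf{u}|^2+c_v\varrho\vartheta+\varrho\vartheta\right)\mathbf{u}\cdot\nabla_x\varphi\right]\mathrm{d}x\,\mathrm{d}t.$$ (v) For any $0\le\tau\le T$, any $\varphi\in C^1_c([0,T]\times\Omega)$ with $\varphi\ge0$, and any $b\in C^1(\mathbb{R})$ with $b'\ge0$, $$\int_\Omega\left[\varrho b(s(\varrho,\vartheta))(\tau,\cdot)\varphi(\tau,\cdot)-\varrho_0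 b(s(\varrho_0,\vartheta_0))\varphi(0,\cdot)\right]\mathrm{d}x\ge\int_0^\tau\!\!\int_\Omega\left[\varrho b(s(\varrho,\vartheta))\partial_t\varphi+\varrho b(s(\varrho,\vartheta))\mathbf{u}\cdot\nabla_x\varphi\right]\mathrm{d}x\,\mathrm{d}t.$$ **Shock-free Riemann solution.** A shock-free solution $[R,\Theta,U]$ of the 1-D Riemann problem is a solution depending only on $(t,x_1)$, and in fact only on the self-similar variable $\xi=x_1/t$ (so $R=R(\xi)$, $\Theta=\Theta(\xi)$, $U=U(\xi)$), with $R>0$ and $\Theta>0$, taking the Riemann data $(R_0,\Theta_0,U_0)$ at $t=0$, locally Lipschitz in the open set $(0,T)\times\Omega$, and such that: - the entropy $S=s(R,\Theta)=\log(\Theta^{c_v}/R)$ is constant in $[0,T]\times\Omega$; - $\Theta=R^{1/c_v}\exp\left(\frac{1}{c_v}S\right)$; - $R=R(t,x_1)$, $U=U(t,x_1)$ is a rarefaction wave solution (i.e. a self-similar, locally Lipschitz for $t>0$ solution, consisting of constant states joined by rarefaction waves) of the 1-D isentropic system $$\partial_t R+\partial_{x_1}(RU)=0,\qquad R\left[\partial_tU+U\partial_{x_1}U\right]+\exp\left(\tfrac{1}{c_v}S\right)\partial_{x_1}R^{\frac{c_v+1}{c_v}}=0.$$ *)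

theory Defs
  imports "HOL-Analysis.Analysis"
begin

text \<open>
  Functions on \<open>\<Omega> = \<real> \<times> \<T>\<^sup>1\<close> are functions of \<open>x = (x\<^sub>1, x\<^sub>2) :: real \<times> real\<close> that are 1-periodic
  in \<open>x\<^sub>2\<close>; integrals over \<open>\<Omega>\<close> are integrals over one period. Time-dependent functions are
  curried, so that \<open>\<rho>(\<tau>, \<cdot>)\<close> is \<open>rho \<tau>\<close>. All measures are Lebesgue (completed), since the
  fields are only assumed Lebesgue measurable.
\<close>

definition periodic_x2 :: "(real \<times> real \<Rightarrow> 'a) \<Rightarrow> bool" where
  "periodic_x2 f \<longleftrightarrow> (\<forall>x1 x2. f (x1, x2 + 1) = f (x1, x2))"

definition period_cell :: "(real \<times> real) set" where
  "period_cell = UNIV \<times> {0..1}"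

definition int_Omega :: "(real \<times> real \<Rightarrow> real) \<Rightarrow> real" where
  "int_Omega f = (LINT x:period_cell|lebesgue. f x)"

definition int_time_Omega :: "real \<Rightarrow> (real \<Rightarrow> real \<times> real \<Rightarrow> real) \<Rightarrow> real" where
  "int_time_Omega \<tau> f = (LINT z:({0<..<\<tau>} \<times> period_cell)|lebesgue. f (fst z) (snd z))"

definition riemann :: "'a \<Rightarrow> 'a \<Rightarrow> real \<Rightarrow> 'a" where
  "riemann l r x1 = (if x1 \<le> 0 then l else r)"

definition entropy :: "real \<Rightarrow> real \<Rightarrow> real \<Rightarrow> real" where
  "entropy cv \<rho> \<theta> = ln (\<theta> powr cv / \<rho>)"


subsection \<open>Test functions\<close>

text \<open>
  \<open>C\<^sup>1\<close> is understood up to the boundary \<open>t = 0\<close> and \<open>t = T\<close>, where derivatives are one-sided.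
  As \<open>\<T>\<^sup>1\<close> is compact, compact support in \<open>[0,T] \<times> \<Omega>\<close> only restricts \<open>x\<^sub>1\<close>; test functions
  need not vanish at \<open>t = 0\<close> or \<open>t = T\<close>.
\<close>

definition C1c_test :: "real \<Rightarrow> (real \<Rightarrow> real \<times> real \<Rightarrow> real) \<Rightarrow> bool" where
  "C1c_test T \<phi> \<longleftrightarrow>
     (\<forall>t\<in>{0..T}. periodic_x2 (\<phi> t)) \<and>
     (\<exists>M. \<forall>t\<in>{0..T}. \<forall>x. \<bar>fst x\<bar> > M \<longrightarrow> \<phi> t x = 0) \<and>
     (\<exists>G :: real \<times> (real \<times> real) \<Rightarrow> real \<times> (real \<times> real).
        continuous_on ({0..T} \<times> UNIV) G \<and>
        (\<forall>z\<in>{0..T} \<times> UNIV.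
           ((\<lambda>(t, x). \<phi> t x) has_derivative (\<lambda>h. G z \<bullet> h)) (at z within {0..T} \<times> UNIV)))"

text \<open>These are used only at interior times, where they are the components of \<open>G\<close> above.\<close>

definition dt :: "(real \<Rightarrow> real \<times> real \<Rightarrow> real) \<Rightarrow> real \<Rightarrow> real \<times> real \<Rightarrow> real" where
  "dt \<phi> t x = deriv (\<lambda>s. \<phi> s x) t"

definition grad :: "(real \<Rightarrow> real \<times> real \<Rightarrow> real) \<Rightarrow> real \<Rightarrow> real \<times> real \<Rightarrow> real \<times> real" where
  "grad \<phi> t x = (deriv (\<lambda>y. \<phi> t (y, snd x)) (fst x), deriv (\<lambda>y. \<phi> t (fst x, y)) (snd x))"


subsection \<open>Weak solutions of the full Euler system\<close>

definition weak_mass ::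
  "real \<Rightarrow> (real \<times> real \<Rightarrow> real) \<Rightarrow>
   (real \<Rightarrow> real \<times> real \<Rightarrow> real) \<Rightarrow> (real \<Rightarrow> real \<times> real \<Rightarrow> real \<times> real) \<Rightarrow> bool" where
  "weak_mass T rho0 rho u \<longleftrightarrow>
     (\<forall>\<tau>\<in>{0..T}. \<forall>\<phi>. C1c_test T \<phi> \<longrightarrow>
        int_Omega (\<lambda>x. rho \<tau> x * \<phi> \<tau> x - rho0 x * \<phi> 0 x) =
        int_time_Omega \<tau> (\<lambda>t x. rho t x * dt \<phi> t x + rho t x * (u t x \<bullet> grad \<phi> t x)))"

text \<open>
  The vector test function is \<open>(\<phi>1, \<phi>2)\<close>, and
  \<open>(u \<otimes> u) : \<nabla>\<phi> = u\<^sup>1 (u \<bullet> \<nabla>\<phi>1) + u\<^sup>2 (u \<bullet> \<nabla>\<phi>2)\<close>.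
\<close>

definition weak_momentum ::
  "real \<Rightarrow> (real \<times> real \<Rightarrow> real) \<Rightarrow> (real \<times> real \<Rightarrow> real \<times> real) \<Rightarrow>
   (real \<Rightarrow> real \<times> real \<Rightarrow> real) \<Rightarrow> (real \<Rightarrow> real \<times> real \<Rightarrow> real) \<Rightarrow>
   (real \<Rightarrow> real \<times> real \<Rightarrow> real \<times> real) \<Rightarrow> bool" where
  "weak_momentum T rho0 u0 rho theta u \<longleftrightarrow>
     (\<forall>\<tau>\<in>{0..T}. \<forall>\<phi>1 \<phi>2. C1c_test T \<phi>1 \<and> C1c_test T \<phi>2 \<longrightarrow>
        int_Omega (\<lambda>x. rho \<tau> x * (u \<tau> x \<bullet> (\<phi>1 \<tau> x, \<phi>2 \<tau> x))
                     - rho0 x * (u0 x \<bullet> (\<phi>1 0 x, \<phi>2 0 x))) =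
        int_time_Omega \<tau> (\<lambda>t x.
            rho t x * (u t x \<bullet> (dt \<phi>1 t x, dt \<phi>2 t x))
          + rho t x * (fst (u t x) * (u t x \<bullet> grad \<phi>1 t x) + snd (u t x) * (u t x \<bullet> grad \<phi>2 t x))
          + rho t x * theta t x * (fst (grad \<phi>1 t x) + snd (grad \<phi>2 t x))))"

definition energy :: "real \<Rightarrow> real \<Rightarrow> real \<Rightarrow> real \<times> real \<Rightarrow> real" where
  "energy cv \<rho> \<theta> w = 1 / 2 * \<rho> * (norm w)\<^sup>2 + cv * \<rho> * \<theta>"

definition weak_energy ::
  "real \<Rightarrow> real \<Rightarrow> (real \<times> real \<Rightarrow> real) \<Rightarrow> (real \<times> real \<Rightarrow> real) \<Rightarrow> (real \<times> real \<Rightarrow> real \<times> real) \<Rightarrow>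
   (real \<Rightarrow> real \<times> real \<Rightarrow> real) \<Rightarrow> (real \<Rightarrow> real \<times> real \<Rightarrow> real) \<Rightarrow>
   (real \<Rightarrow> real \<times> real \<Rightarrow> real \<times> real) \<Rightarrow> bool" where
  "weak_energy T cv rho0 theta0 u0 rho theta u \<longleftrightarrow>
     (\<forall>\<tau>\<in>{0..T}. \<forall>\<phi>. C1c_test T \<phi> \<longrightarrow>
        int_Omega (\<lambda>x. energy cv (rho \<tau> x) (theta \<tau> x) (u \<tau> x) * \<phi> \<tau> x
                     - energy cv (rho0 x) (theta0 x) (u0 x) * \<phi> 0 x) =
        int_time_Omega \<tau> (\<lambda>t x.
            energy cv (rho t x) (theta t x) (u t x) * dt \<phi> t x
          + (energy cv (rho t x) (theta t x) (u t x) + rho t x * theta t x) * (u t x \<bullet> grad \<phi> t x)))"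

definition weak_entropy ::
  "real \<Rightarrow> real \<Rightarrow> (real \<times> real \<Rightarrow> real) \<Rightarrow> (real \<times> real \<Rightarrow> real) \<Rightarrow>
   (real \<Rightarrow> real \<times> real \<Rightarrow> real) \<Rightarrow> (real \<Rightarrow> real \<times> real \<Rightarrow> real) \<Rightarrow>
   (real \<Rightarrow> real \<times> real \<Rightarrow> real \<times> real) \<Rightarrow> bool" where
  "weak_entropy T cv rho0 theta0 rho theta u \<longleftrightarrow>
     (\<forall>\<tau>\<in>{0..T}. \<forall>\<phi> b.
        C1c_test T \<phi> \<and> (\<forall>t\<in>{0..T}. \<forall>x. \<phi> t x \<ge> 0) \<and>
        b C1_differentiable_on UNIV \<and> (\<forall>y. deriv b y \<ge> 0) \<longrightarrow>
        int_Omega (\<lambda>x. rho \<tau> x * b (entropy cv (rho \<tau> x) (theta \<tau> x)) * \<phi> \<tau> x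
                     - rho0 x * b (entropy cv (rho0 x) (theta0 x)) * \<phi> 0 x) \<ge>
        int_time_Omega \<tau> (\<lambda>t x.
            rho t x * b (entropy cv (rho t x) (theta t x)) * dt \<phi> t x
          + rho t x * b (entropy cv (rho t x) (theta t x)) * (u t x \<bullet> grad \<phi> t x)))"

text \<open>A bounded measurable function on \<open>[0,T] \<times> \<Omega>\<close>; values at other times are irrelevant.\<close>

definition bounded_field :: "real \<Rightarrow> (real \<Rightarrow> real \<times> real \<Rightarrow> 'a::euclidean_space) \<Rightarrow> bool" where
  "bounded_field T f \<longleftrightarrow>
     (\<forall>t\<in>{0..T}. periodic_x2 (f t)) \<and>
     (\<lambda>(t, x). f t x) \<in> borel_measurable (lebesgue_on ({0..T} \<times> UNIV)) \<and>
     bounded ((\<lambda>(t, x). f t x) ` ({0..T} \<times> UNIV))"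

definition weak_solution ::
  "real \<Rightarrow> real \<Rightarrow> (real \<times> real \<Rightarrow> real) \<Rightarrow> (real \<times> real \<Rightarrow> real) \<Rightarrow> (real \<times> real \<Rightarrow> real \<times> real) \<Rightarrow>
   (real \<Rightarrow> real \<times> real \<Rightarrow> real) \<Rightarrow> (real \<Rightarrow> real \<times> real \<Rightarrow> real) \<Rightarrow>
   (real \<Rightarrow> real \<times> real \<Rightarrow> real \<times> real) \<Rightarrow> bool" where
  "weak_solution T cv rho0 theta0 u0 rho theta u \<longleftrightarrow>
     bounded_field T rho \<and> bounded_field T theta \<and> bounded_field T u \<and>
     (\<exists>rho_b theta_b s_b u_b. AE (t, x) in lebesgue_on ({0<..<T} \<times> UNIV).
        0 < rho t x \<and> rho t x \<le> rho_b \<and> 0 < theta t x \<and> theta t x \<le> theta_b \<and>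
        \<bar>entropy cv (rho t x) (theta t x)\<bar> < s_b \<and> norm (u t x) < u_b) \<and>
     weak_mass T rho0 rho u \<and>
     weak_momentum T rho0 u0 rho theta u \<and>
     weak_energy T cv rho0 theta0 u0 rho theta u \<and>
     weak_entropy T cv rho0 theta0 rho theta u"

definition far_field ::
  "real \<Rightarrow> real filter \<Rightarrow> real \<Rightarrow> real \<Rightarrow> real \<Rightarrow>
   (real \<Rightarrow> real \<times> real \<Rightarrow> real) \<Rightarrow> (real \<Rightarrow> real \<times> real \<Rightarrow> real) \<Rightarrow>
   (real \<Rightarrow> real \<times> real \<Rightarrow> real \<times> real) \<Rightarrow> bool" where
  "far_field T F R_inf Theta_inf U_inf rho theta u \<longleftrightarrow>
     ((\<lambda>x1. LINT p:({0..T} \<times> {0..1})|lebesgue.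
          (let t = fst p; x = (x1, snd p) in
             \<bar>rho t x - R_inf\<bar> + \<bar>theta t x - Theta_inf\<bar> + \<bar>fst (u t x) - U_inf\<bar> + \<bar>snd (u t x)\<bar>))
        \<longlongrightarrow> 0) F"


subsection \<open>Shock-free solutions of the 1-D Riemann problem\<close>

text \<open>Here functions depend on \<open>(t, x\<^sub>1)\<close> only.\<close>

definition self_similar :: "real \<Rightarrow> (real \<Rightarrow> real \<Rightarrow> real) \<Rightarrow> (real \<Rightarrow> real) \<Rightarrow> bool" where
  "self_similar T f g \<longleftrightarrow> (\<forall>t\<in>{0<..T}. \<forall>x. f t x = g (x / t))"

definition locally_lipschitz :: "real \<Rightarrow> (real \<Rightarrow> real \<Rightarrow> real) \<Rightarrow> bool" where
  "locally_lipschitz T f \<longleftrightarrow>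
     (\<forall>z\<in>{0<..<T} \<times> UNIV. \<exists>\<epsilon>>0. \<exists>L.
        L-lipschitz_on (cball z \<epsilon> \<inter> ({0<..<T} \<times> UNIV)) (\<lambda>(t, x). f t x))"

text \<open>
  The initial values are attained not only by definition at \<open>t = 0\<close> but also as limits for
  \<open>t \<rightarrow> 0\<close>; the origin is excluded, because a self-similar function is constant in \<open>t\<close> there.
\<close>

definition takes_initial_data :: "(real \<Rightarrow> real \<Rightarrow> real) \<Rightarrow> (real \<Rightarrow> real) \<Rightarrow> bool" where
  "takes_initial_data f f0 \<longleftrightarrow>
     (\<forall>x. f 0 x = f0 x) \<and> (\<forall>x. x \<noteq> 0 \<longrightarrow> ((\<lambda>t. f t x) \<longlongrightarrow> f0 x) (at_right 0))"

text \<open>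
  For locally Lipschitz functions, which are differentiable almost everywhere, the equations
  hold pointwise almost everywhere. The first definition is \<open>\<partial>\<^sub>t q + \<partial>\<^sub>x f = 0\<close>.
\<close>

definition conservation_law_ae ::
  "real \<Rightarrow> (real \<Rightarrow> real \<Rightarrow> real) \<Rightarrow> (real \<Rightarrow> real \<Rightarrow> real) \<Rightarrow> bool" where
  "conservation_law_ae T q f \<longleftrightarrow>
     (AE (t, x) in lebesgue_on ({0<..<T} \<times> UNIV).
        \<exists>q_t f_x. ((\<lambda>s. q s x) has_real_derivative q_t) (at t) \<and>
                  ((\<lambda>y. f t y) has_real_derivative f_x) (at x) \<and>
                  q_t + f_x = 0)"

definition euler_1d ::
  "real \<Rightarrow> real \<Rightarrow> (real \<Rightarrow> real \<Rightarrow> real) \<Rightarrow> (real \<Rightarrow> real \<Rightarrow> real) \<Rightarrow> (real \<Rightarrow> real \<Rightarrow> real) \<Rightarrow> bool" where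
  "euler_1d T cv R Theta U \<longleftrightarrow>
     conservation_law_ae T R (\<lambda>t x. R t x * U t x) \<and>
     conservation_law_ae T (\<lambda>t x. R t x * U t x)
       (\<lambda>t x. R t x * (U t x)\<^sup>2 + R t x * Theta t x) \<and>
     conservation_law_ae T
       (\<lambda>t x. 1 / 2 * R t x * (U t x)\<^sup>2 + cv * R t x * Theta t x)
       (\<lambda>t x. (1 / 2 * R t x * (U t x)\<^sup>2 + cv * R t x * Theta t x + R t x * Theta t x) * U t x)"

definition isentropic_1d ::
  "real \<Rightarrow> real \<Rightarrow> real \<Rightarrow> (real \<Rightarrow> real \<Rightarrow> real) \<Rightarrow> (real \<Rightarrow> real \<Rightarrow> real) \<Rightarrow> bool" where
  "isentropic_1d T cv S R U \<longleftrightarrow>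
     conservation_law_ae T R (\<lambda>t x. R t x * U t x) \<and>
     (AE (t, x) in lebesgue_on ({0<..<T} \<times> UNIV).
        \<exists>U_t U_x P_x.
          ((\<lambda>s. U s x) has_real_derivative U_t) (at t) \<and>
          ((\<lambda>y. U t y) has_real_derivative U_x) (at x) \<and>
          ((\<lambda>y. R t y powr ((cv + 1) / cv)) has_real_derivative P_x) (at x) \<and>
          R t x * (U_t + U t x * U_x) + exp (S / cv) * P_x = 0)"

text \<open>
  \<open>c(r) = \<surd>p'(r)\<close> for the pressure \<open>p(r) = exp(S/c\<^sub>v) r\<^bsup>(c\<^sub>v+1)/c\<^sub>v\<^esup>\<close> of the isentropic system, whose
  characteristic speeds are \<open>v - c(r)\<close> and \<open>v + c(r)\<close>.
\<close>

definition sound_speed :: "real \<Rightarrow> real \<Rightarrow> real \<Rightarrow> real" where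
  "sound_speed cv S r = sqrt ((cv + 1) / cv * exp (S / cv) * r powr (1 / cv))"

text \<open>
  Apart from finitely many values of \<open>\<xi> = x\<^sub>1/t\<close>, the profile consists of constant states and
  centred rarefaction waves, i.e. pieces on which \<open>\<xi>\<close> is one of the characteristic speeds.
  (The relation between \<open>r\<close> and \<open>v\<close> within a wave comes from the differential equations.)
\<close>

definition rarefaction_profile ::
  "real \<Rightarrow> real \<Rightarrow> (real \<Rightarrow> real) \<Rightarrow> (real \<Rightarrow> real) \<Rightarrow> bool" where
  "rarefaction_profile cv S r v \<longleftrightarrow>
     (\<exists>E. finite E \<and> (\<forall>I. connected I \<and> I \<inter> E = {} \<longrightarrow>
        (r constant_on I \<and> v constant_on I) \<or>
        (\<forall>\<xi>\<in>I. \<xi> = v \<xi> - sound_speed cv S (r \<xi>)) \<or>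
        (\<forall>\<xi>\<in>I. \<xi> = v \<xi> + sound_speed cv S (r \<xi>))))"

definition rarefaction_wave_solution ::
  "real \<Rightarrow> real \<Rightarrow> real \<Rightarrow> (real \<Rightarrow> real \<Rightarrow> real) \<Rightarrow> (real \<Rightarrow> real \<Rightarrow> real) \<Rightarrow> bool" where
  "rarefaction_wave_solution T cv S R U \<longleftrightarrow>
     locally_lipschitz T R \<and> locally_lipschitz T U \<and>
     isentropic_1d T cv S R U \<and>
     (\<exists>r v. self_similar T R r \<and> self_similar T U v \<and> rarefaction_profile cv S r v)"

definition shock_free_solution ::
  "real \<Rightarrow> real \<Rightarrow> (real \<Rightarrow> real) \<Rightarrow> (real \<Rightarrow> real) \<Rightarrow> (real \<Rightarrow> real) \<Rightarrow>
   (real \<Rightarrow> real \<Rightarrow> real) \<Rightarrow> (real \<Rightarrow> real \<Rightarrow> real) \<Rightarrow> (real \<Rightarrow> real \<Rightarrow> real) \<Rightarrow> bool" where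
  "shock_free_solution T cv R0 Theta0 U0 R Theta U \<longleftrightarrow>
     (\<forall>t\<in>{0..T}. \<forall>x. 0 < R t x \<and> 0 < Theta t x) \<and>
     takes_initial_data R R0 \<and> takes_initial_data Theta Theta0 \<and> takes_initial_data U U0 \<and>
     (\<exists>r \<theta> v. self_similar T R r \<and> self_similar T Theta \<theta> \<and> self_similar T U v) \<and>
     locally_lipschitz T R \<and> locally_lipschitz T Theta \<and> locally_lipschitz T U \<and>
     euler_1d T cv R Theta U \<and>
     (\<exists>S. (\<forall>t\<in>{0..T}. \<forall>x. entropy cv (R t x) (Theta t x) = S \<and>
                            Theta t x = R t x powr (1 / cv) * exp (S / cv)) \<and>
          rarefaction_wave_solution T cv S R U)"

end

(*
  Relative energy method. With w = u^1 - U and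
    E = rho |u - (U,0)|^2 / 2 + cv rho theta - (cv+1) rho Theta - Theta rho (s - S) + R Theta  >=  0,
  which vanishes only at the Riemann solution, the balance laws tested with 1, -U, U^2/2 - (cv+1) Theta
  and Theta give, after cancellation of all first order terms,
    d/dt int E dx  <=  - int [ U_x (rho w^2 + E_int / cv) + rho (s - S) w Theta_x ] dx,
  where E_int is the internal part of E. The minimum principle yields s >= S; in a rarefaction U_x >= 0
  and Theta_x is proportional to U_x, and then the bracket is nonnegative by discriminants. Hence no
  Gronwall argument is needed, and the singularity of U_x at t = 0 does no harm. To obtain C^1 test
  functions the profile is replaced by Steklov averages of width eps^2 in the variable x_1/(t + eps);
  the defects they produce are O(eps).
*)
theory Submission
  imports Defs
begin

section \<open>Calculus lemmas\<close>

text \<open>The profile is described by its velocity \<open>v\<close> and sound speed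
  \<open>c\<close>, not by density and temperature. In these variables the sign of the velocity
  gradient and its control of the temperature gradient become one linear condition,
  \<open>\<bar>2 * cv * dc\<bar> \<le> dv\<close>: both Riemann invariants
  \<open>v + 2 * cv * c\<close> and \<open>v - 2 * cv * c\<close> are nondecreasing. A linear
  condition survives averaging. The two wave equations are nonlinear and do not: averaging over a
  window of width \<open>\<delta>\<close> leaves defects of order \<open>\<delta>\<close>. Since
  derivatives of a function of \<open>x1 / (t + \<epsilon>)\<close> carry the factor
  \<open>1 / (t + \<epsilon>) \<le> 1 / \<epsilon>\<close>, the defects enter the balance as
  \<open>\<delta> / \<epsilon>\<close>; this is why the width is the square of the time shift. The
  shift makes the initial relative energy nonzero, but only where \<open>\<bar>x1\<bar>\<close> is
  of order \<open>\<epsilon>\<close>. The fields are merely Lebesgue measurable, whereas the weak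
  form evaluates them on single time slices. The argument therefore runs at almost every time
  \<open>\<tau>\<close>, with Borel representatives that are correct both in space-time and on the
  slice, and measurability is used again to return from slices to space-time.\<close>

lemma max_0_square_has_real_derivative:
  "((\<lambda>x::real. (max 0 x)\<^sup>2) has_real_derivative 2 * max 0 x) (at x)"
proof -
  consider "x > 0" | "x < 0" | "x = 0" by linarith
  then show ?thesis
  proof cases
    case 1
    have "((\<lambda>x::real. x\<^sup>2) has_real_derivative 2 * max 0 x) (at x)"
      using 1 by (auto intro!: derivative_eq_intros)
    then show ?thesis
      by (rule DERIV_cong_ev[THEN iffD1, rotated 3])
         (use 1 in \<open>auto intro!: eventually_mono[OF eventually_nhds_in_open[of "{0<..}" x]]\<close>)
  next
    case 2
    have "((\<lambda>x::real. 0) has_real_derivative 2 * max 0 x) (at x)"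
      using 2 by (auto intro!: derivative_eq_intros)
    then show ?thesis
      by (rule DERIV_cong_ev[THEN iffD1, rotated 3])
         (use 2 in \<open>auto intro!: eventually_mono[OF eventually_nhds_in_open[of "{..<0}" x]]\<close>)
  next
    case 3
    have "(\<lambda>h::real. (max 0 h)\<^sup>2 / h) \<midarrow>0\<rightarrow> 0"
    proof (rule tendsto_norm_zero_cancel, rule tendsto_sandwich[of "\<lambda>_. 0" _ _ "\<lambda>h. \<bar>h\<bar>"])
      show "\<forall>\<^sub>F h::real in at 0. norm ((max 0 h)\<^sup>2 / h) \<le> \<bar>h\<bar>"
        by (intro always_eventually allI) (auto simp: max_def power2_eq_square)
      show "((\<lambda>h::real. \<bar>h\<bar>) \<longlongrightarrow> 0) (at 0)"
        by (intro tendsto_rabs_zero tendsto_ident_at)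
    qed auto
    then show ?thesis
      using 3 by (simp add: DERIV_def)
  qed
qed

text \<open>The Henstock-Kurzweil fundamental theorem tolerates finitely many points without
  derivative and requires no integrability of \<open>f'\<close> beforehand, so the kinks of a
  rarefaction profile do no harm.\<close>

lemma increment_bound_finite_exceptions:
  fixes f :: "real \<Rightarrow> real"
  assumes "a \<le> b" "finite E" "continuous_on {a..b} f" "0 \<le> K"
    and deriv: "\<And>x. x \<in> {a<..<b} \<Longrightarrow> x \<notin> E \<Longrightarrow> (f has_real_derivative f' x) (at x)"
    and bound: "\<And>x. x \<in> {a<..<b} \<Longrightarrow> x \<notin> E \<Longrightarrow> \<bar>f' x\<bar> \<le> K"
  shows "\<bar>f b - f a\<bar> \<le> K * (b - a)"
proof -
  have "(f' has_integral (f b - f a)) {a..b}"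
    by (rule fundamental_theorem_of_calculus_interior_strong[OF \<open>finite E\<close> \<open>a \<le> b\<close>])
       (use deriv assms in \<open>auto simp: has_real_derivative_iff_has_vector_derivative\<close>)
  moreover have "\<bar>f' x\<bar> \<le> K" if "x \<in> {a..b} - (E \<union> {a, b})" for x
    using bound[of x] that by auto
  ultimately have "norm (f b - f a) \<le> K * Henstock_Kurzweil_Integration.content {a..b}"
    by (intro has_integral_bound_real[of K "E \<union> {a,b}" f'])
       (use assms in auto)
  then show ?thesis using assms by simp
qed

lemma increment_nonneg_finite_exceptions:
  fixes f :: "real \<Rightarrow> real"
  assumes "a \<le> b" "finite E" "continuous_on {a..b} f"
    and deriv: "\<And>x. x \<in> {a<..<b} \<Longrightarrow> x \<notin> E \<Longrightarrow> (f has_real_derivative f' x) (at x)"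
    and nonneg: "\<And>x. x \<in> {a<..<b} \<Longrightarrow> x \<notin> E \<Longrightarrow> 0 \<le> f' x"
  shows "f a \<le> f b"
proof -
  have "(f' has_integral (f b - f a)) {a..b}"
    by (rule fundamental_theorem_of_calculus_interior_strong[OF \<open>finite E\<close> \<open>a \<le> b\<close>])
       (use deriv assms in \<open>auto simp: has_real_derivative_iff_has_vector_derivative\<close>)
  \<comment> \<open>The sign of \<open>f'\<close> is known only off the exceptional points, so it is
    replaced by 0 there without changing the integral.\<close>
  then have "((\<lambda>x. if x \<in> E \<union> {a, b} then 0 else f' x) has_integral (f b - f a)) {a..b}"
    by (rule has_integral_spike_finite[of "E \<union> {a, b}", rotated 2]) (use assms in auto)
  then have "0 \<le> f b - f a"
    by (rule has_integral_nonneg) (use nonneg in auto)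
  then show ?thesis by simp
qed

section \<open>Constancy from an almost everywhere vanishing derivative\<close>

text \<open>Sard's theorem in dimension one, transported through \<open>vec\<close> to
  \<open>real^1\<close>: a vanishing derivative has rank 0, which is less than 1.\<close>

lemma negligible_image_deriv_zero:
  fixes g :: "real \<Rightarrow> real"
  assumes "\<And>x. x \<in> S \<Longrightarrow> (g has_real_derivative 0) (at x)"
  shows "negligible (g ` S)"
proof -
  define f :: "real^1 \<Rightarrow> real^1" where "f = (\<lambda>x. vec (g (x $ 1)))"
  have "negligible (f ` (vec ` S))"
  proof (rule baby_Sard[where f' = "\<lambda>x. (\<lambda>h. 0)"])
    fix x :: "real^1" assume "x \<in> vec ` S"
    then obtain y where y: "y \<in> S" "x = vec y" by auto
    have "(g has_derivative (\<lambda>h. 0)) (at (x $ 1))"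
      using assms[OF y(1)] y(2) by (simp add: has_field_derivative_def lambda_zero)
    moreover have "((\<lambda>x::real^1. x $ 1) has_derivative (\<lambda>x. x $ 1)) (at x)"
      by (intro bounded_linear_imp_has_derivative bounded_linear_vec_nth)
    ultimately have "((\<lambda>x. g (x $ 1)) has_derivative (\<lambda>h. 0)) (at x)"
      using has_derivative_compose[of "\<lambda>x::real^1. x $ 1" "\<lambda>x. x $ 1" x UNIV g "\<lambda>h. 0"] by simp
    then have "(f has_derivative (\<lambda>h. vec 0)) (at x)"
      unfolding f_def
      by (rule bounded_linear.has_derivative[rotated]) (simp add: linear_vec flip: linear_conv_bounded_linear)
    then show "(f has_derivative (\<lambda>h. 0)) (at x within vec ` S)"
      by (simp add: has_derivative_at_withinI)
  next
    fix x :: "real^1"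
    have "matrix (\<lambda>h. 0 :: real^1) = (0 :: real^1^1)"
      by (simp add: matrix_def vec_eq_iff)
    then show "rank (matrix (\<lambda>h. 0 :: real^1) :: real^1^1) < CARD(1)"
      by (simp add: rank_0)
  qed simp
  then have "negligible ((\<lambda>x. x $ 1) ` (f ` (vec ` S)))"
    by (rule negligible_locally_Lipschitz_image[rotated])
       (auto intro!: exI[of _ "UNIV :: (real^1) set"] exI[of _ "1::real"] component_le_norm_cart
          simp flip: vector_minus_component)
  then show ?thesis
    by (simp add: f_def image_image)
qed

text \<open>The image of \<open>I\<close> is negligible: where the derivative is 0 by Sard,
  elsewhere as the Lipschitz image of a null set. Being also connected, the image cannot contain two
  points.\<close>

lemma locally_lipschitz_deriv_AE_zero_constant:
  fixes g :: "real \<Rightarrow> real"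
  assumes "connected I"
    and lip: "\<And>x. x \<in> I \<Longrightarrow> \<exists>e>0. \<exists>L. L-lipschitz_on (ball x e) g"
    and ae: "AE x in lborel. x \<in> I \<longrightarrow> (g has_real_derivative 0) (at x)"
  shows "g constant_on I"
proof -
  define S where "S = {x\<in>I. (g has_real_derivative 0) (at x)}"
  have "AE x in lebesgue. x \<notin> I - S"
    using ae unfolding AE_completion_iff by (rule eventually_mono) (auto simp: S_def)
  then have "I - S \<in> null_sets lebesgue"
    using completion.complete2[of "I - S"] by (auto simp: eventually_ae_filter)
  then have "negligible (I - S)"
    by (simp add: negligible_iff_null_sets)
  then have "negligible (g ` (I - S))"
  proof (rule negligible_locally_Lipschitz_image[rotated])
    fix x assume "x \<in> I - S"
    then obtain e L where e: "e > 0" "L-lipschitz_on (ball x e) g" using lip[of x] by blast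
    have "norm (g y - g x) \<le> L * norm (y - x)" if "y \<in> ball x e" for y
      using lipschitz_onD[OF e(2) that, of x] e(1) by (simp add: dist_norm)
    then show "\<exists>T B. open T \<and> x \<in> T \<and> (\<forall>y\<in>(I - S) \<inter> T. norm (g y - g x) \<le> B * norm (y - x))"
      using e(1) by (intro exI[of _ "ball x e"] exI[of _ L]) auto
  qed simp
  moreover have "negligible (g ` S)"
    by (rule negligible_image_deriv_zero) (auto simp: S_def)
  ultimately have neg: "negligible (g ` I)"
    by (rule negligible_subset[OF negligible_Un]) (auto simp: S_def)
  have "continuous_on I g"
  proof (rule continuous_at_imp_continuous_on, rule ballI)
    fix x assume "x \<in> I"
    then obtain e L where e: "e > 0" "L-lipschitz_on (ball x e) g" using lip[of x] by blast
    then show "isCont g x"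
      using lipschitz_on_continuous_on[OF e(2)] by (simp add: continuous_on_eq_continuous_at)
  qed
  then have "connected (g ` I)"
    using \<open>connected I\<close> by (rule connected_continuous_image)
  have "a = b" if "a \<in> g ` I" "b \<in> g ` I" for a b
  proof (rule ccontr)
    assume "a \<noteq> b"
    define l u where "l = min a b" and "u = max a b"
    have "l < u" using \<open>a \<noteq> b\<close> by (auto simp: l_def u_def)
    have "{l..u} \<subseteq> g ` I"
      using connected_contains_Icc[OF \<open>connected (g ` I)\<close>] that
      by (simp add: l_def u_def min_def max_def)
    then have "negligible {l..u}" using neg negligible_subset by blast
    then show False
      using \<open>l < u\<close> negligible_interval(1)[of l u] by simp
  qed
  then show ?thesis
    unfolding constant_on_def by (cases "I = {}") blast+
qed

section \<open>Rarefaction profiles\<close>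

lemma sound_speed_pos: "cv > 0 \<Longrightarrow> r > 0 \<Longrightarrow> 0 < sound_speed cv S r"
  by (simp add: sound_speed_def)

text \<open>The sound speed is a constant times \<open>r powr (1 / (2 * cv))\<close>, so its
  logarithmic derivative is \<open>1 / (2 * cv * r)\<close>.\<close>

lemma sound_speed_has_real_derivative:
  assumes "cv > 0" "r > 0"
  shows "(sound_speed cv S has_real_derivative sound_speed cv S r / (2 * cv * r)) (at r)"
proof -
  let ?A = "(cv + 1) / cv * exp (S / cv)"
  have A: "?A > 0" using assms by simp
  have eq: "sound_speed cv S y = sqrt ?A * y powr (1 / (2 * cv))" if "y > 0" for y
  proof -
    have "sqrt (y powr (1 / cv)) = y powr (1 / (2 * cv))"
      by (simp add: powr_powr mult.commute flip: powr_half_sqrt)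
    moreover have "sqrt (?A * y powr (1 / cv)) = sqrt ?A * sqrt (y powr (1 / cv))"
      by (rule real_sqrt_mult)
    ultimately show ?thesis unfolding sound_speed_def by metis
  qed
  have "((\<lambda>y. sqrt ?A * y powr (1 / (2 * cv))) has_real_derivative
      sqrt ?A * (1 / (2 * cv) * r powr (1 / (2 * cv) - 1))) (at r)"
    by (intro DERIV_cmult has_real_derivative_powr) (use assms in auto)
  also have "sqrt ?A * (1 / (2 * cv) * r powr (1 / (2 * cv) - 1)) = sound_speed cv S r / (2 * cv * r)"
    using assms by (simp add: eq powr_diff)
  finally show ?thesis
    by (rule DERIV_cong_ev[THEN iffD1, rotated 3])
       (use assms eq in \<open>auto intro!: eventually_mono[OF eventually_nhds_in_open[of "{0<..}" r]]\<close>)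
qed

text \<open>Inside a fan there are two relations between the slopes of \<open>v\<close> and
  \<open>r\<close>: the derivative of the characteristic identity, and the mass equation, which in
  the similarity variable reads \<open>(r v)' = \<xi> r'\<close>. Together they force the slope of
  \<open>v\<close> to be the constant \<open>\<kappa>\<close>, so \<open>v\<close> is
  affine.\<close>

lemma centred_rarefaction_affine:
  fixes r v :: "real \<Rightarrow> real" and cv :: real
  defines "\<kappa> \<equiv> 2 * cv / (2 * cv + 1)"
  assumes cv: "cv > 0" and r: "\<And>\<xi>. 0 < r \<xi>"
    and I: "open I" "connected I" "\<xi>0 \<in> I" and \<sigma>: "\<sigma> = 1 \<or> \<sigma> = -1"
    and char: "\<And>\<xi>. \<xi> \<in> I \<Longrightarrow> \<xi> = v \<xi> + \<sigma> * sound_speed cv S (r \<xi>)"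
    and lip: "\<And>x. \<exists>e>0. \<exists>L. L-lipschitz_on (ball x e) v"
    and ae: "AE \<xi> in lborel. \<exists>q f. (r has_real_derivative q) (at \<xi>) \<and>
              ((\<lambda>\<xi>. r \<xi> * v \<xi>) has_real_derivative f) (at \<xi>) \<and> f = \<xi> * q"
  shows "\<forall>\<xi>\<in>I. v \<xi> = v \<xi>0 + \<kappa> * (\<xi> - \<xi>0)"
proof -
  have deriv: "((\<lambda>\<xi>. v \<xi> - \<kappa> * \<xi>) has_real_derivative 0) (at \<xi>)"
    if "\<xi> \<in> I" "(r has_real_derivative q) (at \<xi>)"
      "((\<lambda>\<xi>. r \<xi> * v \<xi>) has_real_derivative f) (at \<xi>)" "f = \<xi> * q" for \<xi> q f
  proof -
    let ?c = "sound_speed cv S (r \<xi>)"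
    have cpos: "?c > 0" using sound_speed_pos cv r by blast
    define dv where "dv = 1 - \<sigma> * (?c / (2 * cv * r \<xi>) * q)"
    have "((\<lambda>y. y - \<sigma> * sound_speed cv S (r y)) has_real_derivative dv) (at \<xi>)"
      unfolding dv_def
      by (intro DERIV_diff DERIV_ident DERIV_cmult
          DERIV_chain2[OF sound_speed_has_real_derivative that(2)] cv r)
    then have v: "(v has_real_derivative dv) (at \<xi>)"
    proof (rule DERIV_cong_ev[THEN iffD1, rotated 3])
      show "\<forall>\<^sub>F y in nhds \<xi>. y - \<sigma> * sound_speed cv S (r y) = v y"
        using eventually_nhds_in_open[OF I(1) that(1)]
        by eventually_elim (use char in fastforce)
    qed auto
    have "((\<lambda>\<xi>. r \<xi> * v \<xi>) has_real_derivative (r \<xi> * dv + q * v \<xi>)) (at \<xi>)"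
      using DERIV_mult[OF that(2) v] by (simp add: algebra_simps)
    then have "f = r \<xi> * dv + q * v \<xi>" using that(3) DERIV_unique by blast
    then have *: "r \<xi> * dv = (\<xi> - v \<xi>) * q" using that(4) by (simp add: algebra_simps)
    have "\<xi> - v \<xi> = \<sigma> * ?c" using char[OF that(1)] by linarith
    then have **: "r \<xi> * dv = \<sigma> * ?c * q" using * by simp
    \<comment> \<open>Inserting \<open>**\<close> into the definition of \<open>dv\<close>
      eliminates the unknown slope \<open>q\<close> of the density; the linear equation that remains
      has the solution \<open>\<kappa>\<close>.\<close>
    have "dv = 1 - dv / (2 * cv)"
    proof -
      have "dv = 1 - (\<sigma> * ?c * q) / (2 * cv * r \<xi>)" by (simp add: dv_def)
      also have "\<dots> = 1 - dv / (2 * cv)" using ** r[of \<xi>] by (simp flip: **)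
      finally show ?thesis .
    qed
    then have "dv = \<kappa>" using cv unfolding \<kappa>_def by (simp add: field_simps)
    then show ?thesis
      using v by (auto intro!: derivative_eq_intros)
  qed
  have "(\<lambda>\<xi>. v \<xi> - \<kappa> * \<xi>) constant_on I"
  proof (rule locally_lipschitz_deriv_AE_zero_constant[OF I(2)])
    fix x
    obtain e L where e: "e > 0" "L-lipschitz_on (ball x e) v" using lip[of x] by blast
    have "\<bar>\<kappa>\<bar>-lipschitz_on (ball x e) (\<lambda>\<xi>. \<kappa> * \<xi>)"
      by (rule lipschitz_onI) (auto simp: dist_real_def abs_mult simp flip: right_diff_distrib)
    from lipschitz_on_diff[OF e(2) this] e(1)
    show "\<exists>e>0. \<exists>L. L-lipschitz_on (ball x e) (\<lambda>\<xi>. v \<xi> - \<kappa> * \<xi>)" by blast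
  next
    show "AE x in lborel. x \<in> I \<longrightarrow> ((\<lambda>\<xi>. v \<xi> - \<kappa> * \<xi>) has_real_derivative 0) (at x)"
      using ae by eventually_elim (use deriv in blast)
  qed
  then obtain k where k: "\<And>\<xi>. \<xi> \<in> I \<Longrightarrow> v \<xi> - \<kappa> * \<xi> = k" unfolding constant_on_def by blast
  show ?thesis
  proof
    fix \<xi> assume "\<xi> \<in> I"
    from k[OF this] k[OF I(3)] show "v \<xi> = v \<xi>0 + \<kappa> * (\<xi> - \<xi>0)" by (simp add: algebra_simps)
  qed
qed

section \<open>Reduction to the similarity variable\<close>

lemma locally_lipschitz_profile:
  assumes T: "T > 0" and lip: "locally_lipschitz T f" and sim: "self_similar T f g"
  shows "\<exists>e>0. \<exists>L. L-lipschitz_on (ball x e) g"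
proof -
  define z where "z = (T / 2, x * (T / 2))"
  have "z \<in> {0<..<T} \<times> UNIV" using T by (auto simp: z_def)
  then obtain \<epsilon> L where L: "\<epsilon> > 0"
      "L-lipschitz_on (cball z \<epsilon> \<inter> ({0<..<T} \<times> UNIV)) (\<lambda>(t, x). f t x)"
    using lip unfolding locally_lipschitz_def by blast
  define e where "e = \<epsilon> / (T / 2)"
  have e: "e > 0" using L(1) T by (simp add: e_def)
  have g: "g y = (\<lambda>(t, x). f t x) (T / 2, y * (T / 2))" for y
    using sim T unfolding self_similar_def by simp
  have mem: "(T / 2, y * (T / 2)) \<in> cball z \<epsilon> \<inter> ({0<..<T} \<times> UNIV)" if "y \<in> ball x e" for y
  proof -
    have "dist (x * (T / 2)) (y * (T / 2)) = dist x y * (T / 2)"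
      using T by (simp add: dist_real_def abs_mult flip: left_diff_distrib diff_divide_distrib)
    also have "\<dots> \<le> \<epsilon>" using that T by (simp add: e_def field_simps)
    finally show ?thesis using T by (simp add: z_def dist_Pair_Pair)
  qed
  have "(L * (T / 2))-lipschitz_on (ball x e) g"
  proof (rule lipschitz_onI)
    fix a b assume ab: "a \<in> ball x e" "b \<in> ball x e"
    have "dist (g a) (g b) \<le> L * dist (T / 2, a * (T / 2)) (T / 2, b * (T / 2))"
      unfolding g by (rule lipschitz_onD[OF L(2)]) (use mem ab in blast)+
    also have "dist (T / 2, a * (T / 2)) (T / 2, b * (T / 2)) = (T / 2) * dist a b"
      using T by (simp add: dist_Pair_Pair dist_real_def abs_mult flip: left_diff_distrib diff_divide_distrib)
    finally show "dist (g a) (g b) \<le> L * (T / 2) * dist a b" by (simp add: mult.assoc)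
  next
    show "0 \<le> L * (T / 2)" using lipschitz_on_nonneg[OF L(2)] T by simp
  qed
  then show ?thesis using e by blast
qed

lemma AE_lborel_interval_witness:
  fixes T :: real
  assumes "T > 0" "AE t in lborel. t \<in> {0<..<T} \<longrightarrow> P t"
  obtains t where "0 < t" "t < T" "P t"
proof (rule ccontr)
  assume "\<not> thesis"
  with that have no: "\<not> P t" if "t \<in> {0<..<T}" for t using \<open>t \<in> {0<..<T}\<close> by auto
  have "AE t in lborel. t \<notin> {0<..<T}"
    using assms(2) by (rule eventually_mono) (use no in blast)
  then have "{0<..<T} \<in> null_sets lborel" by (subst AE_iff_null_sets) auto
  then show False using assms(1) by (auto simp: null_sets_def)
qed

text \<open>By Fubini the law holds at some fixed time \<open>t\<close> for almost every
  \<open>x\<close>. With \<open>x = t * \<xi>\<close>, the space derivative of the flux yields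
  \<open>h'\<close> and the time derivative of the density yields \<open>g'\<close>, and
  \<open>q_t + f_x = 0\<close> becomes \<open>h' = \<xi> g'\<close>.\<close>

lemma conservation_law_profile:
  assumes T: "T > 0" and q: "self_similar T q g" and f: "self_similar T f h"
    and law: "conservation_law_ae T q f"
  shows "AE \<xi> in lborel. \<exists>a b. (g has_real_derivative a) (at \<xi>) \<and> (h has_real_derivative b) (at \<xi>) \<and> b = \<xi> * a"
proof -
  let ?P = "\<lambda>t x. \<exists>q_t f_x. ((\<lambda>s. q s x) has_real_derivative q_t) (at t) \<and>
                  ((\<lambda>y. f t y) has_real_derivative f_x) (at x) \<and> q_t + f_x = 0"
  have "AE z in lebesgue. z \<in> {0<..<T} \<times> (UNIV::real set) \<longrightarrow> (case z of (t, x) \<Rightarrow> ?P t x)"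
    using law unfolding conservation_law_ae_def
    by (subst (asm) AE_restrict_space_iff) (auto intro!: sets_completionI_sets borel_open open_Times)
  then have "AE z in (lborel \<Otimes>\<^sub>M lborel). z \<in> {0<..<T} \<times> (UNIV::real set) \<longrightarrow> (case z of (t, x) \<Rightarrow> ?P t x)"
    unfolding lborel_prod AE_completion_iff .
  from lborel_pair.AE_pair[OF this]
  have "AE t in lborel. t \<in> {0<..<T} \<longrightarrow> (AE x in lborel. ?P t x)"
    by eventually_elim auto
  then obtain t where t: "0 < t" "t < T" and ae: "AE x in lborel. ?P t x"
    by (rule AE_lborel_interval_witness[OF T]) blast
  from ae obtain N where N: "\<And>x. x \<in> space lborel - N \<Longrightarrow> ?P t x" "N \<in> null_sets lborel"
    by (rule AE_E3) blast
  then have [measurable]: "N \<in> sets borel" by auto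
  have "AE \<xi> in lborel. 0 + t * \<xi> \<notin> N"
    by (rule AE_borel_affine) (use t N in \<open>auto simp: AE_not_in\<close>)
  \<comment> \<open>On the line \<open>x = 0\<close> the similarity variable does not move with
    time, so a time derivative says nothing about \<open>g\<close> at 0.\<close>
  moreover have "AE \<xi> in lborel. \<xi> \<noteq> (0::real)" by (rule AE_lborel_singleton)
  ultimately show ?thesis
  proof eventually_elim
    case (elim \<xi>)
    then have "?P t (t * \<xi>)" using N(1) by auto
    then obtain q_t f_x where D: "((\<lambda>s. q s (t * \<xi>)) has_real_derivative q_t) (at t)"
      "((\<lambda>y. f t y) has_real_derivative f_x) (at (t * \<xi>))" "q_t + f_x = 0" by blast
    have "((\<lambda>y. f t (t * y)) has_real_derivative (f_x * t)) (at \<xi>)"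
      by (rule DERIV_chain2[where f = "f t" and g = "\<lambda>y. t * y"])
         (use D(2) in \<open>auto intro!: derivative_eq_intros\<close>)
    then have b: "(h has_real_derivative (f_x * t)) (at \<xi>)"
      using f t by (simp add: self_similar_def)
    have "((\<lambda>s. q s (t * \<xi>)) has_real_derivative q_t) (at (t * \<xi> / \<xi>))" using D(1) elim by simp
    \<comment> \<open>Near \<open>\<xi>\<close> the profile is read off along the vertical line
      \<open>x = t * \<xi>\<close>: the time at which this line meets the ray of slope
      \<open>y\<close> is \<open>t * \<xi> / y\<close>, hence
      \<open>g y = q (t * \<xi> / y) (t * \<xi>)\<close>.\<close>
    then have "((\<lambda>y. q (t * \<xi> / y) (t * \<xi>)) has_real_derivative (q_t * (- (t * \<xi>) / \<xi>\<^sup>2))) (at \<xi>)"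
      by (rule DERIV_chain2[where f = "\<lambda>s. q s (t * \<xi>)" and g = "\<lambda>y. t * \<xi> / y"])
         (use elim in \<open>auto intro!: derivative_eq_intros simp: power2_eq_square\<close>)
    then have a: "(g has_real_derivative (q_t * (- (t * \<xi>) / \<xi>\<^sup>2))) (at \<xi>)"
    proof (rule DERIV_cong_ev[THEN iffD1, rotated 3])
      have "((\<lambda>y. t * \<xi> / y) \<longlongrightarrow> t * \<xi> / \<xi>) (nhds \<xi>)"
        unfolding tendsto_at_iff_tendsto_nhds[symmetric] isCont_def[symmetric]
        using elim by (auto intro!: continuous_intros)
      then have "\<forall>\<^sub>F y in nhds \<xi>. t * \<xi> / y \<in> {0<..<T}"
        by (rule topological_tendstoD) (use t elim in auto)
      moreover have "\<forall>\<^sub>F y in nhds \<xi>. y \<in> - {0}"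
        by (rule eventually_nhds_in_open) (use elim in auto)
      ultimately show "\<forall>\<^sub>F y in nhds \<xi>. q (t * \<xi> / y) (t * \<xi>) = g y"
        by eventually_elim (use q t elim in \<open>auto simp: self_similar_def\<close>)
    qed auto
    have "f_x = - q_t" using D(3) by simp
    then have "f_x * t = \<xi> * (q_t * (- (t * \<xi>) / \<xi>\<^sup>2))"
      using elim by (simp add: power2_eq_square)
    with a b show ?case by blast
  qed
qed

section \<open>Simple waves in terms of velocity and sound speed\<close>

text \<open>The last two equations are the momentum and the mass equation of the isentropic system
  in the similarity variable, with \<open>r' / r\<close> expressed as
  \<open>2 * cv * c' / c\<close>. The bounds on \<open>dv\<close> and \<open>dc\<close> make the
  profile Lipschitz and both Riemann invariants monotone.\<close>

definition wave_profile :: "real \<Rightarrow> (real \<Rightarrow> real) \<Rightarrow> (real \<Rightarrow> real) \<Rightarrow> bool" where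
  "wave_profile cv v c \<longleftrightarrow>
     continuous_on UNIV v \<and> continuous_on UNIV c \<and> (\<forall>\<xi>. 0 < c \<xi>) \<and>
     (\<exists>E. finite E \<and> (\<forall>\<xi>. \<xi> \<notin> E \<longrightarrow> (\<exists>dv dc.
        (v has_real_derivative dv) (at \<xi>) \<and> (c has_real_derivative dc) (at \<xi>) \<and>
        0 \<le> dv \<and> dv \<le> 1 \<and> \<bar>2 * cv * dc\<bar> \<le> dv \<and>
        (v \<xi> - \<xi>) * dv + 2 * cv * c \<xi> * dc = 0 \<and>
        (v \<xi> - \<xi>) * (2 * cv * dc) + c \<xi> * dv = 0)))"

lemma simple_wave_derivatives:
  fixes r v :: "real \<Rightarrow> real" and cv :: real
  assumes cv: "cv > 0" and r: "\<And>\<xi>. 0 < r \<xi>"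
    and I: "open I" "connected I" "\<xi> \<in> I" and \<sigma>: "\<sigma> = 1 \<or> \<sigma> = -1"
    and char: "\<And>\<xi>. \<xi> \<in> I \<Longrightarrow> \<xi> = v \<xi> + \<sigma> * sound_speed cv S (r \<xi>)"
    and lip: "\<And>x. \<exists>e>0. \<exists>L. L-lipschitz_on (ball x e) v"
    and ae: "AE \<xi> in lborel. \<exists>q f. (r has_real_derivative q) (at \<xi>) \<and>
              ((\<lambda>\<xi>. r \<xi> * v \<xi>) has_real_derivative f) (at \<xi>) \<and> f = \<xi> * q"
  shows "(v has_real_derivative (2 * cv / (2 * cv + 1))) (at \<xi>)"
    and "((\<lambda>x. sound_speed cv S (r x)) has_real_derivative (\<sigma> / (2 * cv + 1))) (at \<xi>)"
proof -
  let ?\<kappa> = "2 * cv / (2 * cv + 1)"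
  note aff = centred_rarefaction_affine[OF cv r I \<sigma> char lip ae]
  have ev: "\<forall>\<^sub>F y in nhds \<xi>. y \<in> I" by (rule eventually_nhds_in_open[OF I(1,3)])
  show "(v has_real_derivative ?\<kappa>) (at \<xi>)"
  proof (rule DERIV_cong_ev[THEN iffD2])
    show "\<forall>\<^sub>F y in nhds \<xi>. v y = v \<xi> + ?\<kappa> * (y - \<xi>)"
      using ev by eventually_elim (use aff in auto)
    show "((\<lambda>y. v \<xi> + ?\<kappa> * (y - \<xi>)) has_real_derivative ?\<kappa>) (at \<xi>)"
      using cv by (auto intro!: derivative_eq_intros)
  qed auto
  have c: "sound_speed cv S (r y) = \<sigma> * (y - v y)" if "y \<in> I" for y
    using char[OF that] \<sigma> by auto
  show "((\<lambda>x. sound_speed cv S (r x)) has_real_derivative (\<sigma> / (2 * cv + 1))) (at \<xi>)"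
  proof (rule DERIV_cong_ev[THEN iffD2])
    show "\<forall>\<^sub>F y in nhds \<xi>. sound_speed cv S (r y) = \<sigma> * (y - (v \<xi> + ?\<kappa> * (y - \<xi>)))"
      using ev by eventually_elim (use aff c in auto)
    have "\<sigma> * (1 - ?\<kappa>) = \<sigma> / (2 * cv + 1)" using cv by (simp add: field_simps)
    moreover have "((\<lambda>y. \<sigma> * (y - (v \<xi> + k * (y - \<xi>)))) has_real_derivative \<sigma> * (1 - k)) (at \<xi>)" for k
      by (auto intro!: derivative_eq_intros)
    ultimately show "((\<lambda>y. \<sigma> * (y - (v \<xi> + ?\<kappa> * (y - \<xi>)))) has_real_derivative \<sigma> / (2 * cv + 1)) (at \<xi>)"
      by metis
  qed auto
qed

text \<open>On constant pieces all slopes are 0. On a fan \<open>dv\<close> is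
  \<open>2 * cv / (2 * cv + 1)\<close> and \<open>dc\<close> is
  \<open>\<sigma> / (2 * cv + 1)\<close>, so the bound on \<open>2 * cv * dc\<close> holds with
  equality.\<close>

lemma rarefaction_profile_wave_profile:
  fixes r v :: "real \<Rightarrow> real" and cv :: real
  assumes cv: "cv > 0" and r: "\<And>\<xi>. 0 < r \<xi>"
    and profile: "rarefaction_profile cv S r v"
    and lip_r: "\<And>x. \<exists>e>0. \<exists>L. L-lipschitz_on (ball x e) r"
    and lip: "\<And>x. \<exists>e>0. \<exists>L. L-lipschitz_on (ball x e) v"
    and ae: "AE \<xi> in lborel. \<exists>q f. (r has_real_derivative q) (at \<xi>) \<and>
              ((\<lambda>\<xi>. r \<xi> * v \<xi>) has_real_derivative f) (at \<xi>) \<and> f = \<xi> * q"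
  shows "wave_profile cv v (\<lambda>\<xi>. sound_speed cv S (r \<xi>))"
proof -
  let ?c = "\<lambda>\<xi>. sound_speed cv S (r \<xi>)"
  let ?\<kappa> = "2 * cv / (2 * cv + 1)"
  have lip_cont: "continuous_on UNIV f"
    if lipf: "\<And>x. \<exists>e>0. \<exists>L. L-lipschitz_on (ball x e) f" for f :: "real \<Rightarrow> real"
  proof (rule continuous_at_imp_continuous_on, rule ballI)
    fix x :: real
    obtain e L where e: "e > 0" "L-lipschitz_on (ball x e) f" using lipf[of x] by blast
    then show "isCont f x"
      using lipschitz_on_continuous_on[OF e(2)] by (simp add: continuous_on_eq_continuous_at)
  qed
  have cpos: "0 < ?c \<xi>" for \<xi> using sound_speed_pos cv r by blast
  obtain E where E: "finite E" and pieces: "\<And>I. connected I \<Longrightarrow> I \<inter> E = {} \<Longrightarrow>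
        (r constant_on I \<and> v constant_on I) \<or>
        (\<forall>\<xi>\<in>I. \<xi> = v \<xi> - ?c \<xi>) \<or> (\<forall>\<xi>\<in>I. \<xi> = v \<xi> + ?c \<xi>)"
    using profile unfolding rarefaction_profile_def by blast
  have "\<exists>dv dc. (v has_real_derivative dv) (at \<xi>) \<and> (?c has_real_derivative dc) (at \<xi>) \<and>
        0 \<le> dv \<and> dv \<le> 1 \<and> \<bar>2 * cv * dc\<bar> \<le> dv \<and>
        (v \<xi> - \<xi>) * dv + 2 * cv * ?c \<xi> * dc = 0 \<and>
        (v \<xi> - \<xi>) * (2 * cv * dc) + ?c \<xi> * dv = 0" if notin: "\<xi> \<notin> E" for \<xi>
  proof -
    have "open (- E)" using E by (simp add: finite_imp_closed open_Compl)
    then obtain e where e: "e > 0" "ball \<xi> e \<subseteq> - E"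
      using notin by (meson ComplI open_contains_ball)
    let ?I = "ball \<xi> e"
    have I: "open ?I" "connected ?I" "\<xi> \<in> ?I" using e by auto
    have simple: ?thesis if \<sigma>: "\<sigma> = 1 \<or> \<sigma> = -1" and char: "\<And>\<eta>. \<eta> \<in> ?I \<Longrightarrow> \<eta> = v \<eta> + \<sigma> * ?c \<eta>" for \<sigma>
    proof -
      note d = simple_wave_derivatives[OF cv r I \<sigma> char lip ae]
      \<comment> \<open>With this and \<open>2 * cv * dc = \<sigma> * dv\<close>, both wave
        equations reduce to \<open>\<sigma> * \<sigma> = 1\<close>.\<close>
      have *: "v \<xi> - \<xi> = - \<sigma> * ?c \<xi>" using char[OF I(3)] by simp
      have "\<sigma> * \<sigma> = 1" using \<sigma> by auto
      then show ?thesis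
        using cv \<sigma> by (intro exI[of _ ?\<kappa>] exI[of _ "\<sigma> / (2 * cv + 1)"] conjI d)
            (auto simp: * field_simps abs_mult)
    qed
    have "?I \<inter> E = {}" using e by auto
    from pieces[OF I(2) this] consider "r constant_on ?I \<and> v constant_on ?I"
      | "\<forall>\<xi>\<in>?I. \<xi> = v \<xi> - ?c \<xi>" | "\<forall>\<xi>\<in>?I. \<xi> = v \<xi> + ?c \<xi>" by blast
    then show ?thesis
    proof cases
      case 1
      then obtain a b where ab: "\<And>y. y \<in> ?I \<Longrightarrow> r y = a" "\<And>y. y \<in> ?I \<Longrightarrow> v y = b"
        unfolding constant_on_def by blast
      have ev: "\<forall>\<^sub>F y in nhds \<xi>. y \<in> ?I" by (rule eventually_nhds_in_open[OF I(1,3)])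
      have "(v has_real_derivative 0) (at \<xi>)"
        by (rule DERIV_cong_ev[THEN iffD2, of _ \<xi> _ "\<lambda>_. b" _ 0])
           (use ev ab in \<open>auto elim!: eventually_mono\<close>)
      moreover have "(?c has_real_derivative 0) (at \<xi>)"
        by (rule DERIV_cong_ev[THEN iffD2, of _ \<xi> _ "\<lambda>_. sound_speed cv S a" _ 0])
           (use ev ab in \<open>auto elim!: eventually_mono\<close>)
      ultimately show ?thesis by (intro exI[of _ 0]) auto
    next
      case 2
      then show ?thesis by (intro simple[of "-1"]) auto
    next
      case 3
      then show ?thesis by (intro simple[of 1]) auto
    qed
  qed
  moreover have "continuous_on UNIV ?c"
    using lip_cont[OF lip_r] r unfolding sound_speed_def
    by (intro continuous_intros) (auto simp: less_imp_neq[symmetric])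
  ultimately show ?thesis
    unfolding wave_profile_def using lip_cont[OF lip] cpos E by blast
qed

text \<open>Beyond the outermost exceptional points the profile is a single piece on each side. It
  cannot be a fan, because there \<open>\<xi>\<close> would equal \<open>v\<close> plus or minus the
  sound speed, which converges while \<open>\<xi>\<close> does not; hence it is constant and equal
  to its limit.\<close>

lemma rarefaction_profile_eventually_constant:
  fixes r v :: "real \<Rightarrow> real" and cv :: real
  assumes cv: "cv > 0" and profile: "rarefaction_profile cv S r v"
    and lim: "(v \<longlongrightarrow> v1) at_top" "(r \<longlongrightarrow> r1) at_top" "(v \<longlongrightarrow> v0) at_bot" "(r \<longlongrightarrow> r0) at_bot"
    and pos: "r0 > 0" "r1 > 0"
  shows "\<exists>M>0. (\<forall>\<xi>>M. v \<xi> = v1 \<and> r \<xi> = r1) \<and> (\<forall>\<xi>< -M. v \<xi> = v0 \<and> r \<xi> = r0)"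
proof -
  let ?c = "\<lambda>\<xi>. sound_speed cv S (r \<xi>)"
  obtain E where E: "finite E" and pieces: "\<And>I. connected I \<Longrightarrow> I \<inter> E = {} \<Longrightarrow>
        (r constant_on I \<and> v constant_on I) \<or>
        (\<forall>\<xi>\<in>I. \<xi> = v \<xi> - ?c \<xi>) \<or> (\<forall>\<xi>\<in>I. \<xi> = v \<xi> + ?c \<xi>)"
    using profile unfolding rarefaction_profile_def by blast
  obtain M where M: "M > 0" "\<And>x. x \<in> E \<Longrightarrow> \<bar>x\<bar> \<le> M"
    using finite_imp_bounded[OF E] unfolding bounded_pos by auto
  have clim: "((\<lambda>\<xi>. ?c \<xi>) \<longlongrightarrow> sound_speed cv S a) F" if "(r \<longlongrightarrow> a) F" "a > 0" for F a
    using that unfolding sound_speed_def by (intro tendsto_intros) auto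
  have noid: False if "\<forall>\<^sub>F \<xi> in F. \<xi> = v \<xi> + \<sigma> * ?c \<xi>" "(v \<longlongrightarrow> b) F" "(r \<longlongrightarrow> a) F" "a > 0"
      "filterlim (\<lambda>x. x) at_infinity F" "F \<noteq> bot" for F \<sigma> a b
  proof -
    have "((\<lambda>\<xi>. v \<xi> + \<sigma> * ?c \<xi>) \<longlongrightarrow> b + \<sigma> * sound_speed cv S a) F"
      by (intro tendsto_intros that clim)
    then have "((\<lambda>\<xi>. \<xi>) \<longlongrightarrow> b + \<sigma> * sound_speed cv S a) F"
      by (rule Lim_transform_eventually) (use that(1) in \<open>auto elim: eventually_mono\<close>)
    then show False
      using that(5,6) not_tendsto_and_filterlim_at_infinity by blast
  qed
  have const: "\<forall>\<xi>\<in>I. v \<xi> = b \<and> r \<xi> = a"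
    if I: "connected I" "I \<inter> E = {}" "\<forall>\<^sub>F \<xi> in F. \<xi> \<in> I" and F: "(v \<longlongrightarrow> b) F" "(r \<longlongrightarrow> a) F" "a > 0"
      "filterlim (\<lambda>x. x) at_infinity F" "F \<noteq> bot" for F I a b
    using pieces[OF I(1,2)]
  proof (elim disjE conjE)
    assume c: "r constant_on I" "v constant_on I"
    then obtain a' b' where ab: "\<And>y. y \<in> I \<Longrightarrow> r y = a'" "\<And>y. y \<in> I \<Longrightarrow> v y = b'"
      unfolding constant_on_def by blast
    have "(r \<longlongrightarrow> a') F" "(v \<longlongrightarrow> b') F"
      by (rule tendsto_eventually, use I(3) ab in \<open>auto elim!: eventually_mono\<close>)+
    then have "a' = a" "b' = b" using F tendsto_unique by blast+
    then show ?thesis using ab by blast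
  next
    assume "\<forall>\<xi>\<in>I. \<xi> = v \<xi> - ?c \<xi>"
    then have "\<forall>\<^sub>F \<xi> in F. \<xi> = v \<xi> + (-1) * ?c \<xi>" using I(3) by (auto elim!: eventually_mono)
    then show ?thesis using noid[OF _ F] by blast
  next
    assume "\<forall>\<xi>\<in>I. \<xi> = v \<xi> + ?c \<xi>"
    then have "\<forall>\<^sub>F \<xi> in F. \<xi> = v \<xi> + 1 * ?c \<xi>" using I(3) by (auto elim!: eventually_mono)
    then show ?thesis using noid[OF _ F] by blast
  qed
  have "{M<..} \<inter> E = {}" "{..< -M} \<inter> E = {}" using M(2) by force+
  have "\<forall>\<xi>\<in>{M<..}. v \<xi> = v1 \<and> r \<xi> = r1"
    by (rule const[of _ at_top])
       (use lim pos \<open>{M<..} \<inter> E = {}\<close> in \<open>auto simp: eventually_gt_at_top filterlim_at_top_imp_at_infinity filterlim_ident\<close>)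
  moreover have "\<forall>\<xi>\<in>{..< -M}. v \<xi> = v0 \<and> r \<xi> = r0"
    by (rule const[of _ at_bot])
       (use lim pos \<open>{..< -M} \<inter> E = {}\<close> in
        \<open>auto simp: eventually_gt_at_bot filterlim_at_bot_imp_at_infinity filterlim_ident\<close>)
  ultimately show ?thesis using M(1) by auto
qed

text \<open>The interface between the shock-free solution and the uniqueness argument: afterwards
  only \<open>v\<close>, \<open>c\<close> and \<open>S\<close> occur, temperature being a multiple
  of the squared sound speed and density a power of temperature.\<close>

lemma shock_free_wave_profile:
  assumes T: "T > 0" and cv: "cv > 0" and pos: "R_L > 0" "R_R > 0"
    and sf: "shock_free_solution T cv (riemann R_L R_R) (riemann Theta_L Theta_R) (riemann U_L U_R) R Theta U"
  obtains S v c M c_L c_R where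
    "wave_profile cv v c" "M > 0"
    "\<And>\<xi>. \<xi> > M \<Longrightarrow> v \<xi> = U_R \<and> c \<xi> = c_R" "\<And>\<xi>. \<xi> < -M \<Longrightarrow> v \<xi> = U_L \<and> c \<xi> = c_L"
    "Theta_L = cv / (cv + 1) * c_L\<^sup>2" "Theta_R = cv / (cv + 1) * c_R\<^sup>2"
    "entropy cv R_L Theta_L = S" "entropy cv R_R Theta_R = S"
    "\<And>t x. t \<in> {0<..T} \<Longrightarrow> U t x = v (x / t) \<and> Theta t x = cv / (cv + 1) * (c (x / t))\<^sup>2
        \<and> R t x = exp (- S) * Theta t x powr cv"
proof -
  have Rpos: "0 < R t x" "0 < Theta t x" if "t \<in> {0..T}" for t x
    using sf that unfolding shock_free_solution_def by auto
  have init: "takes_initial_data R (riemann R_L R_R)" "takes_initial_data Theta (riemann Theta_L Theta_R)"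
     "takes_initial_data U (riemann U_L U_R)"
    using sf unfolding shock_free_solution_def by auto
  obtain S where S: "\<And>t x. t \<in> {0..T} \<Longrightarrow> entropy cv (R t x) (Theta t x) = S"
      "\<And>t x. t \<in> {0..T} \<Longrightarrow> Theta t x = R t x powr (1 / cv) * exp (S / cv)"
      and rw: "rarefaction_wave_solution T cv S R U"
    using sf unfolding shock_free_solution_def by blast
  obtain r v where sim: "self_similar T R r" "self_similar T U v" and prof: "rarefaction_profile cv S r v"
    and lip: "locally_lipschitz T R" "locally_lipschitz T U"
    and law: "conservation_law_ae T R (\<lambda>t x. R t x * U t x)"
    using rw unfolding rarefaction_wave_solution_def isentropic_1d_def by blast
  let ?c = "\<lambda>\<xi>. sound_speed cv S (r \<xi>)"
  have rpos: "0 < r \<xi>" for \<xi>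
  proof -
    have "R T (\<xi> * T) = r \<xi>" using sim T by (simp add: self_similar_def)
    then show ?thesis using Rpos(1)[of T "\<xi> * T"] T by simp
  qed
  have "self_similar T (\<lambda>t x. R t x * U t x) (\<lambda>\<xi>. r \<xi> * v \<xi>)"
    using sim by (simp add: self_similar_def)
  then have wp: "wave_profile cv v ?c"
    by (intro rarefaction_profile_wave_profile cv rpos prof
        locally_lipschitz_profile[OF T lip(1) sim(1)] locally_lipschitz_profile[OF T lip(2) sim(2)]
        conservation_law_profile[OF T sim(1) _ law])
  \<comment> \<open>At the fixed points 1 and -1, letting \<open>t\<close> tend to 0 sends
    \<open>x / t\<close> to plus and minus infinity, so the initial data are the limits of the
    profile.\<close>
  have limit_top: "(g \<longlongrightarrow> b) at_top" and limit_bot: "(g \<longlongrightarrow> a) at_bot"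
    if f: "takes_initial_data f (riemann a b)" "self_similar T f g" for f g and a b :: real
  proof -
    have ev: "\<forall>\<^sub>F t in at_right 0. f t x = g (x / t)" for x
    proof -
      have "\<forall>\<^sub>F t in at_right 0. t \<in> {0<..<T}" using T by (rule eventually_at_right_real)
      then show ?thesis by eventually_elim (use f(2) in \<open>auto simp: self_similar_def\<close>)
    qed
    have "((\<lambda>t. f t 1) \<longlongrightarrow> b) (at_right 0)"
      using f(1) unfolding takes_initial_data_def riemann_def by (auto dest!: spec[of _ 1])
    then have "((\<lambda>t. g (inverse t)) \<longlongrightarrow> b) (at_right 0)"
      by (rule Lim_transform_eventually) (use ev[of 1] in \<open>simp add: inverse_eq_divide\<close>)
    then show "(g \<longlongrightarrow> b) at_top" by (subst filterlim_at_top_to_right)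
    have "((\<lambda>t. f t (-1)) \<longlongrightarrow> a) (at_right 0)"
      using f(1) unfolding takes_initial_data_def riemann_def by (auto dest!: spec[of _ "-1"])
    then have "((\<lambda>t. g (- inverse t)) \<longlongrightarrow> a) (at_right 0)"
      by (rule Lim_transform_eventually) (use ev[of "-1"] in \<open>simp add: inverse_eq_divide\<close>)
    then show "(g \<longlongrightarrow> a) at_bot"
      unfolding filterlim_at_bot_mirror by (subst filterlim_at_top_to_right)
  qed
  obtain M where M: "M > 0" "\<And>\<xi>. \<xi> > M \<Longrightarrow> v \<xi> = U_R \<and> r \<xi> = R_R"
    "\<And>\<xi>. \<xi> < -M \<Longrightarrow> v \<xi> = U_L \<and> r \<xi> = R_L"
    using rarefaction_profile_eventually_constant[OF cv prof, of U_R R_R U_L R_L]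
      limit_top[OF init(1) sim(1)] limit_top[OF init(3) sim(2)]
      limit_bot[OF init(1) sim(1)] limit_bot[OF init(3) sim(2)] pos by blast
  \<comment> \<open>For this pressure law the squared sound speed is \<open>(cv + 1) / cv\<close>
    times the temperature.\<close>
  have csq: "cv / (cv + 1) * (sound_speed cv S a)\<^sup>2 = a powr (1 / cv) * exp (S / cv)" for a
    using cv by (simp add: sound_speed_def)
  have data: "R 0 1 = R_R" "R 0 (-1) = R_L" "Theta 0 1 = Theta_R" "Theta 0 (-1) = Theta_L"
    using init unfolding takes_initial_data_def by (auto simp: riemann_def)
  show thesis
  proof (rule that[OF wp M(1), of "sound_speed cv S R_R" "sound_speed cv S R_L" S])
    show "Theta_L = cv / (cv + 1) * (sound_speed cv S R_L)\<^sup>2"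
         "Theta_R = cv / (cv + 1) * (sound_speed cv S R_R)\<^sup>2"
      unfolding csq using S(2)[of 0 "-1"] S(2)[of 0 1] data T by auto
    show "entropy cv R_L Theta_L = S" "entropy cv R_R Theta_R = S"
      using S(1)[of 0 "-1"] S(1)[of 0 1] data T by auto
    fix t x assume t: "t \<in> {0<..T}"
    then have "R t x = r (x / t)" "U t x = v (x / t)" using sim by (auto simp: self_similar_def)
    moreover have "R t x = exp (- S) * Theta t x powr cv"
    proof -
      have "exp S = Theta t x powr cv / R t x"
        using S(1)[of t x] Rpos[of t x] t by (auto simp: entropy_def)
      then show ?thesis using Rpos[of t x] t by (simp add: exp_minus field_simps)
    qed
    ultimately show "U t x = v (x / t) \<and> Theta t x = cv / (cv + 1) * (?c (x / t))\<^sup>2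
        \<and> R t x = exp (- S) * Theta t x powr cv"
      unfolding csq using S(2)[of t x] t by auto
  qed (use M in auto)
qed

section \<open>Pointwise entropy inequalities\<close>

lemma exp_excess_nonneg: "0 \<le> exp x - 1 - (x::real)"
  using exp_ge_add_one_self[of x] by linarith

lemma exp_excess_ge_half_square:
  fixes x :: real assumes "x \<ge> 0" shows "x\<^sup>2 \<le> 2 * (exp x - 1 - x)"
  using exp_lower_Taylor_quadratic[OF assms] by simp

text \<open>With \<open>a = ln (\<theta>/\<Theta>)\<close> and \<open>b = ln (R/\<rho>)\<close> the entropy excess is \<open>cv a + b\<close> and the right-hand side
  is the internal part of the relative energy; nonnegativity of the excess removes the regime of
  large negative \<open>a\<close>, \<open>b\<close>, in which the inequality fails.\<close>

lemma entropy_excess_square_le: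
  fixes a b cv :: real
  assumes cv: "cv > 0" and nonneg: "cv * a + b \<ge> 0"
  shows "(cv * a + b)\<^sup>2 \<le> 2 * (cv + 1) * (cv * (exp a - 1 - a) + (exp b - 1 - b))"
proof -
  define p q where "p = max a 0" and "q = max b 0"
  have le: "cv * a + b \<le> cv * p + q" using cv by (simp add: p_def q_def add_mono)
  have half: "(max x 0)\<^sup>2 \<le> 2 * (exp x - 1 - x)" for x :: real
  proof (cases "x \<le> 0")
    case True
    then have "(max x 0)\<^sup>2 = 0" by (simp add: max_def)
    then show ?thesis using exp_excess_nonneg[of x] by (metis mult_nonneg_nonneg zero_le_numeral)
  next
    case False
    then show ?thesis using exp_excess_ge_half_square[of x] by (simp add: max_def)
  qed
  have "(cv * a + b)\<^sup>2 \<le> (cv * p + q)\<^sup>2"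
    using nonneg le by (rule power_mono[rotated])
  \<comment> \<open>Cauchy-Schwarz with the weights \<open>cv\<close> and 1, written as an identity
    with its remainder.\<close>
  also have "\<dots> = (cv + 1) * (cv * p\<^sup>2 + q\<^sup>2) - cv * (p - q)\<^sup>2"
    by (simp add: power2_eq_square algebra_simps)
  also have "\<dots> \<le> (cv + 1) * (cv * p\<^sup>2 + q\<^sup>2)" using cv by simp
  also have "\<dots> \<le> (cv + 1) * (cv * (2 * (exp a - 1 - a)) + 2 * (exp b - 1 - b))"
    using cv half[of a] half[of b] unfolding p_def q_def
    by (intro mult_left_mono add_mono) auto
  finally show ?thesis by (simp add: algebra_simps)
qed

section \<open>Relative internal energy\<close>

text \<open>The Bregman distance of the internal energy, seen as a function of density and total
  entropy \<open>\<rho> * s\<close>, from the state with temperature \<open>h\<close> and specific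
  entropy \<open>S\<close>. That state has density \<open>exp (- S) * h powr cv\<close>, and the
  last summand is its pressure.\<close>

definition rel_internal :: "real \<Rightarrow> real \<Rightarrow> real \<Rightarrow> real \<Rightarrow> real \<Rightarrow> real" where
  "rel_internal cv S \<rho> \<theta> h =
     cv * \<rho> * \<theta> - (cv + 1) * \<rho> * h - \<rho> * (entropy cv \<rho> \<theta> - S) * h + exp (- S) * h powr (cv + 1)"

text \<open>Logarithms of the temperature and density ratios separate the variables: the entropy
  excess becomes linear, and the energy a sum of two one-dimensional excesses of the exponential
  over its tangent.\<close>

lemma rel_internal_eq:
  fixes cv S \<rho> \<theta> h :: real
  assumes "cv > 0" "\<rho> > 0" "\<theta> > 0" "h > 0"
  defines "a \<equiv> ln (\<theta> / h)" and "b \<equiv> ln (exp (- S) * h powr cv / \<rho>)"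
  shows "entropy cv \<rho> \<theta> - S = cv * a + b"
    and "rel_internal cv S \<rho> \<theta> h = \<rho> * h * (cv * (exp a - 1 - a) + (exp b - 1 - b))"
proof -
  show s: "entropy cv \<rho> \<theta> - S = cv * a + b"
    using assms(1-4) by (simp add: entropy_def a_def b_def ln_div ln_mult ln_powr algebra_simps)
  have a: "exp a = \<theta> / h" and b: "exp b = exp (- S) * h powr cv / \<rho>"
    using assms(1-4) by (simp_all add: a_def b_def)
  have "\<rho> * h * exp a = \<rho> * \<theta>" "\<rho> * h * exp b = exp (- S) * h powr (cv + 1)"
    unfolding a b using assms(1-4) by (simp_all add: powr_add)
  then show "rel_internal cv S \<rho> \<theta> h = \<rho> * h * (cv * (exp a - 1 - a) + (exp b - 1 - b))"
    unfolding rel_internal_def s by (simp only: algebra_simps)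
qed

lemma rel_internal_nonneg:
  assumes "cv > 0" "\<rho> > 0" "\<theta> > 0" "h > 0"
  shows "0 \<le> rel_internal cv S \<rho> \<theta> h"
  unfolding rel_internal_eq(2)[OF assms]
  by (intro mult_nonneg_nonneg add_nonneg_nonneg exp_excess_nonneg) (use assms in auto)

text \<open>The exponential meets its tangent at 0 only there, so both logarithmic ratios
  vanish.\<close>

lemma rel_internal_eq_0:
  assumes "cv > 0" "\<rho> > 0" "\<theta> > 0" "h > 0" and zero: "rel_internal cv S \<rho> \<theta> h \<le> 0"
  shows "\<theta> = h" "\<rho> = exp (- S) * h powr cv"
proof -
  define a b where "a = ln (\<theta> / h)" and "b = ln (exp (- S) * h powr cv / \<rho>)"
  have pos: "x = 0" if "exp x - 1 - x \<le> 0" for x :: real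
  proof -
    have "exp x - 1 = x" using that exp_ge_add_one_self[of x] by linarith
    then have "exp x = 1" by (intro ln_eq_minus_one) simp_all
    then show ?thesis by simp
  qed
  have "cv * (exp a - 1 - a) + (exp b - 1 - b) \<le> 0"
    using zero assms unfolding rel_internal_eq(2)[OF assms(1-4)] a_def b_def
    by (simp add: mult_le_0_iff)
  moreover have "0 \<le> exp a - 1 - a" "0 \<le> exp b - 1 - b"
    by (rule exp_excess_nonneg)+
  moreover have "0 \<le> cv * (exp a - 1 - a)" using assms(1) calculation(2) by simp
  ultimately have "cv * (exp a - 1 - a) \<le> 0" "exp b - 1 - b \<le> 0" by linarith+
  then have "a = 0" "b = 0" using pos assms(1) by (auto simp: mult_le_0_iff)
  then show "\<theta> = h" "\<rho> = exp (- S) * h powr cv"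
    using assms(1-4) by (auto simp: a_def b_def)
qed

text \<open>Discriminant form of the decisive inequality: the indefinite term is controlled by the
  compression-free part because \<open>v\<^sub>x \<ge> 0\<close> and \<open>2 cv \<bar>c\<^sub>x\<bar> \<le> v\<^sub>x\<close>.\<close>

lemma rarefaction_dissipation_nonneg:
  fixes cv S \<rho> \<theta> c dv dc w :: real
  assumes cv: "cv > 0" and pos: "\<rho> > 0" "\<theta> > 0" "c > 0" and s: "entropy cv \<rho> \<theta> \<ge> S"
    and dv: "dv \<ge> 0" "\<bar>2 * cv * dc\<bar> \<le> dv"
  defines "h \<equiv> cv / (cv + 1) * c\<^sup>2"
  shows "0 \<le> dv * (\<rho> * w\<^sup>2 + rel_internal cv S \<rho> \<theta> h / cv)
           + \<rho> * (entropy cv \<rho> \<theta> - S) * w * (cv / (cv + 1) * (2 * c * dc))"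
proof -
  define d where "d = entropy cv \<rho> \<theta> - S"
  define E where "E = rel_internal cv S \<rho> \<theta> h"
  have h: "h > 0" using cv pos by (simp add: h_def)
  have d0: "d \<ge> 0" using s by (simp add: d_def)
  have E0: "E \<ge> 0" unfolding E_def by (rule rel_internal_nonneg[OF cv pos(1,2) h])
  have "d\<^sup>2 * (\<rho> * h) \<le> 2 * (cv + 1) * E"
  proof -
    have "d\<^sup>2 \<le> 2 * (cv + 1) * (E / (\<rho> * h))"
      using entropy_excess_square_le[OF cv, of "ln (\<theta> / h)" "ln (exp (- S) * h powr cv / \<rho>)"] d0 pos h
      unfolding d_def E_def rel_internal_eq[OF cv pos(1,2) h]
      by (simp del: exp_ln)
    then show ?thesis using pos h by (simp add: field_simps)
  qed
  then have dE: "\<rho> * cv * (c * d)\<^sup>2 \<le> 2 * (cv + 1)\<^sup>2 * E"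
    using cv by (simp add: h_def power2_eq_square field_simps)
  \<comment> \<open>Chosen so that the indefinite term has modulus
    \<open>\<rho> * k * \<bar>w\<bar> * \<bar>2 * cv * dc\<bar>\<close>, to which the slope
    condition applies directly.\<close>
  define k where "k = c / (cv + 1) * d"
  have kE: "\<rho> * cv * k\<^sup>2 \<le> 2 * E"
    using dE cv by (simp add: k_def power_divide power_mult_distrib divide_le_eq algebra_simps)
  have "\<bar>\<rho> * d * w * (cv / (cv + 1) * (2 * c * dc))\<bar> = \<rho> * k * \<bar>w\<bar> * \<bar>2 * cv * dc\<bar>"
    using pos d0 cv by (simp add: k_def abs_mult)
  also have "\<dots> \<le> \<rho> * k * \<bar>w\<bar> * dv"
    using pos d0 cv dv by (intro mult_left_mono) (auto simp: k_def)
  also have "\<dots> \<le> dv * (\<rho> * w\<^sup>2 + E / cv)"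
  proof -
    \<comment> \<open>Completing the square needs only \<open>k\<^sup>2 / 4\<close>; the larger
      \<open>k\<^sup>2 / 2\<close> is used because \<open>kE\<close> pays for exactly that amount
      with \<open>E / cv\<close>.\<close>
    have "k * \<bar>w\<bar> \<le> w\<^sup>2 + k\<^sup>2 / 2"
    proof -
      have "k * \<bar>w\<bar> \<le> w\<^sup>2 + k\<^sup>2 / 4"
        using zero_le_power2[of "\<bar>w\<bar> - k / 2"] by (simp add: power2_eq_square algebra_simps)
      moreover have "0 \<le> k\<^sup>2" by simp
      ultimately show ?thesis by linarith
    qed
    then have "\<rho> * (k * \<bar>w\<bar>) \<le> \<rho> * (w\<^sup>2 + k\<^sup>2 / 2)" using pos by simp
    also have "\<dots> \<le> \<rho> * w\<^sup>2 + E / cv"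
      using kE cv by (simp add: field_simps)
    finally show ?thesis using dv(1) by (metis mult.assoc mult.commute mult_left_mono)
  qed
  finally have "\<bar>\<rho> * d * w * (cv / (cv + 1) * (2 * c * dc))\<bar> \<le> dv * (\<rho> * w\<^sup>2 + E / cv)" .
  moreover have "0 \<le> y + x" if "\<bar>x\<bar> \<le> y" for x y :: real using that by linarith
  ultimately show ?thesis unfolding d_def E_def by blast
qed

section \<open>Smoothing the profile\<close>

text \<open>The sampling clauses say that smoothed values are values of the profile at nearby
  points; bounds, positivity, far states and convergence all follow from them. In the last two
  clauses, \<open>2 * \<delta>\<close> accounts for replacing \<open>w \<xi> - \<xi>\<close> by its
  value at a point of the window, against slopes at most 1, and \<open>\<delta> / (2 * cv)\<close>
  for replacing the sound speed.\<close>

definition smooth_profile ::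
  "real \<Rightarrow> real \<Rightarrow> (real \<Rightarrow> real) \<Rightarrow> (real \<Rightarrow> real) \<Rightarrow> (real \<Rightarrow> real) \<Rightarrow> (real \<Rightarrow> real) \<Rightarrow>
   (real \<Rightarrow> real) \<Rightarrow> (real \<Rightarrow> real) \<Rightarrow> bool" where
  "smooth_profile cv \<delta> v c w w' k k' \<longleftrightarrow>
     (\<forall>\<xi>. (w has_real_derivative w' \<xi>) (at \<xi>)) \<and> (\<forall>\<xi>. (k has_real_derivative k' \<xi>) (at \<xi>)) \<and>
     continuous_on UNIV w' \<and> continuous_on UNIV k' \<and>
     (\<forall>\<xi>. \<exists>\<zeta>\<in>{\<xi>..\<xi>+\<delta>}. w \<xi> = v \<zeta>) \<and> (\<forall>\<xi>. \<exists>\<zeta>\<in>{\<xi>..\<xi>+\<delta>}. k \<xi> = c \<zeta>) \<and>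
     (\<forall>\<xi>. 0 \<le> w' \<xi> \<and> \<bar>2 * cv * k' \<xi>\<bar> \<le> w' \<xi>) \<and>
     (\<forall>\<xi>. \<bar>(w \<xi> - \<xi>) * w' \<xi> + 2 * cv * k \<xi> * k' \<xi>\<bar> \<le> (2 + 1 / (2 * cv)) * \<delta>) \<and>
     (\<forall>\<xi>. \<bar>(w \<xi> - \<xi>) * (2 * cv * k' \<xi>) + k \<xi> * w' \<xi>\<bar> \<le> (2 + 1 / (2 * cv)) * \<delta>)"

lemma continuous_antiderivative:
  fixes f :: "real \<Rightarrow> real"
  assumes "continuous_on UNIV f"
  obtains F where "\<And>x. (F has_real_derivative f x) (at x)"
proof -
  have "\<exists>F. \<forall>x::real. -\<infinity> < ereal x \<longrightarrow> ereal x < \<infinity> \<longrightarrow> (F has_vector_derivative f x) (at x)"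
    by (rule einterval_antiderivative) (use assms in \<open>auto simp: continuous_on_eq_continuous_at\<close>)
  then have "\<exists>F. \<forall>x. (F has_real_derivative f x) (at x)"
    by (simp add: has_real_derivative_iff_has_vector_derivative)
  then show thesis using that by blast
qed

text \<open>The mean over the forward window from \<open>x\<close> to \<open>x + \<delta>\<close>,
  written as a difference quotient of an antiderivative; the mean value theorem turns it into a
  sampled value.\<close>

lemma steklov_average:
  fixes f :: "real \<Rightarrow> real"
  assumes "continuous_on UNIV f" "\<delta> > 0"
  obtains g where "\<And>x. (g has_real_derivative (f (x + \<delta>) - f x) / \<delta>) (at x)"
    "\<And>x. \<exists>z\<in>{x..x+\<delta>}. g x = f z"
proof -
  obtain F where F: "\<And>x. (F has_real_derivative f x) (at x)"
    using continuous_antiderivative[OF assms(1)] by blast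
  show thesis
  proof
    fix x
    have "((\<lambda>x. F (x + \<delta>)) has_real_derivative f (x + \<delta>)) (at x)"
      using F[of "x + \<delta>"] by (rule DERIV_shift[THEN iffD1])
    then show "((\<lambda>x. (F (x + \<delta>) - F x) / \<delta>) has_real_derivative (f (x + \<delta>) - f x) / \<delta>) (at x)"
      by (intro DERIV_cdivide DERIV_diff F)
    have "\<exists>z>x. z < x + \<delta> \<and> F (x + \<delta>) - F x = (x + \<delta> - x) * f z"
      by (rule MVT2) (use assms(2) F in simp_all)
    then obtain z where "x < z" "z < x + \<delta>" "F (x + \<delta>) - F x = (x + \<delta> - x) * f z"
      by blast
    then show "\<exists>z\<in>{x..x+\<delta>}. (F (x + \<delta>) - F x) / \<delta> = f z"
      using assms(2) by (intro bexI[of _ z]) auto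
  qed
qed

text \<open>The slope of an average is an increment of the profile over the window, so linear slope
  conditions pass over. For the nonlinear equations the coefficients are frozen at \<open>x\<close>;
  over the window the increment then has a derivative of order \<open>\<delta>\<close>, because the
  exact equations hold at every regular point \<open>y\<close>.\<close>

lemma smooth_profile_exists:
  assumes cv: "cv > 0" and \<delta>: "\<delta> > 0" and prof: "wave_profile cv v c"
  shows "\<exists>w w' k k'. smooth_profile cv \<delta> v c w w' k k'"
proof -
  have cont: "continuous_on UNIV v" "continuous_on UNIV c" and cpos: "\<And>\<xi>. 0 < c \<xi>"
    using prof unfolding wave_profile_def by auto
  then have cont': "continuous_on A v" "continuous_on A c" for A
    using continuous_on_subset subset_UNIV by blast+
  define Q where "Q \<xi> dv dc \<longleftrightarrow>
        (v has_real_derivative dv) (at \<xi>) \<and> (c has_real_derivative dc) (at \<xi>) \<and>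
        0 \<le> dv \<and> dv \<le> 1 \<and> \<bar>2 * cv * dc\<bar> \<le> dv \<and>
        (v \<xi> - \<xi>) * dv + 2 * cv * c \<xi> * dc = 0 \<and>
        (v \<xi> - \<xi>) * (2 * cv * dc) + c \<xi> * dv = 0" for \<xi> dv dc
  obtain E where E: "finite E" and ex: "\<forall>\<xi>. \<xi> \<notin> E \<longrightarrow> (\<exists>dv dc. Q \<xi> dv dc)"
    using prof unfolding wave_profile_def Q_def by (elim conjE exE) blast
  obtain dv dc where Q: "\<And>\<xi>. \<xi> \<notin> E \<Longrightarrow> Q \<xi> (dv \<xi>) (dc \<xi>)"
    using ex by metis
  note D = Q[unfolded Q_def, THEN conjunct1]
    Q[unfolded Q_def, THEN conjunct2, THEN conjunct1]
    Q[unfolded Q_def, THEN conjunct2, THEN conjunct2, THEN conjunct1]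
    Q[unfolded Q_def, THEN conjunct2, THEN conjunct2, THEN conjunct2, THEN conjunct1]
    Q[unfolded Q_def, THEN conjunct2, THEN conjunct2, THEN conjunct2, THEN conjunct2, THEN conjunct1]
    Q[unfolded Q_def, THEN conjunct2, THEN conjunct2, THEN conjunct2, THEN conjunct2, THEN conjunct2, THEN conjunct1]
    Q[unfolded Q_def, THEN conjunct2, THEN conjunct2, THEN conjunct2, THEN conjunct2, THEN conjunct2, THEN conjunct2]
  obtain w where w: "\<And>x. (w has_real_derivative (v (x + \<delta>) - v x) / \<delta>) (at x)"
    "\<And>x. \<exists>z\<in>{x..x+\<delta>}. w x = v z"
    using steklov_average[OF cont(1) \<delta>] by blast
  obtain k where k: "\<And>x. (k has_real_derivative (c (x + \<delta>) - c x) / \<delta>) (at x)"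
    "\<And>x. \<exists>z\<in>{x..x+\<delta>}. k x = c z"
    using steklov_average[OF cont(2) \<delta>] by blast
  have dc_le: "\<bar>dc x\<bar> \<le> 1 / (2 * cv)" if "x \<notin> E" for x
    using D(4,5)[OF that] cv by (simp add: abs_mult field_simps)
  have incr_v: "\<bar>v y - v x\<bar> \<le> y - x" and incr_c: "\<bar>c y - c x\<bar> \<le> 1 / (2 * cv) * (y - x)"
    if "x \<le> y" for x y
    using increment_bound_finite_exceptions[OF that E cont'(1), of 1 dv] D(1,3,4)
      increment_bound_finite_exceptions[OF that E cont'(2), of "1 / (2 * cv)" dc] D(2) dc_le cv
    by force+
  have near: "\<bar>w x - v y\<bar> \<le> \<delta>" "\<bar>k x - c y\<bar> \<le> 1 / (2 * cv) * \<delta>" if y: "y \<in> {x..x+\<delta>}" for x y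
  proof -
    have aux: "\<bar>f z - f y\<bar> \<le> K * \<delta>" if "z \<in> {x..x+\<delta>}" "K \<ge> 0"
      "\<And>x y. x \<le> y \<Longrightarrow> \<bar>f y - f x\<bar> \<le> K * (y - x)" for K z and f :: "real \<Rightarrow> real"
    proof -
      have "\<bar>f z - f y\<bar> \<le> K * \<bar>z - y\<bar>"
        using that(3)[of z y] that(3)[of y z] by (cases "z \<le> y") (auto simp: abs_minus_commute)
      also have "\<dots> \<le> K * \<delta>" using that y by (intro mult_left_mono) auto
      finally show ?thesis .
    qed
    show "\<bar>w x - v y\<bar> \<le> \<delta>"
      using w(2)[of x] aux[of _ 1 v] incr_v by fastforce
    show "\<bar>k x - c y\<bar> \<le> 1 / (2 * cv) * \<delta>"
      using k(2)[of x] aux[of _ "1 / (2 * cv)" c] incr_c cv by fastforce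
  qed
  \<comment> \<open>For frozen coefficients \<open>A\<close> and \<open>B\<close>: one factor
    \<open>\<delta>\<close> is the size of the derivative, the other the length of the window, and
    the latter is divided out below.\<close>
  have err: "\<bar>A * v (x + \<delta>) + B * c (x + \<delta>) - (A * v x + B * c x)\<bar> \<le> (2 + 1 / (2 * cv)) * \<delta> * \<delta>"
    if "\<And>y. y \<in> {x<..<x+\<delta>} \<Longrightarrow> y \<notin> E \<Longrightarrow> \<bar>A * dv y + B * dc y\<bar> \<le> (2 + 1 / (2 * cv)) * \<delta>" for A B x
  proof -
    have "\<bar>(A * v (x + \<delta>) + B * c (x + \<delta>)) - (A * v x + B * c x)\<bar> \<le> (2 + 1 / (2 * cv)) * \<delta> * (x + \<delta> - x)"
      by (rule increment_bound_finite_exceptions[OF _ E, where f' = "\<lambda>y. A * dv y + B * dc y"])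
         (use \<delta> cv that in \<open>auto intro!: continuous_intros cont' derivative_eq_intros D(1,2)\<close>)
    then show ?thesis by simp
  qed
  have err1: "\<bar>(w x - x) * ((v (x + \<delta>) - v x) / \<delta>) + 2 * cv * k x * ((c (x + \<delta>) - c x) / \<delta>)\<bar>
      \<le> (2 + 1 / (2 * cv)) * \<delta>" for x
  proof -
    have "\<bar>(w x - x) * v (x + \<delta>) + (2 * cv * k x) * c (x + \<delta>) - ((w x - x) * v x + (2 * cv * k x) * c x)\<bar>
         \<le> (2 + 1 / (2 * cv)) * \<delta> * \<delta>"
    proof (rule err)
      fix y assume y: "y \<in> {x<..<x+\<delta>}" "y \<notin> E"
      \<comment> \<open>The exact equation at \<open>y\<close> is subtracted, which leaves only
        differences between coefficients at \<open>x\<close> and at \<open>y\<close>.\<close>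
      have "(w x - x) * dv y + 2 * cv * k x * dc y =
         ((w x - v y) - (x - y)) * dv y + (k x - c y) * (2 * cv * dc y)"
        using D(6)[OF y(2)] by (simp add: algebra_simps)
      also have "\<bar>\<dots>\<bar> \<le> \<bar>(w x - v y) - (x - y)\<bar> * \<bar>dv y\<bar> + \<bar>k x - c y\<bar> * \<bar>2 * cv * dc y\<bar>"
        by (metis abs_mult abs_triangle_ineq)
      also have "\<dots> \<le> (2 * \<delta>) * 1 + (1 / (2 * cv) * \<delta>) * 1"
        using near[of y x] y(1) D(3,4,5)[OF y(2)] \<delta> cv
        by (intro add_mono mult_mono) auto
      finally show "\<bar>(w x - x) * dv y + 2 * cv * k x * dc y\<bar> \<le> (2 + 1 / (2 * cv)) * \<delta>"
        by (simp add: algebra_simps)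
    qed
    then have "\<bar>((w x - x) * v (x + \<delta>) + (2 * cv * k x) * c (x + \<delta>) - ((w x - x) * v x + (2 * cv * k x) * c x)) / \<delta>\<bar>
       \<le> (2 + 1 / (2 * cv)) * \<delta>" using \<delta> by (simp add: abs_divide pos_divide_le_eq)
    then show ?thesis by (simp add: diff_divide_distrib add_divide_distrib algebra_simps)
  qed
  have err2: "\<bar>(w x - x) * (2 * cv * ((c (x + \<delta>) - c x) / \<delta>)) + k x * ((v (x + \<delta>) - v x) / \<delta>)\<bar>
      \<le> (2 + 1 / (2 * cv)) * \<delta>" for x
  proof -
    have "\<bar>k x * v (x + \<delta>) + (2 * cv * (w x - x)) * c (x + \<delta>) - (k x * v x + (2 * cv * (w x - x)) * c x)\<bar>
         \<le> (2 + 1 / (2 * cv)) * \<delta> * \<delta>"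
    proof (rule err)
      fix y assume y: "y \<in> {x<..<x+\<delta>}" "y \<notin> E"
      have "k x * dv y + 2 * cv * (w x - x) * dc y =
         ((w x - v y) - (x - y)) * (2 * cv * dc y) + (k x - c y) * dv y"
        using D(7)[OF y(2)] by (simp add: algebra_simps)
      also have "\<bar>\<dots>\<bar> \<le> \<bar>(w x - v y) - (x - y)\<bar> * \<bar>2 * cv * dc y\<bar> + \<bar>k x - c y\<bar> * \<bar>dv y\<bar>"
        by (metis abs_mult abs_triangle_ineq)
      also have "\<dots> \<le> (2 * \<delta>) * 1 + (1 / (2 * cv) * \<delta>) * 1"
        using near[of y x] y(1) D(3,4,5)[OF y(2)] \<delta> cv
        by (intro add_mono mult_mono) auto
      finally show "\<bar>k x * dv y + 2 * cv * (w x - x) * dc y\<bar> \<le> (2 + 1 / (2 * cv)) * \<delta>"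
        by (simp add: algebra_simps)
    qed
    then have "\<bar>(k x * v (x + \<delta>) + (2 * cv * (w x - x)) * c (x + \<delta>) - (k x * v x + (2 * cv * (w x - x)) * c x)) / \<delta>\<bar>
       \<le> (2 + 1 / (2 * cv)) * \<delta>" using \<delta> by (simp add: abs_divide pos_divide_le_eq)
    then show ?thesis by (simp add: diff_divide_distrib add_divide_distrib algebra_simps)
  qed
  have mono: "0 \<le> (v (x + \<delta>) - v x) / \<delta>" "\<bar>2 * cv * ((c (x + \<delta>) - c x) / \<delta>)\<bar> \<le> (v (x + \<delta>) - v x) / \<delta>" for x
  proof -
    \<comment> \<open>The values 1 and -1 of \<open>\<sigma>\<close> give the two Riemann
      invariants, the value 0 the velocity itself.\<close>
    have s: "v x + \<sigma> * (2 * cv * c x) \<le> v (x + \<delta>) + \<sigma> * (2 * cv * c (x + \<delta>))" if \<sigma>: "\<bar>\<sigma>\<bar> \<le> 1" for \<sigma>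
    proof (rule increment_nonneg_finite_exceptions[OF _ E,
          where f = "\<lambda>y. v y + \<sigma> * (2 * cv * c y)" and f' = "\<lambda>y. dv y + \<sigma> * (2 * cv * dc y)"
            and a = x and b = "x + \<delta>"])
      fix y assume "y \<notin> E"
      have "\<bar>\<sigma> * (2 * cv * dc y)\<bar> \<le> 1 * dv y"
        unfolding abs_mult[of \<sigma>] using \<sigma> D(5)[OF \<open>y \<notin> E\<close>] by (intro mult_mono) auto
      then show "0 \<le> dv y + \<sigma> * (2 * cv * dc y)" by linarith
    qed (use \<delta> in \<open>auto intro!: continuous_intros cont' derivative_eq_intros D(1,2)\<close>)
    show "0 \<le> (v (x + \<delta>) - v x) / \<delta>" using s[of 0] \<delta> by simp
    have "\<bar>2 * cv * (c (x + \<delta>) - c x)\<bar> \<le> v (x + \<delta>) - v x"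
      using s[of 1] s[of "-1"] by (simp add: abs_le_iff algebra_simps)
    then have "\<bar>2 * cv * (c (x + \<delta>) - c x)\<bar> / \<delta> \<le> (v (x + \<delta>) - v x) / \<delta>"
      using \<delta> by (intro divide_right_mono) auto
    then show "\<bar>2 * cv * ((c (x + \<delta>) - c x) / \<delta>)\<bar> \<le> (v (x + \<delta>) - v x) / \<delta>"
      using \<delta> by (simp add: abs_mult)
  qed
  have "continuous_on UNIV (\<lambda>x. (v (x + \<delta>) - v x) / \<delta>)" "continuous_on UNIV (\<lambda>x. (c (x + \<delta>) - c x) / \<delta>)"
    using \<delta> by (auto intro!: continuous_intros continuous_on_compose2[OF cont(1)] continuous_on_compose2[OF cont(2)])
  then show ?thesis
    unfolding smooth_profile_def using w k mono err1 err2
    by (intro exI[of _ w] exI[of _ k] exI[of _ "\<lambda>x. (v (x + \<delta>) - v x) / \<delta>"]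
        exI[of _ "\<lambda>x. (c (x + \<delta>) - c x) / \<delta>"]) blast
qed

section \<open>Self-similar test functions\<close>

definition C1_pair :: "(real \<Rightarrow> real) \<Rightarrow> (real \<Rightarrow> real) \<Rightarrow> bool" where
  "C1_pair g g' \<longleftrightarrow> (\<forall>x. (g has_real_derivative g' x) (at x)) \<and> continuous_on UNIV g'"

definition cutoff :: "real \<Rightarrow> (real \<Rightarrow> real) \<Rightarrow> (real \<Rightarrow> real) \<Rightarrow> bool" where
  "cutoff L \<psi> \<psi>' \<longleftrightarrow> C1_pair \<psi> \<psi>' \<and> (\<forall>x. \<bar>x\<bar> > L \<longrightarrow> \<psi> x = 0 \<and> \<psi>' x = 0)"

text \<open>The test function \<open>\<psi>(x\<^sub>1) g(x\<^sub>1/(t+\<epsilon>))\<close>: the time shift \<open>\<epsilon>\<close> keeps self-similar functions smooth at \<open>t = 0\<close>.\<close>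

definition sim_test :: "(real \<Rightarrow> real) \<Rightarrow> (real \<Rightarrow> real) \<Rightarrow> real \<Rightarrow> real \<Rightarrow> real \<times> real \<Rightarrow> real" where
  "sim_test \<psi> g \<epsilon> t x = \<psi> (fst x) * g (fst x / (t + \<epsilon>))"

lemma C1_pair_continuous: "C1_pair g g' \<Longrightarrow> continuous_on A g \<and> continuous_on A g'"
  unfolding C1_pair_def
  by (meson DERIV_isCont continuous_at_imp_continuous_on continuous_on_subset subset_UNIV)

lemma sim_test_C1c:
  assumes \<psi>: "cutoff L \<psi> \<psi>'" and g: "C1_pair g g'" and \<epsilon>: "\<epsilon> > 0"
  shows "C1c_test T (sim_test \<psi> g \<epsilon>)"
    and "0 < t \<Longrightarrow> dt (sim_test \<psi> g \<epsilon>) t x =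
      - \<psi> (fst x) * (g' (fst x / (t + \<epsilon>)) * (fst x / (t + \<epsilon>))) / (t + \<epsilon>)"
    and "0 < t \<Longrightarrow> grad (sim_test \<psi> g \<epsilon>) t x =
      (\<psi>' (fst x) * g (fst x / (t + \<epsilon>)) + \<psi> (fst x) * g' (fst x / (t + \<epsilon>)) / (t + \<epsilon>), 0)"
proof -
  have \<psi>1: "C1_pair \<psi> \<psi>'" and supp: "\<And>x. \<bar>x\<bar> > L \<Longrightarrow> \<psi> x = 0"
    using \<psi> unfolding cutoff_def by auto
  have d\<psi>: "(\<psi> has_real_derivative \<psi>' x) (at x)" and dg: "(g has_real_derivative g' x) (at x)" for x
    using \<psi>1 g unfolding C1_pair_def by auto
  show "C1c_test T (sim_test \<psi> g \<epsilon>)"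
    unfolding C1c_test_def
  proof (intro conjI)
    show "\<forall>t\<in>{0..T}. periodic_x2 (sim_test \<psi> g \<epsilon> t)"
      by (simp add: periodic_x2_def sim_test_def)
    show "\<exists>M. \<forall>t\<in>{0..T}. \<forall>x. \<bar>fst x\<bar> > M \<longrightarrow> sim_test \<psi> g \<epsilon> t x = 0"
      using supp by (intro exI[of _ L]) (simp add: sim_test_def)
    define G :: "real \<times> (real \<times> real) \<Rightarrow> real \<times> (real \<times> real)" where
      "G = (\<lambda>z. (- \<psi> (fst (snd z)) * (g' (fst (snd z) / (fst z + \<epsilon>)) * (fst (snd z) / (fst z + \<epsilon>))) / (fst z + \<epsilon>),
            (\<psi>' (fst (snd z)) * g (fst (snd z) / (fst z + \<epsilon>))
              + \<psi> (fst (snd z)) * g' (fst (snd z) / (fst z + \<epsilon>)) / (fst z + \<epsilon>), 0)))"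
    have c: "continuous_on A \<psi>" "continuous_on A \<psi>'" "continuous_on A g" "continuous_on A g'" for A
      using C1_pair_continuous[OF \<psi>1] C1_pair_continuous[OF g] by auto
    show "\<exists>G. continuous_on ({0..T} \<times> UNIV) G \<and>
        (\<forall>z\<in>{0..T} \<times> UNIV. ((\<lambda>(t, x). sim_test \<psi> g \<epsilon> t x) has_derivative (\<lambda>h. G z \<bullet> h))
           (at z within {0..T} \<times> UNIV))"
    proof (intro exI[of _ G] conjI ballI)
      show "continuous_on ({0..T} \<times> UNIV) G"
        unfolding G_def using \<epsilon>
        by (intro continuous_intros continuous_on_compose2[OF c(1)[of UNIV]] continuous_on_compose2[OF c(2)[of UNIV]]
            continuous_on_compose2[OF c(3)[of UNIV]] continuous_on_compose2[OF c(4)[of UNIV]]) auto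
    next
      fix z :: "real \<times> (real \<times> real)" assume z: "z \<in> {0..T} \<times> UNIV"
      define q where "q = fst z + \<epsilon>"
      have q: "q > 0" using z \<epsilon> by (auto simp: q_def)
      have d1: "((\<lambda>z. \<psi> (fst (snd z))) has_derivative (\<lambda>h. fst (snd h) * \<psi>' (fst (snd z)))) (at z)"
        by (rule DERIV_compose_FDERIV[OF d\<psi>]) (auto intro!: derivative_eq_intros)
      have d2: "((\<lambda>z. g (fst (snd z) / (fst z + \<epsilon>))) has_derivative
          (\<lambda>h. (fst (snd h) * q - fst (snd z) * fst h) / (q * q) * g' (fst (snd z) / (fst z + \<epsilon>)))) (at z)"
        unfolding q_def
        by (intro DERIV_compose_FDERIV[OF dg] has_derivative_divide')
           (use q in \<open>auto intro!: derivative_eq_intros simp: q_def\<close>)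
      have "((\<lambda>z. \<psi> (fst (snd z)) * g (fst (snd z) / (fst z + \<epsilon>))) has_derivative (\<lambda>h. G z \<bullet> h)) (at z)"
      proof (rule has_derivative_eq_rhs[OF has_derivative_mult[OF d1 d2]], rule ext)
        fix h :: "real \<times> (real \<times> real)"
        have eq: "(fst (snd h) * q - fst (snd z) * fst h) / (q * q) = fst (snd h) / q - fst (snd z) * fst h / (q * q)"
          using q by (simp add: diff_divide_distrib)
        show "\<psi> (fst (snd z)) * ((fst (snd h) * q - fst (snd z) * fst h) / (q * q) * g' (fst (snd z) / (fst z + \<epsilon>)))
            + fst (snd h) * \<psi>' (fst (snd z)) * g (fst (snd z) / (fst z + \<epsilon>)) = G z \<bullet> h"
          unfolding G_def q_def[symmetric] eq by (simp add: inner_prod_def algebra_simps)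
      qed
      then show "((\<lambda>(t, x). sim_test \<psi> g \<epsilon> t x) has_derivative (\<lambda>h. G z \<bullet> h)) (at z within {0..T} \<times> UNIV)"
        by (simp add: sim_test_def case_prod_unfold has_derivative_at_withinI)
    qed
  qed
  assume t: "0 < t"
  have "((\<lambda>s. \<psi> (fst x) * g (fst x / (s + \<epsilon>))) has_real_derivative
     \<psi> (fst x) * (g' (fst x / (t + \<epsilon>)) * (- fst x / (t + \<epsilon>)\<^sup>2))) (at t)"
    by (intro DERIV_cmult DERIV_chain2[OF dg])
       (use t \<epsilon> in \<open>auto intro!: derivative_eq_intros simp: power2_eq_square\<close>)
  then show "dt (sim_test \<psi> g \<epsilon>) t x =
      - \<psi> (fst x) * (g' (fst x / (t + \<epsilon>)) * (fst x / (t + \<epsilon>))) / (t + \<epsilon>)"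
    unfolding dt_def sim_test_def by (subst DERIV_imp_deriv) (auto simp: power2_eq_square)
  have "((\<lambda>y. \<psi> y * g (y / (t + \<epsilon>))) has_real_derivative
     \<psi> (fst x) * (g' (fst x / (t + \<epsilon>)) * (1 / (t + \<epsilon>))) + \<psi>' (fst x) * g (fst x / (t + \<epsilon>))) (at (fst x))"
    by (intro DERIV_mult' d\<psi> DERIV_chain2[OF dg])
       (use t \<epsilon> in \<open>auto intro!: derivative_eq_intros\<close>)
  then show "grad (sim_test \<psi> g \<epsilon>) t x =
      (\<psi>' (fst x) * g (fst x / (t + \<epsilon>)) + \<psi> (fst x) * g' (fst x / (t + \<epsilon>)) / (t + \<epsilon>), 0)"
    unfolding grad_def sim_test_def by (simp add: DERIV_imp_deriv)
qed

definition cell :: "real \<Rightarrow> (real \<times> real) set" where "cell L = {-L..L} \<times> {0..1}"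
definition slab :: "real \<Rightarrow> real \<Rightarrow> (real \<times> (real \<times> real)) set" where "slab \<tau> L = {0<..<\<tau>} \<times> cell L"

text \<open>No measurability of \<open>F\<close> is assumed: it agrees almost everywhere with a
  Borel function, and Lebesgue measure is complete. Two different sets are allowed, so that the same
  step also cuts the period cell down to a bounded piece or replaces closed by open time
  intervals.\<close>

lemma set_integral_lebesgue_AE_eq:
  fixes F G :: "'a::euclidean_space \<Rightarrow> real"
  assumes A[measurable]: "A \<in> sets borel" "B \<in> sets borel" and G[measurable]: "G \<in> borel_measurable borel"
    and eq: "AE x in lborel. indicator A x * F x = indicator B x * G x"
  shows "(LINT x:A|lebesgue. F x) = (LINT x:B|lborel. G x)"
proof -
  let ?G = "\<lambda>x. indicator B x *\<^sub>R G x"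
  have eq': "AE x in lebesgue. indicator A x *\<^sub>R F x = ?G x"
    using eq by (intro AE_completion) simp
  have G': "?G \<in> borel_measurable lborel" by simp
  then have G'': "?G \<in> borel_measurable lebesgue" by (rule measurable_completion)
  have "(\<lambda>x. indicator A x *\<^sub>R F x) \<in> borel_measurable lebesgue"
    by (rule borel_measurable_AE[OF G'']) (use eq' in \<open>auto elim!: eventually_mono\<close>)
  then have "(LINT x|lebesgue. indicator A x *\<^sub>R F x) = (LINT x|lebesgue. ?G x)"
    by (intro integral_cong_AE G'' eq')
  also have "\<dots> = (LINT x|lborel. ?G x)" by (rule integral_completion[OF G'])
  finally show ?thesis by (simp add: set_lebesgue_integral_def)
qed

text \<open>The two sides of the weak form of \<open>\<partial>\<^sub>t q + div f = 0\<close>; only the \<open>x\<^sub>1\<close>-component of the flux \<open>f\<close> enters,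
  since the test functions do not depend on \<open>x\<^sub>2\<close>.\<close>

definition test_bulk :: "real \<Rightarrow> (real \<times> (real \<times> real) \<Rightarrow> real) \<Rightarrow> (real \<times> (real \<times> real) \<Rightarrow> real) \<Rightarrow>
    (real \<Rightarrow> real) \<Rightarrow> (real \<Rightarrow> real) \<Rightarrow> (real \<Rightarrow> real) \<Rightarrow> (real \<Rightarrow> real) \<Rightarrow> real \<times> (real \<times> real) \<Rightarrow> real" where
  "test_bulk \<epsilon> q f \<psi> \<psi>' g g' = (\<lambda>(t, x1, x2).
     q (t, x1, x2) * (- \<psi> x1 * (g' (x1 / (t + \<epsilon>)) * (x1 / (t + \<epsilon>))) / (t + \<epsilon>))
     + f (t, x1, x2) * (\<psi>' x1 * g (x1 / (t + \<epsilon>)) + \<psi> x1 * g' (x1 / (t + \<epsilon>)) / (t + \<epsilon>)))"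

definition test_jump :: "real \<Rightarrow> real \<Rightarrow> (real \<times> (real \<times> real) \<Rightarrow> real) \<Rightarrow> (real \<Rightarrow> real) \<Rightarrow>
    (real \<Rightarrow> real) \<Rightarrow> (real \<Rightarrow> real) \<Rightarrow> real \<times> real \<Rightarrow> real" where
  "test_jump \<tau> \<epsilon> q q0 \<psi> g = (\<lambda>(x1, x2).
     q (\<tau>, x1, x2) * (\<psi> x1 * g (x1 / (\<tau> + \<epsilon>))) - q0 x1 * (\<psi> x1 * g (x1 / \<epsilon>)))"

text \<open>The cut-off and its derivative vanish off \<open>cell L\<close>, so the integrals over
  the unbounded domain become integrals over bounded sets. The jump sees the fields only on the
  slice at \<open>\<tau>\<close>, the bulk only in space-time, hence the two separate almost
  everywhere hypotheses.\<close>

lemma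
  fixes q f :: "real \<times> (real \<times> real) \<Rightarrow> real" and q0 :: "real \<Rightarrow> real"
  assumes \<tau>: "0 < \<tau>" and \<psi>: "cutoff L \<psi> \<psi>'" and g: "C1_pair g g'" and \<epsilon>: "\<epsilon> > 0"
    and meas[measurable]: "q \<in> borel_measurable borel" "f \<in> borel_measurable borel" "q0 \<in> borel_measurable borel"
    and eq\<tau>: "AE x in lborel. qs \<tau> x = q (\<tau>, x)"
    and eq: "AE z in lborel. fst z \<in> {0<..<\<tau>} \<longrightarrow> qs (fst z) (snd z) = q z \<and> fs (fst z) (snd z) = f z"
  shows int_Omega_sim_test: "int_Omega (\<lambda>x. qs \<tau> x * sim_test \<psi> g \<epsilon> \<tau> x - q0 (fst x) * sim_test \<psi> g \<epsilon> 0 x)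
      = (LINT x:cell L|lborel. test_jump \<tau> \<epsilon> q q0 \<psi> g x)"
    and int_time_Omega_sim_test: "int_time_Omega \<tau> (\<lambda>t x. qs t x * dt (sim_test \<psi> g \<epsilon>) t x
        + fs t x * fst (grad (sim_test \<psi> g \<epsilon>) t x))
      = (LINT z:slab \<tau> L|lborel. test_bulk \<epsilon> q f \<psi> \<psi>' g g' z)"
proof -
  have \<psi>1: "C1_pair \<psi> \<psi>'" and supp: "\<And>x. \<bar>x\<bar> > L \<Longrightarrow> \<psi> x = 0 \<and> \<psi>' x = 0"
    using \<psi> unfolding cutoff_def by auto
  have [measurable]: "\<psi> \<in> borel_measurable borel" "\<psi>' \<in> borel_measurable borel"
    "g \<in> borel_measurable borel" "g' \<in> borel_measurable borel"
    using C1_pair_continuous[OF \<psi>1, of UNIV] C1_pair_continuous[OF g, of UNIV]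
    by (auto intro: borel_measurable_continuous_onI)
  have cells: "period_cell \<in> sets borel" "cell L \<in> sets borel"
    "{0<..<\<tau>} \<times> period_cell \<in> sets borel" "slab \<tau> L \<in> sets borel"
    unfolding period_cell_def cell_def slab_def
    by (auto intro!: borel_closed closed_Times simp flip: borel_prod)
  show "int_Omega (\<lambda>x. qs \<tau> x * sim_test \<psi> g \<epsilon> \<tau> x - q0 (fst x) * sim_test \<psi> g \<epsilon> 0 x)
      = (LINT x:cell L|lborel. test_jump \<tau> \<epsilon> q q0 \<psi> g x)"
    unfolding int_Omega_def
  proof (rule set_integral_lebesgue_AE_eq[OF cells(1,2)])
    show "test_jump \<tau> \<epsilon> q q0 \<psi> g \<in> borel_measurable borel"
      unfolding test_jump_def by (simp flip: borel_prod) measurable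
    show "AE x in lborel. indicator period_cell x * (qs \<tau> x * sim_test \<psi> g \<epsilon> \<tau> x - q0 (fst x) * sim_test \<psi> g \<epsilon> 0 x) =
        indicator (cell L) x * test_jump \<tau> \<epsilon> q q0 \<psi> g x"
      using eq\<tau>
    proof eventually_elim
      case (elim x)
      show ?case
        using supp[of "fst x"] elim
        by (auto simp: indicator_def period_cell_def cell_def sim_test_def test_jump_def split: prod.split)
    qed
  qed
  show "int_time_Omega \<tau> (\<lambda>t x. qs t x * dt (sim_test \<psi> g \<epsilon>) t x + fs t x * fst (grad (sim_test \<psi> g \<epsilon>) t x))
      = (LINT z:slab \<tau> L|lborel. test_bulk \<epsilon> q f \<psi> \<psi>' g g' z)"
    unfolding int_time_Omega_def
  proof (rule set_integral_lebesgue_AE_eq[OF cells(3,4)])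
    show "test_bulk \<epsilon> q f \<psi> \<psi>' g g' \<in> borel_measurable borel"
      unfolding test_bulk_def by (simp flip: borel_prod) measurable
    show "AE z in lborel. indicator ({0<..<\<tau>} \<times> period_cell) z *
         (qs (fst z) (snd z) * dt (sim_test \<psi> g \<epsilon>) (fst z) (snd z) +
          fs (fst z) (snd z) * fst (grad (sim_test \<psi> g \<epsilon>) (fst z) (snd z))) =
        indicator (slab \<tau> L) z * test_bulk \<epsilon> q f \<psi> \<psi>' g g' z"
      using eq
    proof eventually_elim
      case (elim z)
      show ?case
      proof (cases "fst z \<in> {0<..<\<tau>}")
        case True
        then show ?thesis
          using supp[of "fst (snd z)"] elim sim_test_C1c(2,3)[OF \<psi> g \<epsilon>, of "fst z" "snd z"]
          by (auto simp: indicator_def period_cell_def cell_def slab_def test_bulk_def split: prod.split)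
      qed (auto simp: indicator_def slab_def)
    qed
  qed
qed

section \<open>Borel representatives of the weak solution\<close>

text \<open>What remains of a weak balance law at one fixed time when only products of a cut-off and
  a shifted self-similar function are used as tests. Everything is stated in Borel functions and
  \<open>lborel\<close>, so Fubini and measurability become routine.\<close>

definition balanced :: "real \<Rightarrow> (real \<times> (real \<times> real) \<Rightarrow> real) \<Rightarrow> (real \<times> (real \<times> real) \<Rightarrow> real) \<Rightarrow> (real \<Rightarrow> real) \<Rightarrow> bool" where
  "balanced \<tau> q f q0 \<longleftrightarrow> (\<forall>L \<psi> \<psi>' g g' \<epsilon>. cutoff L \<psi> \<psi>' \<and> C1_pair g g' \<and> 0 < \<epsilon> \<longrightarrow>
     (LINT x:cell L|lborel. test_jump \<tau> \<epsilon> q q0 \<psi> g x) = (LINT z:slab \<tau> L|lborel. test_bulk \<epsilon> q f \<psi> \<psi>' g g' z))"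

definition overbalanced :: "real \<Rightarrow> (real \<times> (real \<times> real) \<Rightarrow> real) \<Rightarrow> (real \<times> (real \<times> real) \<Rightarrow> real) \<Rightarrow> (real \<Rightarrow> real) \<Rightarrow> bool" where
  "overbalanced \<tau> q f q0 \<longleftrightarrow> (\<forall>L \<psi> \<psi>' g g' \<epsilon>. cutoff L \<psi> \<psi>' \<and> C1_pair g g' \<and> 0 < \<epsilon> \<and>
     (\<forall>x. 0 \<le> \<psi> x) \<and> (\<forall>x. 0 \<le> g x) \<longrightarrow>
     (LINT x:cell L|lborel. test_jump \<tau> \<epsilon> q q0 \<psi> g x) \<ge> (LINT z:slab \<tau> L|lborel. test_bulk \<epsilon> q f \<psi> \<psi>' g g' z))"

lemma int_time_Omega_cong:
  "(\<And>t x. 0 < t \<Longrightarrow> t < \<tau> \<Longrightarrow> f t x = g t x) \<Longrightarrow> int_time_Omega \<tau> f = int_time_Omega \<tau> g"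
  unfolding int_time_Omega_def set_lebesgue_integral_def
  by (rule Bochner_Integration.integral_cong) (auto simp: indicator_def)

lemma entropy_measurable[measurable]:
  assumes [measurable]: "f \<in> borel_measurable M" "g \<in> borel_measurable M"
  shows "(\<lambda>z. entropy cv (f z) (g z)) \<in> borel_measurable M"
  unfolding entropy_def by measurable

lemma energy_measurable[measurable]:
  assumes [measurable]: "f \<in> borel_measurable M" "g \<in> borel_measurable M" "a \<in> borel_measurable M" "b \<in> borel_measurable M"
  shows "(\<lambda>z. energy cv (f z) (g z) (a z, b z)) \<in> borel_measurable M"
  unfolding energy_def norm_Pair by measurable

lemma riemann_measurable[measurable]: "riemann l r \<in> borel_measurable borel" for l r :: real
  unfolding riemann_def[abs_def] by measurable

lemma borel_representative:
  fixes f :: "real \<Rightarrow> real \<times> real \<Rightarrow> real"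
  assumes "(\<lambda>(t, x). f t x) \<in> borel_measurable (lebesgue_on ({0..T} \<times> UNIV))"
  obtains g where "g \<in> borel_measurable borel"
    "AE z in lborel. fst z \<in> {0..T} \<longrightarrow> f (fst z) (snd z) = g z"
proof -
  have "{0..T} \<times> UNIV \<in> sets (lebesgue :: (real \<times> (real \<times> real)) measure)"
    by (intro sets_completionI_sets) (auto intro!: borel_closed closed_Times)
  then have "(\<lambda>z. indicator ({0..T} \<times> UNIV) z *\<^sub>R (case z of (t, x) \<Rightarrow> f t x)) \<in> borel_measurable lebesgue"
    using assms by (subst (asm) borel_measurable_restrict_space_iff) auto
  from completion_ex_borel_measurable_real[OF this] obtain g where
    "g \<in> borel_measurable lborel" "AE z in lborel. indicator ({0..T} \<times> UNIV) z *\<^sub>R (case z of (t, x) \<Rightarrow> f t x) = g z"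
    by auto
  then show thesis
    by (intro that[of g]) (auto elim!: eventually_mono simp: case_prod_unfold indicator_def)
qed

text \<open>Borel representatives, modified on a null set so that the bounds hold at every point;
  later estimates can then be made pointwise. A single constant \<open>K \<ge> 1\<close> serves for
  all bounds.\<close>

locale euler_fields =
  fixes T cv K :: real and \<rho> \<theta> a b :: "real \<times> (real \<times> real) \<Rightarrow> real"
  assumes T: "T > 0" and cv: "cv > 0" and K1: "K \<ge> 1"
    and meas[measurable]: "\<rho> \<in> borel_measurable borel" "\<theta> \<in> borel_measurable borel"
      "a \<in> borel_measurable borel" "b \<in> borel_measurable borel"
    and bounds: "\<And>z. 0 < \<rho> z" "\<And>z. \<rho> z \<le> K" "\<And>z. 0 < \<theta> z" "\<And>z. \<theta> z \<le> K"
      "\<And>z. \<bar>entropy cv (\<rho> z) (\<theta> z)\<bar> \<le> K" "\<And>z. \<bar>a z\<bar> \<le> K" "\<And>z. \<bar>b z\<bar> \<le> K"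
begin

definition represents ::
  "(real \<Rightarrow> real \<times> real \<Rightarrow> real) \<Rightarrow> (real \<Rightarrow> real \<times> real \<Rightarrow> real) \<Rightarrow> (real \<Rightarrow> real \<times> real \<Rightarrow> real \<times> real) \<Rightarrow> bool" where
  "represents rho theta u \<longleftrightarrow> (AE z in lborel. fst z \<in> {0<..<T} \<longrightarrow>
     rho (fst z) (snd z) = \<rho> z \<and> theta (fst z) (snd z) = \<theta> z \<and> u (fst z) (snd z) = (a z, b z))"

text \<open>A single time slice is a null set of space-time, so agreement in space-time says nothing
  about the left-hand side of the weak formulation; agreement on the slice has to be asked for
  separately, and holds for almost every time.\<close>

definition represents_at ::
  "(real \<Rightarrow> real \<times> real \<Rightarrow> real) \<Rightarrow> (real \<Rightarrow> real \<times> real \<Rightarrow> real) \<Rightarrow> (real \<Rightarrow> real \<times> real \<Rightarrow> real \<times> real) \<Rightarrow> real \<Rightarrow> bool" where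
  "represents_at rho theta u \<tau> \<longleftrightarrow> (AE x in lborel.
     rho \<tau> x = \<rho> (\<tau>, x) \<and> theta \<tau> x = \<theta> (\<tau>, x) \<and> u \<tau> x = (a (\<tau>, x), b (\<tau>, x)))"

lemma represents_at_AE:
  assumes "represents rho theta u"
  shows "AE \<tau> in lborel. \<tau> \<in> {0<..<T} \<longrightarrow> represents_at rho theta u \<tau>"
proof -
  have "AE z in lborel \<Otimes>\<^sub>M lborel. fst z \<in> {0<..<T} \<longrightarrow>
     rho (fst z) (snd z) = \<rho> z \<and> theta (fst z) (snd z) = \<theta> z \<and> u (fst z) (snd z) = (a z, b z)"
    using assms unfolding represents_def lborel_prod .
  from lborel_pair.AE_pair[OF this] show ?thesis
    by eventually_elim (auto simp: represents_at_def)
qed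

text \<open>The test functions do not depend on \<open>x2\<close>, so every flux contributes only
  its first component and the system is reduced to balance laws in one space dimension for
  two-dimensional fields.\<close>

lemma weak_balances:
  assumes rep: "represents rho theta u" and \<tau>: "\<tau> \<in> {0<..<T}" and rep\<tau>: "represents_at rho theta u \<tau>"
    and weak: "weak_solution T cv
                 (\<lambda>x. riemann R_L R_R (fst x))
                 (\<lambda>x. riemann Theta_L Theta_R (fst x))
                 (\<lambda>x. (riemann U_L U_R (fst x), 0))
                 rho theta u"
  shows "balanced \<tau> \<rho> (\<lambda>z. \<rho> z * a z) (riemann R_L R_R)"
    and "balanced \<tau> (\<lambda>z. \<rho> z * a z) (\<lambda>z. \<rho> z * (a z)\<^sup>2 + \<rho> z * \<theta> z) (\<lambda>x. riemann R_L R_R x * riemann U_L U_R x)"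
    and "balanced \<tau> (\<lambda>z. energy cv (\<rho> z) (\<theta> z) (a z, b z)) (\<lambda>z. (energy cv (\<rho> z) (\<theta> z) (a z, b z) + \<rho> z * \<theta> z) * a z)
          (\<lambda>x. energy cv (riemann R_L R_R x) (riemann Theta_L Theta_R x) (riemann U_L U_R x, 0))"
    and "\<And>\<beta>. \<beta> C1_differentiable_on UNIV \<Longrightarrow> (\<forall>y. deriv \<beta> y \<ge> 0) \<Longrightarrow>
          overbalanced \<tau> (\<lambda>z. \<rho> z * \<beta> (entropy cv (\<rho> z) (\<theta> z))) (\<lambda>z. \<rho> z * \<beta> (entropy cv (\<rho> z) (\<theta> z)) * a z)
          (\<lambda>x. riemann R_L R_R x * \<beta> (entropy cv (riemann R_L R_R x) (riemann Theta_L Theta_R x)))"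
proof -
  have \<tau>': "0 < \<tau>" "\<tau> \<in> {0..T}" using \<tau> by auto
  have AEz: "AE z in lborel. fst z \<in> {0<..<\<tau>} \<longrightarrow>
     rho (fst z) (snd z) = \<rho> z \<and> theta (fst z) (snd z) = \<theta> z \<and> u (fst z) (snd z) = (a z, b z)"
    using rep unfolding represents_def by (rule eventually_mono) (use \<tau> in auto)
  note AEx = rep\<tau>[unfolded represents_at_def]
  have lift_z: "AE z in lborel. fst z \<in> {0<..<\<tau>} \<longrightarrow> qs (fst z) (snd z) = q z \<and> fs (fst z) (snd z) = f z"
    if "\<And>t x. rho t x = \<rho> (t, x) \<Longrightarrow> theta t x = \<theta> (t, x) \<Longrightarrow> u t x = (a (t, x), b (t, x)) \<Longrightarrow>
        qs t x = q (t, x) \<and> fs t x = f (t, x)" for qs fs and q f :: "real \<times> (real \<times> real) \<Rightarrow> real"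
    using AEz by eventually_elim (use that in auto)
  have lift_x: "AE x in lborel. qs \<tau> x = q (\<tau>, x)"
    if "\<And>t x. rho t x = \<rho> (t, x) \<Longrightarrow> theta t x = \<theta> (t, x) \<Longrightarrow> u t x = (a (t, x), b (t, x)) \<Longrightarrow>
        qs t x = q (t, x)" for qs and q :: "real \<times> (real \<times> real) \<Rightarrow> real"
    using AEx by eventually_elim (use that in auto)
  \<comment> \<open>Common to all four laws: \<open>q\<close> and \<open>f\<close> are the Borel
    forms of the density \<open>qs\<close> and of the flux \<open>fs\<close> built from the weak
    solution.\<close>
  have key:
    "int_Omega (\<lambda>x. qs \<tau> x * sim_test \<psi> g \<epsilon> \<tau> x - init (fst x) * sim_test \<psi> g \<epsilon> 0 x)
      = (LINT x:cell L|lborel. test_jump \<tau> \<epsilon> q init \<psi> g x)"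
    "int_time_Omega \<tau> (\<lambda>t x. qs t x * dt (sim_test \<psi> g \<epsilon>) t x + fs t x * fst (grad (sim_test \<psi> g \<epsilon>) t x))
      = (LINT z:slab \<tau> L|lborel. test_bulk \<epsilon> q f \<psi> \<psi>' g g' z)"
    if A: "cutoff L \<psi> \<psi>'" "C1_pair g g'" "0 < \<epsilon>"
      and m: "q \<in> borel_measurable borel" "f \<in> borel_measurable borel" "init \<in> borel_measurable borel"
      and c: "\<forall>t x. rho t x = \<rho> (t, x) \<and> theta t x = \<theta> (t, x) \<and> u t x = (a (t, x), b (t, x)) \<longrightarrow>
        qs t x = q (t, x) \<and> fs t x = f (t, x)"
    for L \<psi> \<psi>' g g' \<epsilon> q f init qs fs
    using int_Omega_sim_test[OF \<tau>'(1) A m lift_x lift_z, of qs qs fs]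
      int_time_Omega_sim_test[OF \<tau>'(1) A m lift_x lift_z, of qs qs fs] c by auto
  show "balanced \<tau> \<rho> (\<lambda>z. \<rho> z * a z) (riemann R_L R_R)"
    unfolding balanced_def
  proof (intro allI impI, elim conjE)
    fix L \<psi> \<psi>' g g' and \<epsilon> :: real assume A: "cutoff L \<psi> \<psi>'" "C1_pair g g'" "0 < \<epsilon>"
    note test = sim_test_C1c[OF A]
    have m: "\<rho> \<in> borel_measurable borel" "(\<lambda>z. \<rho> z * a z) \<in> borel_measurable borel"
        "riemann R_L R_R \<in> borel_measurable borel" by measurable
    have c: "\<forall>t x. rho t x = \<rho> (t, x) \<and> theta t x = \<theta> (t, x) \<and> u t x = (a (t, x), b (t, x)) \<longrightarrow>
        (rho) t x = (\<rho>) (t, x) \<and> (\<lambda>t x. rho t x * fst (u t x)) t x = (\<lambda>z. \<rho> z * a z) (t, x)"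
      by simp
    have "int_Omega (\<lambda>x. rho \<tau> x * sim_test \<psi> g \<epsilon> \<tau> x - riemann R_L R_R (fst x) * sim_test \<psi> g \<epsilon> 0 x) =
        int_time_Omega \<tau> (\<lambda>t x. rho t x * dt (sim_test \<psi> g \<epsilon>) t x + rho t x * (u t x \<bullet> grad (sim_test \<psi> g \<epsilon>) t x))"
      using weak \<tau>' test(1) unfolding weak_solution_def weak_mass_def by blast
    also have "\<dots> = int_time_Omega \<tau> (\<lambda>t x. rho t x * dt (sim_test \<psi> g \<epsilon>) t x
        + (rho t x * fst (u t x)) * fst (grad (sim_test \<psi> g \<epsilon>) t x))"
      by (rule int_time_Omega_cong) (simp add: test inner_prod_def)
    finally show "(LINT x:cell L|lborel. test_jump \<tau> \<epsilon> \<rho> (riemann R_L R_R) \<psi> g x) =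
         (LINT z:slab \<tau> L|lborel. test_bulk \<epsilon> \<rho> (\<lambda>z. \<rho> z * a z) \<psi> \<psi>' g g' z)"
      unfolding key(1)[where q = "\<rho>" and f = "\<lambda>z. \<rho> z * a z" and init = "riemann R_L R_R" and qs = "rho" and fs = "\<lambda>t x. rho t x * fst (u t x)", OF A m c]
        key(2)[where q = "\<rho>" and f = "\<lambda>z. \<rho> z * a z" and init = "riemann R_L R_R" and qs = "rho" and fs = "\<lambda>t x. rho t x * fst (u t x)", OF A m c] .
  qed
  show "balanced \<tau> (\<lambda>z. \<rho> z * a z) (\<lambda>z. \<rho> z * (a z)\<^sup>2 + \<rho> z * \<theta> z) (\<lambda>x. riemann R_L R_R x * riemann U_L U_R x)"
    unfolding balanced_def
  proof (intro allI impI, elim conjE)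
    fix L \<psi> \<psi>' g g' and \<epsilon> :: real assume A: "cutoff L \<psi> \<psi>'" "C1_pair g g'" "0 < \<epsilon>"
    note test = sim_test_C1c[OF A]
    have m: "(\<lambda>z. \<rho> z * a z) \<in> borel_measurable borel" "(\<lambda>z. \<rho> z * (a z)\<^sup>2 + \<rho> z * \<theta> z) \<in> borel_measurable borel"
        "(\<lambda>x. riemann R_L R_R x * riemann U_L U_R x) \<in> borel_measurable borel" by measurable
    have c: "\<forall>t x. rho t x = \<rho> (t, x) \<and> theta t x = \<theta> (t, x) \<and> u t x = (a (t, x), b (t, x)) \<longrightarrow>
        (\<lambda>t x. rho t x * fst (u t x)) t x = (\<lambda>z. \<rho> z * a z) (t, x) \<and> (\<lambda>t x. rho t x * (fst (u t x))\<^sup>2 + rho t x * theta t x) t x = (\<lambda>z. \<rho> z * (a z)\<^sup>2 + \<rho> z * \<theta> z) (t, x)"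
      by simp
    \<comment> \<open>The vector test function has second component 0, which leaves the first
      momentum equation.\<close>
    have Z: "C1_pair (\<lambda>_. 0) (\<lambda>_. 0)" by (simp add: C1_pair_def)
    note test0 = sim_test_C1c[OF A(1) Z A(3)]
    let ?z = "sim_test \<psi> (\<lambda>_. 0) \<epsilon>"
    have z0: "?z t x = 0" for t x by (simp add: sim_test_def)
    have "int_Omega (\<lambda>x. rho \<tau> x * (u \<tau> x \<bullet> (sim_test \<psi> g \<epsilon> \<tau> x, ?z \<tau> x))
          - riemann R_L R_R (fst x) * ((riemann U_L U_R (fst x), 0) \<bullet> (sim_test \<psi> g \<epsilon> 0 x, ?z 0 x))) =
        int_time_Omega \<tau> (\<lambda>t x. rho t x * (u t x \<bullet> (dt (sim_test \<psi> g \<epsilon>) t x, dt ?z t x))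
          + rho t x * (fst (u t x) * (u t x \<bullet> grad (sim_test \<psi> g \<epsilon>) t x) + snd (u t x) * (u t x \<bullet> grad ?z t x))
          + rho t x * theta t x * (fst (grad (sim_test \<psi> g \<epsilon>) t x) + snd (grad ?z t x)))"
      using weak \<tau>' test(1) test0(1) unfolding weak_solution_def weak_momentum_def by blast
    also have "\<dots> = int_time_Omega \<tau> (\<lambda>t x. (rho t x * fst (u t x)) * dt (sim_test \<psi> g \<epsilon>) t x
        + (rho t x * (fst (u t x))\<^sup>2 + rho t x * theta t x) * fst (grad (sim_test \<psi> g \<epsilon>) t x))"
      by (rule int_time_Omega_cong) (simp add: test test0 inner_prod_def power2_eq_square algebra_simps)
    also have "(\<lambda>x. rho \<tau> x * (u \<tau> x \<bullet> (sim_test \<psi> g \<epsilon> \<tau> x, ?z \<tau> x))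
          - riemann R_L R_R (fst x) * ((riemann U_L U_R (fst x), 0) \<bullet> (sim_test \<psi> g \<epsilon> 0 x, ?z 0 x)))
      = (\<lambda>x. (rho \<tau> x * fst (u \<tau> x)) * sim_test \<psi> g \<epsilon> \<tau> x - (riemann R_L R_R (fst x) * riemann U_L U_R (fst x)) * sim_test \<psi> g \<epsilon> 0 x)"
      by (simp add: z0 inner_prod_def algebra_simps)
    finally show "(LINT x:cell L|lborel. test_jump \<tau> \<epsilon> (\<lambda>z. \<rho> z * a z) (\<lambda>x. riemann R_L R_R x * riemann U_L U_R x) \<psi> g x) =
         (LINT z:slab \<tau> L|lborel. test_bulk \<epsilon> (\<lambda>z. \<rho> z * a z) (\<lambda>z. \<rho> z * (a z)\<^sup>2 + \<rho> z * \<theta> z) \<psi> \<psi>' g g' z)"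
      unfolding key(1)[where q = "\<lambda>z. \<rho> z * a z" and f = "\<lambda>z. \<rho> z * (a z)\<^sup>2 + \<rho> z * \<theta> z" and init = "\<lambda>x. riemann R_L R_R x * riemann U_L U_R x" and qs = "\<lambda>t x. rho t x * fst (u t x)" and fs = "\<lambda>t x. rho t x * (fst (u t x))\<^sup>2 + rho t x * theta t x", OF A m c]
        key(2)[where q = "\<lambda>z. \<rho> z * a z" and f = "\<lambda>z. \<rho> z * (a z)\<^sup>2 + \<rho> z * \<theta> z" and init = "\<lambda>x. riemann R_L R_R x * riemann U_L U_R x" and qs = "\<lambda>t x. rho t x * fst (u t x)" and fs = "\<lambda>t x. rho t x * (fst (u t x))\<^sup>2 + rho t x * theta t x", OF A m c] .
  qed
  let ?E = "\<lambda>z. energy cv (\<rho> z) (\<theta> z) (a z, b z)"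
  show "balanced \<tau> ?E (\<lambda>z. (?E z + \<rho> z * \<theta> z) * a z)
          (\<lambda>x. energy cv (riemann R_L R_R x) (riemann Theta_L Theta_R x) (riemann U_L U_R x, 0))"
    unfolding balanced_def
  proof (intro allI impI, elim conjE)
    fix L \<psi> \<psi>' g g' and \<epsilon> :: real assume A: "cutoff L \<psi> \<psi>'" "C1_pair g g'" "0 < \<epsilon>"
    let ?e = "\<lambda>t x. energy cv (rho t x) (theta t x) (u t x)"
    let ?ei = "\<lambda>x. energy cv (riemann R_L R_R x) (riemann Theta_L Theta_R x) (riemann U_L U_R x, 0)"
    note test = sim_test_C1c[OF A]
    have m: "?E \<in> borel_measurable borel" "(\<lambda>z. (?E z + \<rho> z * \<theta> z) * a z) \<in> borel_measurable borel"
        "?ei \<in> borel_measurable borel" by measurable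
    have c: "\<forall>t x. rho t x = \<rho> (t, x) \<and> theta t x = \<theta> (t, x) \<and> u t x = (a (t, x), b (t, x)) \<longrightarrow>
        (?e) t x = (?E) (t, x) \<and> (\<lambda>t x. (?e t x + rho t x * theta t x) * fst (u t x)) t x = (\<lambda>z. (?E z + \<rho> z * \<theta> z) * a z) (t, x)"
      by simp
    have "int_Omega (\<lambda>x. ?e \<tau> x * sim_test \<psi> g \<epsilon> \<tau> x - ?ei (fst x) * sim_test \<psi> g \<epsilon> 0 x) =
        int_time_Omega \<tau> (\<lambda>t x. ?e t x * dt (sim_test \<psi> g \<epsilon>) t x
          + (?e t x + rho t x * theta t x) * (u t x \<bullet> grad (sim_test \<psi> g \<epsilon>) t x))"
      using weak \<tau>' test(1) unfolding weak_solution_def weak_energy_def by blast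
    also have "\<dots> = int_time_Omega \<tau> (\<lambda>t x. ?e t x * dt (sim_test \<psi> g \<epsilon>) t x
        + ((?e t x + rho t x * theta t x) * fst (u t x)) * fst (grad (sim_test \<psi> g \<epsilon>) t x))"
      by (rule int_time_Omega_cong) (simp add: test inner_prod_def)
    finally show "(LINT x:cell L|lborel. test_jump \<tau> \<epsilon> ?E ?ei \<psi> g x) =
         (LINT z:slab \<tau> L|lborel. test_bulk \<epsilon> ?E (\<lambda>z. (?E z + \<rho> z * \<theta> z) * a z) \<psi> \<psi>' g g' z)"
      unfolding key(1)[where q = "?E" and f = "\<lambda>z. (?E z + \<rho> z * \<theta> z) * a z" and init = "?ei" and qs = "?e" and fs = "\<lambda>t x. (?e t x + rho t x * theta t x) * fst (u t x)", OF A m c]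
        key(2)[where q = "?E" and f = "\<lambda>z. (?E z + \<rho> z * \<theta> z) * a z" and init = "?ei" and qs = "?e" and fs = "\<lambda>t x. (?e t x + rho t x * theta t x) * fst (u t x)", OF A m c] .
  qed
  fix \<beta> :: "real \<Rightarrow> real" assume \<beta>: "\<beta> C1_differentiable_on UNIV" "\<forall>y. deriv \<beta> y \<ge> 0"
  have [measurable]: "\<beta> \<in> borel_measurable borel"
    by (rule borel_measurable_continuous_onI) (use \<beta>(1) C1_differentiable_imp_continuous_on in blast)
  let ?q = "\<lambda>z. \<rho> z * \<beta> (entropy cv (\<rho> z) (\<theta> z))"
  let ?qi = "\<lambda>x. riemann R_L R_R x * \<beta> (entropy cv (riemann R_L R_R x) (riemann Theta_L Theta_R x))"
  show "overbalanced \<tau> ?q (\<lambda>z. \<rho> z * \<beta> (entropy cv (\<rho> z) (\<theta> z)) * a z) ?qi"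
    unfolding overbalanced_def
  proof (intro allI impI, elim conjE)
    fix L \<psi> \<psi>' g g' and \<epsilon> :: real assume A: "cutoff L \<psi> \<psi>'" "C1_pair g g'" "0 < \<epsilon>"
      and nn: "\<forall>x. 0 \<le> \<psi> x" "\<forall>x. 0 \<le> g x"
    let ?qs = "\<lambda>t x. rho t x * \<beta> (entropy cv (rho t x) (theta t x))"
    note test = sim_test_C1c[OF A]
    have m: "?q \<in> borel_measurable borel" "(\<lambda>z. ?q z * a z) \<in> borel_measurable borel"
        "?qi \<in> borel_measurable borel" by measurable
    have c: "\<forall>t x. rho t x = \<rho> (t, x) \<and> theta t x = \<theta> (t, x) \<and> u t x = (a (t, x), b (t, x)) \<longrightarrow>
        (?qs) t x = (?q) (t, x) \<and> (\<lambda>t x. ?qs t x * fst (u t x)) t x = (\<lambda>z. ?q z * a z) (t, x)"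
      by simp
    have "\<forall>t\<in>{0..T}. \<forall>x. sim_test \<psi> g \<epsilon> t x \<ge> 0" using nn by (simp add: sim_test_def)
    then have "int_Omega (\<lambda>x. ?qs \<tau> x * sim_test \<psi> g \<epsilon> \<tau> x - ?qi (fst x) * sim_test \<psi> g \<epsilon> 0 x) \<ge>
        int_time_Omega \<tau> (\<lambda>t x. ?qs t x * dt (sim_test \<psi> g \<epsilon>) t x + ?qs t x * (u t x \<bullet> grad (sim_test \<psi> g \<epsilon>) t x))"
      using weak \<tau>' test(1) \<beta> unfolding weak_solution_def weak_entropy_def by blast
    also have "int_time_Omega \<tau> (\<lambda>t x. ?qs t x * dt (sim_test \<psi> g \<epsilon>) t x + ?qs t x * (u t x \<bullet> grad (sim_test \<psi> g \<epsilon>) t x))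
      = int_time_Omega \<tau> (\<lambda>t x. ?qs t x * dt (sim_test \<psi> g \<epsilon>) t x
        + (?qs t x * fst (u t x)) * fst (grad (sim_test \<psi> g \<epsilon>) t x))"
      by (rule int_time_Omega_cong) (simp add: test inner_prod_def)
    finally show "(LINT x:cell L|lborel. test_jump \<tau> \<epsilon> ?q ?qi \<psi> g x) \<ge>
         (LINT z:slab \<tau> L|lborel. test_bulk \<epsilon> ?q (\<lambda>z. ?q z * a z) \<psi> \<psi>' g g' z)"
      unfolding key(1)[where q = "?q" and f = "\<lambda>z. ?q z * a z" and init = "?qi" and qs = "?qs" and fs = "\<lambda>t x. ?qs t x * fst (u t x)", OF A m c]
        key(2)[where q = "?q" and f = "\<lambda>z. ?q z * a z" and init = "?qi" and qs = "?qs" and fs = "\<lambda>t x. ?qs t x * fst (u t x)", OF A m c] .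
  qed
qed

end

lemma weak_solution_fields:
  assumes T: "T > 0" and cv: "cv > 0" and weak: "weak_solution T cv rho0 theta0 u0 rho theta u"
  shows "\<exists>K \<rho> \<theta> a b. euler_fields T cv K \<rho> \<theta> a b \<and> euler_fields.represents T \<rho> \<theta> a b rho theta u"
proof -
  have m: "(\<lambda>(t, x). rho t x) \<in> borel_measurable (lebesgue_on ({0..T} \<times> UNIV))"
    "(\<lambda>(t, x). theta t x) \<in> borel_measurable (lebesgue_on ({0..T} \<times> UNIV))"
    "(\<lambda>(t, x). u t x) \<in> borel_measurable (lebesgue_on ({0..T} \<times> UNIV))"
    using weak unfolding weak_solution_def bounded_field_def by blast+
  have "(\<lambda>z. fst ((\<lambda>(t, x). u t x) z)) \<in> borel_measurable (lebesgue_on ({0..T} \<times> UNIV))"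
    "(\<lambda>z. snd ((\<lambda>(t, x). u t x) z)) \<in> borel_measurable (lebesgue_on ({0..T} \<times> UNIV))"
    using measurable_compose[OF m(3) borel_measurable_continuous_onI[OF continuous_on_fst[OF continuous_on_id]]]
      measurable_compose[OF m(3) borel_measurable_continuous_onI[OF continuous_on_snd[OF continuous_on_id]]] by auto
  then have mu: "(\<lambda>(t, x). fst (u t x)) \<in> borel_measurable (lebesgue_on ({0..T} \<times> UNIV))"
    "(\<lambda>(t, x). snd (u t x)) \<in> borel_measurable (lebesgue_on ({0..T} \<times> UNIV))"
    by (simp_all add: case_prod_unfold)
  obtain r0 where r0[measurable]: "r0 \<in> borel_measurable borel"
    "AE z in lborel. fst z \<in> {0..T} \<longrightarrow> rho (fst z) (snd z) = r0 z" by (rule borel_representative[OF m(1)])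
  obtain t0 where t0[measurable]: "t0 \<in> borel_measurable borel"
    "AE z in lborel. fst z \<in> {0..T} \<longrightarrow> theta (fst z) (snd z) = t0 z" by (rule borel_representative[OF m(2)])
  obtain a0 where a0[measurable]: "a0 \<in> borel_measurable borel"
    "AE z in lborel. fst z \<in> {0..T} \<longrightarrow> fst (u (fst z) (snd z)) = a0 z" by (rule borel_representative[OF mu(1)])
  obtain b0 where b0[measurable]: "b0 \<in> borel_measurable borel"
    "AE z in lborel. fst z \<in> {0..T} \<longrightarrow> snd (u (fst z) (snd z)) = b0 z" by (rule borel_representative[OF mu(2)])
  obtain rho_b theta_b s_b u_b where bd: "AE z in lebesgue_on ({0<..<T} \<times> UNIV). case z of (t, x) \<Rightarrow>
        0 < rho t x \<and> rho t x \<le> rho_b \<and> 0 < theta t x \<and> theta t x \<le> theta_b \<and>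
        \<bar>entropy cv (rho t x) (theta t x)\<bar> < s_b \<and> norm (u t x) < u_b"
    using weak unfolding weak_solution_def by blast
  then have "AE z in lebesgue. z \<in> {0<..<T} \<times> UNIV \<longrightarrow> (case z of (t, x) \<Rightarrow>
        0 < rho t x \<and> rho t x \<le> rho_b \<and> 0 < theta t x \<and> theta t x \<le> theta_b \<and>
        \<bar>entropy cv (rho t x) (theta t x)\<bar> < s_b \<and> norm (u t x) < u_b)"
    by (subst (asm) AE_restrict_space_iff) (auto intro!: sets_completionI_sets borel_open open_Times)
  then have bd': "AE z in lborel. z \<in> {0<..<T} \<times> UNIV \<longrightarrow> (case z of (t, x) \<Rightarrow>
        0 < rho t x \<and> rho t x \<le> rho_b \<and> 0 < theta t x \<and> theta t x \<le> theta_b \<and>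
        \<bar>entropy cv (rho t x) (theta t x)\<bar> < s_b \<and> norm (u t x) < u_b)"
    unfolding AE_completion_iff .
  define K where "K = Max {1, rho_b, theta_b, s_b, u_b}"
  have K: "1 \<le> K" "rho_b \<le> K" "theta_b \<le> K" "s_b \<le> K" "u_b \<le> K" unfolding K_def by (auto intro: Max_ge)
  \<comment> \<open>A Borel set of full measure in the time interval. Off it the fields are set to
    density 1, temperature 1 and velocity 0, a state of entropy 0, which satisfies all bounds
    because \<open>K \<ge> 1\<close>.\<close>
  define ok where "ok z \<longleftrightarrow> 0 < r0 z \<and> r0 z \<le> K \<and> 0 < t0 z \<and> t0 z \<le> K \<and>
     \<bar>entropy cv (r0 z) (t0 z)\<bar> \<le> K \<and> \<bar>a0 z\<bar> \<le> K \<and> \<bar>b0 z\<bar> \<le> K" for z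
  have [measurable]: "Measurable.pred borel ok" unfolding ok_def[abs_def] by measurable
  define \<rho> \<theta> a b where "\<rho> = (\<lambda>z. if ok z then r0 z else 1)" and "\<theta> = (\<lambda>z. if ok z then t0 z else 1)"
    and "a = (\<lambda>z. if ok z then a0 z else 0)" and "b = (\<lambda>z. if ok z then b0 z else 0)"
  have fields: "euler_fields T cv K \<rho> \<theta> a b"
  proof
    show "\<rho> \<in> borel_measurable borel" "\<theta> \<in> borel_measurable borel"
      "a \<in> borel_measurable borel" "b \<in> borel_measurable borel"
      unfolding \<rho>_def \<theta>_def a_def b_def by measurable
    fix z
    have "entropy cv 1 1 = 0" by (simp add: entropy_def)
    then show "\<bar>entropy cv (\<rho> z) (\<theta> z)\<bar> \<le> K" using K(1) by (simp add: \<rho>_def \<theta>_def ok_def)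
  qed (use T cv K(1) in \<open>auto simp: \<rho>_def \<theta>_def a_def b_def ok_def\<close>)
  have "AE z in lborel. fst z \<in> {0<..<T} \<longrightarrow>
     rho (fst z) (snd z) = \<rho> z \<and> theta (fst z) (snd z) = \<theta> z \<and> u (fst z) (snd z) = (a z, b z)"
    using r0(2) t0(2) a0(2) b0(2) bd'
  proof eventually_elim
    case (elim z)
    show ?case
    proof
      assume z: "fst z \<in> {0<..<T}"
      have "\<bar>fst (u (fst z) (snd z))\<bar> \<le> norm (u (fst z) (snd z))" "\<bar>snd (u (fst z) (snd z))\<bar> \<le> norm (u (fst z) (snd z))"
        using norm_fst_le[of "fst (u (fst z) (snd z))" "snd (u (fst z) (snd z))"]
          norm_snd_le[of "snd (u (fst z) (snd z))" "fst (u (fst z) (snd z))"] by simp_all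
      moreover have "(case z of (t, x) \<Rightarrow>
        0 < rho t x \<and> rho t x \<le> rho_b \<and> 0 < theta t x \<and> theta t x \<le> theta_b \<and>
        \<bar>entropy cv (rho t x) (theta t x)\<bar> < s_b \<and> norm (u t x) < u_b)"
        using elim(5) z by (cases z) auto
      moreover have "rho (fst z) (snd z) = r0 z" "theta (fst z) (snd z) = t0 z"
         "fst (u (fst z) (snd z)) = a0 z" "snd (u (fst z) (snd z)) = b0 z"
        using elim(1-4) z by auto
      ultimately have "ok z" using K by (auto simp: ok_def case_prod_unfold)
      then show "rho (fst z) (snd z) = \<rho> z \<and> theta (fst z) (snd z) = \<theta> z \<and> u (fst z) (snd z) = (a z, b z)"
        using elim(1-4) z by (auto simp: \<rho>_def \<theta>_def a_def b_def prod_eq_iff)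
    qed
  qed
  then show ?thesis using fields euler_fields.represents_def[OF fields] by blast
qed

section \<open>Integration over slabs\<close>

text \<open>A class closed under the algebraic operations and contained in the integrable functions
  on bounded Borel sets, so the integrability of long expressions is settled by introduction
  rules.\<close>

definition bounded_borel :: "('a::euclidean_space) set \<Rightarrow> ('a \<Rightarrow> real) \<Rightarrow> bool" where
  "bounded_borel A f \<longleftrightarrow> f \<in> borel_measurable borel \<and> (\<exists>C. \<forall>x\<in>A. \<bar>f x\<bar> \<le> C)"

lemma bounded_borelI: "f \<in> borel_measurable borel \<Longrightarrow> (\<And>x. x \<in> A \<Longrightarrow> \<bar>f x\<bar> \<le> C) \<Longrightarrow> bounded_borel A f"
  unfolding bounded_borel_def by blast

lemma bounded_borel_const: "bounded_borel A (\<lambda>x. c)"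
  by (rule bounded_borelI) auto

lemma bounded_borel_add: "bounded_borel A f \<Longrightarrow> bounded_borel A g \<Longrightarrow> bounded_borel A (\<lambda>x. f x + g x)"
  unfolding bounded_borel_def
proof (elim conjE exE, intro conjI)
  fix C D assume "\<forall>x\<in>A. \<bar>f x\<bar> \<le> C" "\<forall>x\<in>A. \<bar>g x\<bar> \<le> D"
  then show "\<exists>C. \<forall>x\<in>A. \<bar>f x + g x\<bar> \<le> C" by (intro exI[of _ "C + D"]) force
qed auto

lemma bounded_borel_mult: "bounded_borel A f \<Longrightarrow> bounded_borel A g \<Longrightarrow> bounded_borel A (\<lambda>x. f x * g x)"
  unfolding bounded_borel_def
proof (elim conjE exE, intro conjI)
  fix C D assume *: "\<forall>x\<in>A. \<bar>f x\<bar> \<le> C" "\<forall>x\<in>A. \<bar>g x\<bar> \<le> D"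
  have "\<bar>f x * g x\<bar> \<le> \<bar>C\<bar> * \<bar>D\<bar>" if "x \<in> A" for x
    unfolding abs_mult using *(1)[rule_format, OF that] *(2)[rule_format, OF that] by (intro mult_mono) auto
  then show "\<exists>C. \<forall>x\<in>A. \<bar>f x * g x\<bar> \<le> C" by blast
qed auto

lemma bounded_borel_minus: "bounded_borel A f \<Longrightarrow> bounded_borel A (\<lambda>x. - f x)"
  using bounded_borel_mult[OF bounded_borel_const[of _ "-1"]] by fastforce

lemma bounded_borel_diff: "bounded_borel A f \<Longrightarrow> bounded_borel A g \<Longrightarrow> bounded_borel A (\<lambda>x. f x - g x)"
  using bounded_borel_add[OF _ bounded_borel_minus] by fastforce

lemma bounded_borel_power: "bounded_borel A f \<Longrightarrow> bounded_borel A (\<lambda>x. (f x) ^ n)"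
  by (induction n) (auto intro: bounded_borel_const bounded_borel_mult)

lemma bounded_borel_subset: "bounded_borel B f \<Longrightarrow> A \<subseteq> B \<Longrightarrow> bounded_borel A f"
  unfolding bounded_borel_def by blast

lemma bounded_borel_continuous:
  assumes "continuous_on B f" "compact B" "A \<subseteq> B" "f \<in> borel_measurable borel"
  shows "bounded_borel A f"
proof -
  have "bounded (f ` B)" using compact_continuous_image[OF assms(1,2)] compact_imp_bounded by blast
  then obtain C where "\<forall>x\<in>B. \<bar>f x\<bar> \<le> C" unfolding bounded_iff by auto
  then show ?thesis using assms(3,4) unfolding bounded_borel_def by blast
qed

lemmas bounded_borel_intros = bounded_borel_const bounded_borel_add bounded_borel_mult bounded_borel_minus
  bounded_borel_diff bounded_borel_power

lemma bounded_borel_set_integrable: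
  assumes "bounded_borel A f" "A \<in> sets borel" "bounded A"
  shows "set_integrable lborel A f"
proof -
  obtain C where C: "\<And>x. x \<in> A \<Longrightarrow> \<bar>f x\<bar> \<le> C" and [measurable]: "f \<in> borel_measurable borel"
    using assms(1) unfolding bounded_borel_def by blast
  have "emeasure lborel A < \<infinity>" using assms(3) by (rule emeasure_bounded_finite)
  then show ?thesis
    unfolding set_integrable_def
    by (intro integrableI_bounded_set_indicator[where B = C]) (use C assms(2) in auto)
qed

lemma cell_borel [measurable, simp]: "cell L \<in> sets borel" and slab_borel [measurable, simp]: "slab \<tau> L \<in> sets borel"
  unfolding cell_def slab_def by (auto intro!: borel_closed closed_Times simp flip: borel_prod)

lemma cell_bounded [simp]: "bounded (cell L)" and slab_bounded [simp]: "bounded (slab \<tau> L)"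
  unfolding cell_def slab_def by (auto intro!: bounded_Times)

lemma cell_integrable: "bounded_borel (cell L) f \<Longrightarrow> set_integrable lborel (cell L) f"
  and slab_integrable: "bounded_borel (slab \<tau> L) g \<Longrightarrow> set_integrable lborel (slab \<tau> L) g"
  by (auto intro: bounded_borel_set_integrable)

lemma slab_continuous:
  assumes "continuous_on ({0..\<tau>} \<times> (UNIV :: real set)) (\<lambda>(t, x). f t x)"
    and [measurable]: "(\<lambda>p. f (fst p) (snd p)) \<in> borel_measurable borel"
  shows "bounded_borel (slab \<tau> L) (\<lambda>z. f (fst z) (fst (snd z)))"
proof (rule bounded_borel_continuous)
  show "compact ({0..\<tau>} \<times> {-L..L} \<times> {0..1::real})" by (intro compact_Times compact_Icc)
  show "slab \<tau> L \<subseteq> {0..\<tau>} \<times> {-L..L} \<times> {0..1::real}" by (auto simp: slab_def cell_def)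
  show "continuous_on ({0..\<tau>} \<times> {-L..L} \<times> {0..1::real}) (\<lambda>z. f (fst z) (fst (snd z)))"
  proof -
    have "continuous_on ({0..\<tau>} \<times> {-L..L} \<times> {0..1::real}) (\<lambda>z. (\<lambda>(t, x). f t x) (fst z, fst (snd z)))"
      by (rule continuous_on_compose2[OF assms(1)]) (auto intro!: continuous_intros)
    then show ?thesis by simp
  qed
  have "(\<lambda>z. (fst z, fst (snd z))) \<in> borel_measurable (borel :: (real \<times> (real \<times> real)) measure)"
    by (intro borel_measurable_continuous_onI continuous_intros)
  from measurable_compose[OF this assms(2)]
  show "(\<lambda>z::real \<times> (real \<times> real). f (fst z) (fst (snd z))) \<in> borel_measurable borel" by simp
qed

lemma cell_continuous:
  assumes "continuous_on UNIV f"
  shows "bounded_borel (cell L) (\<lambda>x. f (fst x))"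
proof (rule bounded_borel_continuous)
  show "compact ({-L..L} \<times> {0..1::real})" by (intro compact_Times compact_Icc)
  show "continuous_on ({-L..L} \<times> {0..1::real}) (\<lambda>z. f (fst z))"
    by (intro continuous_on_compose2[OF assms] continuous_intros) auto
  show "(\<lambda>z. f (fst z)) \<in> borel_measurable borel"
    by (intro borel_measurable_continuous_onI continuous_on_compose2[OF assms] continuous_intros) auto
qed (auto simp: cell_def)

text \<open>The variable \<open>x2\<close> contributes only the length 1 of its period.\<close>

lemma set_integral_cell_fst:
  assumes f: "bounded_borel (cell L) (\<lambda>x. f (fst x))"
  shows "(LINT x:cell L|lborel. f (fst x)) = (LINT y:{-L..L}|lborel. f y)"
proof -
  have int: "integrable (lborel \<Otimes>\<^sub>M lborel) (\<lambda>x. indicator (cell L) x *\<^sub>R f (fst x))"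
    using cell_integrable[OF f] unfolding set_integrable_def lborel_prod .
  have "(LINT x:cell L|lborel. f (fst x)) = (LINT y|lborel. LINT y2|lborel. indicator (cell L) (y, y2) *\<^sub>R f y)"
    unfolding set_lebesgue_integral_def using lborel_pair.integral_fst'[OF int] by (simp add: lborel_prod)
  also have "\<dots> = (LINT y|lborel. LINT y2|lborel. (indicator {-L..L} y * f y) * indicator {0..1::real} y2)"
    by (intro Bochner_Integration.integral_cong refl) (auto simp: cell_def indicator_def)
  also have "\<dots> = (LINT y:{-L..L}|lborel. f y)"
    by (simp add: set_lebesgue_integral_def)
  finally show ?thesis .
qed

lemma set_integral_slab_iterated:
  assumes f: "bounded_borel (slab \<tau> L) (\<lambda>z. f (fst z) (fst (snd z)))"
    and f': "\<And>t. t \<in> {0<..<\<tau>} \<Longrightarrow> bounded_borel (cell L) (\<lambda>x. f t (fst x))"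
  shows "(LINT z:slab \<tau> L|lborel. f (fst z) (fst (snd z))) = (LINT t:{0<..<\<tau>}|lborel. LINT y:{-L..L}|lborel. f t y)"
proof -
  have int: "integrable (lborel \<Otimes>\<^sub>M lborel) (\<lambda>z. indicator (slab \<tau> L) z *\<^sub>R f (fst z) (fst (snd z)))"
    using slab_integrable[OF f] unfolding set_integrable_def lborel_prod .
  have "(LINT z:slab \<tau> L|lborel. f (fst z) (fst (snd z)))
      = (LINT t|lborel. LINT x|lborel. indicator (slab \<tau> L) (t, x) *\<^sub>R f t (fst x))"
    unfolding set_lebesgue_integral_def using lborel_pair.integral_fst'[OF int] by (simp add: lborel_prod)
  also have "\<dots> = (LINT t|lborel. indicator {0<..<\<tau>} t *\<^sub>R (LINT y:{-L..L}|lborel. f t y))"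
  proof (intro Bochner_Integration.integral_cong refl)
    fix t
    show "(LINT x|lborel. indicator (slab \<tau> L) (t, x) *\<^sub>R f t (fst x)) = indicator {0<..<\<tau>} t *\<^sub>R (LINT y:{-L..L}|lborel. f t y)"
    proof (cases "t \<in> {0<..<\<tau>}")
      case True
      then show ?thesis
        unfolding set_integral_cell_fst[OF f'[OF True], symmetric]
        by (simp add: set_lebesgue_integral_def slab_def indicator_times)
    qed (simp add: slab_def indicator_times)
  qed
  finally show ?thesis by (simp add: set_lebesgue_integral_def)
qed

lemma continuous_on_slices:
  assumes "continuous_on ({0..\<tau>} \<times> UNIV) (\<lambda>(t, x). f t (x::real))"
  shows "t \<in> {0..\<tau>} \<Longrightarrow> continuous_on UNIV (f t)" and "continuous_on {0..\<tau>} (\<lambda>t. f t x)"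
proof -
  show "continuous_on UNIV (f t)" if "t \<in> {0..\<tau>}"
  proof -
    have "continuous_on UNIV (\<lambda>x. (\<lambda>(t, x). f t x) (t, x))"
      by (rule continuous_on_compose2[OF assms]) (use that in \<open>auto intro!: continuous_intros\<close>)
    then show ?thesis by simp
  qed
  have "continuous_on {0..\<tau>} (\<lambda>t. (\<lambda>(t, x). f t x) (t, x))"
    by (rule continuous_on_compose2[OF assms]) (auto intro!: continuous_intros)
  then show "continuous_on {0..\<tau>} (\<lambda>t. f t x)" by simp
qed

text \<open>The divergence theorem for explicit smooth functions of \<open>t\<close> and
  \<open>x1\<close>: Fubini and the fundamental theorem in each variable, with no lateral
  contribution since \<open>B\<close> vanishes at \<open>L\<close> and \<open>-L\<close>. It serves
  for the pressure of the profile, to which no weak law applies.\<close>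

lemma slab_divergence:
  fixes A B A' B' :: "real \<Rightarrow> real \<Rightarrow> real"
  assumes \<tau>: "\<tau> > 0" and L: "L \<ge> 0"
    and A: "\<And>t x. t \<in> {0..\<tau>} \<Longrightarrow> ((\<lambda>t. A t x) has_real_derivative A' t x) (at t)"
    and B: "\<And>t x. t \<in> {0..\<tau>} \<Longrightarrow> ((\<lambda>x. B t x) has_real_derivative B' t x) (at x)"
    and cA: "continuous_on ({0..\<tau>} \<times> UNIV) (\<lambda>(t, x). A' t x)"
    and cB: "continuous_on ({0..\<tau>} \<times> UNIV) (\<lambda>(t, x). B' t x)"
    and mA: "(\<lambda>p. A' (fst p) (snd p)) \<in> borel_measurable borel"
    and mB: "(\<lambda>p. B' (fst p) (snd p)) \<in> borel_measurable borel"
    and cA0: "\<And>t. t \<in> {0..\<tau>} \<Longrightarrow> continuous_on UNIV (A t)"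
    and zero: "\<And>t. B t L = 0" "\<And>t. B t (-L) = 0"
  shows "(LINT x:cell L|lborel. A \<tau> (fst x) - A 0 (fst x))
       = (LINT z:slab \<tau> L|lborel. A' (fst z) (fst (snd z)) + B' (fst z) (fst (snd z)))"
proof -
  note bA = slab_continuous[OF cA mA, of L] and bB = slab_continuous[OF cB mB, of L]
  have "(LINT z:slab \<tau> L|lborel. B' (fst z) (fst (snd z))) = (LINT t:{0<..<\<tau>}|lborel. LINT y:{-L..L}|lborel. B' t y)"
    by (intro set_integral_slab_iterated bB cell_continuous continuous_on_slices(1)[OF cB]) auto
  also have "\<dots> = (LINT t:{0<..<\<tau>}|lborel. 0)"
  proof (rule set_lebesgue_integral_cong, simp, intro allI impI)
    fix t assume t: "t \<in> {0<..<\<tau>}"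
    have "(LINT y:{-L..L}|lborel. B' t y) = B t L - B t (-L)"
      unfolding set_lebesgue_integral_def
    proof (rule integral_FTC_Icc)
      show "(B t has_vector_derivative B' t x) (at x within {- L..L})" for x
        using B[of t x] t by (auto simp: has_real_derivative_iff_has_vector_derivative intro: has_vector_derivative_at_within)
      show "continuous_on {- L..L} (B' t)"
        using continuous_on_slices(1)[OF cB, of t] t continuous_on_subset by fastforce
    qed (use L in auto)
    then show "(LINT y:{-L..L}|lborel. B' t y) = 0" using zero by simp
  qed
  finally have B0: "(LINT z:slab \<tau> L|lborel. B' (fst z) (fst (snd z))) = 0" by simp
  have FTC: "(LINT t:{0<..<\<tau>}|lborel. A' t y) = A \<tau> y - A 0 y" for y
  proof -
    have "(LINT t:{0<..<\<tau>}|lborel. A' t y) = (LINT t:{0..\<tau>}|lborel. A' t y)"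
    proof (rule set_integral_cong_set)
      have "(\<lambda>t. (t, y)) \<in> borel_measurable borel"
        by (intro borel_measurable_continuous_onI continuous_intros)
      from measurable_compose[OF this mA] have [measurable]: "(\<lambda>t. A' t y) \<in> borel_measurable borel" by simp
      show "set_borel_measurable lborel {0<..<\<tau>} (\<lambda>t. A' t y)" "set_borel_measurable lborel {0..\<tau>} (\<lambda>t. A' t y)"
        unfolding set_borel_measurable_def by simp_all
      show "AE t in lborel. (t \<in> {0..\<tau>}) = (t \<in> {0<..<\<tau>})"
        using AE_lborel_singleton[of 0] AE_lborel_singleton[of \<tau>] by eventually_elim auto
    qed
    also have "\<dots> = A \<tau> y - A 0 y"
      unfolding set_lebesgue_integral_def
    proof (rule integral_FTC_Icc)
      show "((\<lambda>t. A t y) has_vector_derivative A' t y) (at t within {0..\<tau>})" if "0 \<le> t" "t \<le> \<tau>" for t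
        using A[of t y] that by (auto simp: has_real_derivative_iff_has_vector_derivative intro: has_vector_derivative_at_within)
      show "continuous_on {0..\<tau>} (\<lambda>t. A' t y)" by (rule continuous_on_slices(2)[OF cA])
    qed (use \<tau> in auto)
    finally show ?thesis .
  qed
  have "(LINT z:slab \<tau> L|lborel. A' (fst z) (fst (snd z))) = (LINT t:{0<..<\<tau>}|lborel. LINT y:{-L..L}|lborel. A' t y)"
    by (intro set_integral_slab_iterated bA cell_continuous continuous_on_slices(1)[OF cA]) auto
  also have "\<dots> = (LINT t|lborel. LINT y|lborel. indicator ({0<..<\<tau>} \<times> {-L..L}) (t, y) *\<^sub>R A' t y)"
    unfolding set_lebesgue_integral_def
    by (intro Bochner_Integration.integral_cong refl) (simp add: indicator_times mult.assoc)
  also have "\<dots> = (LINT y|lborel. LINT t|lborel. indicator ({0<..<\<tau>} \<times> {-L..L}) (t, y) *\<^sub>R A' t y)"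
  proof (rule lborel_pair.Fubini_integral[symmetric])
    have "bounded_borel ({0<..<\<tau>} \<times> {-L..L}) (\<lambda>(t, y). A' t y)"
      by (rule bounded_borel_continuous[where B = "{0..\<tau>} \<times> {-L..L}"])
         (use continuous_on_subset[OF cA, of "{0..\<tau>} \<times> {-L..L}"] mA in \<open>auto intro!: compact_Times simp: case_prod_unfold\<close>)
    then have "set_integrable lborel ({0<..<\<tau>} \<times> {-L..L}) (\<lambda>(t, y). A' t y)"
      by (rule bounded_borel_set_integrable) (auto intro!: bounded_Times simp flip: borel_prod)
    then show "integrable (lborel \<Otimes>\<^sub>M lborel) (\<lambda>(t, y). indicator ({0<..<\<tau>} \<times> {-L..L}) (t, y) *\<^sub>R A' t y)"
      unfolding set_integrable_def lborel_prod by (simp add: case_prod_unfold)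
  qed
  also have "\<dots> = (LINT y:{-L..L}|lborel. LINT t:{0<..<\<tau>}|lborel. A' t y)"
    unfolding set_lebesgue_integral_def
    by (intro Bochner_Integration.integral_cong refl) (auto simp: indicator_def)
  also have "\<dots> = (LINT y:{-L..L}|lborel. A \<tau> y - A 0 y)" by (simp add: FTC)
  also have "\<dots> = (LINT x:cell L|lborel. A \<tau> (fst x) - A 0 (fst x))"
  proof (rule set_integral_cell_fst[symmetric])
    show "bounded_borel (cell L) (\<lambda>x. A \<tau> (fst x) - A 0 (fst x))"
      by (rule cell_continuous) (use \<tau> cA0 in \<open>auto intro!: continuous_intros\<close>)
  qed
  finally show ?thesis
    using B0 by (subst set_integral_add(2)) (auto intro: slab_integrable bA bB)
qed

section \<open>The relative energy inequality\<close>

definition rel_energy :: "real \<Rightarrow> real \<Rightarrow> real \<Rightarrow> real \<Rightarrow> real \<Rightarrow> real \<Rightarrow> real \<Rightarrow> real \<Rightarrow> real" where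
  "rel_energy cv S r t a b U h = 1 / 2 * r * ((a - U)\<^sup>2 + b\<^sup>2) + rel_internal cv S r t h"

text \<open>The flux that accompanies \<open>rel_energy\<close>. It has no sign; it is paired with
  the derivative of the cut-off and need only be small near infinity, where it vanishes at the far
  state.\<close>

definition rel_flux :: "real \<Rightarrow> real \<Rightarrow> real \<Rightarrow> real \<Rightarrow> real \<Rightarrow> real \<Rightarrow> real \<Rightarrow> real \<Rightarrow> real" where
  "rel_flux cv S r t a b U h = 1 / 2 * r * a * ((a - U)\<^sup>2 + b\<^sup>2) + (cv + 1) * r * a * (t - h)
     - U * (r * t - exp (- S) * h powr (cv + 1)) - r * (entropy cv r t - S) * h * a"

text \<open>\<open>rel_energy\<close> is the Bregman distance of the total energy as a function of
  density, momentum and total entropy. The weights are minus its partial derivatives at the profile,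
  and the pressure of the profile is the constant left over by the linearisation.\<close>

lemma rel_energy_combination:
  "energy cv r t (a, b) - r * a * U + r * (U\<^sup>2 / 2 - (cv + 1) * h) - r * (entropy cv r t - S) * h
     + exp (- S) * h powr (cv + 1) = rel_energy cv S r t a b U h"
  by (simp add: energy_def rel_energy_def rel_internal_def norm_Pair power2_eq_square algebra_simps)

lemma rel_flux_combination:
  "(energy cv r t (a, b) + r * t) * a - (r * a\<^sup>2 + r * t) * U + r * a * (U\<^sup>2 / 2 - (cv + 1) * h)
     - r * (entropy cv r t - S) * a * h + exp (- S) * h powr (cv + 1) * U = rel_flux cv S r t a b U h"
  by (simp add: energy_def rel_flux_def norm_Pair power2_eq_square algebra_simps)

text \<open>All terms that are first order in the deviation cancel, up to the defects \<open>e1\<close>, \<open>e2\<close> of the profile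
  in the two equations of the simple wave.\<close>

lemma relative_bulk_identity:
  fixes r t a d w w' h h' \<xi> R cv :: real
  assumes "cv \<noteq> 0"
  defines "e1 \<equiv> (w - \<xi>) * w' + (cv + 1) * h'" and "e2 \<equiv> (w - \<xi>) * h' + h * w' / cv"
  shows "r * a * w' * \<xi> - (r * a\<^sup>2 + r * t) * w' + r * (a - \<xi>) * (w * w' - (cv + 1) * h') - r * d * (a - \<xi>) * h'
           + (cv + 1) * R * h' * (w - \<xi>) + R * h * w'
       = - (w' * (r * (a - w)\<^sup>2 + (cv * r * t - (cv + 1) * r * h - r * d * h + R * h) / cv) + r * d * (a - w) * h')
         - r * (a - w) * e1 - ((cv + 1) * (r - R) + r * d) * e2"
  unfolding e1_def e2_def using assms(1)
  by (simp add: field_simps power2_eq_square)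

lemma bounded_borel_test_bulk:
  assumes \<epsilon>: "\<epsilon> > 0" and qf: "bounded_borel UNIV q" "bounded_borel UNIV f"
    and \<psi>: "cutoff L \<psi> \<psi>'" and g: "C1_pair g g'"
  shows "bounded_borel (slab \<tau> L) (test_bulk \<epsilon> q f \<psi> \<psi>' g g')"
proof -
  have c: "continuous_on A \<psi>" "continuous_on A \<psi>'" "continuous_on A g" "continuous_on A g'" for A
    using C1_pair_continuous[of \<psi> \<psi>'] C1_pair_continuous[OF g] \<psi> unfolding cutoff_def by auto
  have [measurable]: "\<psi> \<in> borel_measurable borel" "\<psi>' \<in> borel_measurable borel"
    "g \<in> borel_measurable borel" "g' \<in> borel_measurable borel"
    using c by (auto intro: borel_measurable_continuous_onI)
  define X where "X t x1 = - \<psi> x1 * (g' (x1 / (t + \<epsilon>)) * (x1 / (t + \<epsilon>))) / (t + \<epsilon>)" for t x1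
  define Y where "Y t x1 = \<psi>' x1 * g (x1 / (t + \<epsilon>)) + \<psi> x1 * g' (x1 / (t + \<epsilon>)) / (t + \<epsilon>)" for t x1
  have bX: "bounded_borel (slab \<tau> L) (\<lambda>z. X (fst z) (fst (snd z)))"
  proof (rule slab_continuous)
    show "continuous_on ({0..\<tau>} \<times> UNIV) (\<lambda>(t, x). X t x)"
      unfolding X_def case_prod_unfold using \<epsilon>
      by (intro continuous_intros continuous_on_compose2[OF c(1)[of UNIV]] continuous_on_compose2[OF c(4)[of UNIV]]) auto
    show "(\<lambda>p. X (fst p) (snd p)) \<in> borel_measurable borel"
      unfolding X_def by (simp flip: borel_prod) measurable
  qed
  have bY: "bounded_borel (slab \<tau> L) (\<lambda>z. Y (fst z) (fst (snd z)))"
  proof (rule slab_continuous)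
    show "continuous_on ({0..\<tau>} \<times> UNIV) (\<lambda>(t, x). Y t x)"
      unfolding Y_def case_prod_unfold using \<epsilon>
      by (intro continuous_intros continuous_on_compose2[OF c(1)[of UNIV]] continuous_on_compose2[OF c(2)[of UNIV]]
          continuous_on_compose2[OF c(3)[of UNIV]] continuous_on_compose2[OF c(4)[of UNIV]]) auto
    show "(\<lambda>p. Y (fst p) (snd p)) \<in> borel_measurable borel"
      unfolding Y_def by (simp flip: borel_prod) measurable
  qed
  have "test_bulk \<epsilon> q f \<psi> \<psi>' g g' = (\<lambda>z. q z * X (fst z) (fst (snd z)) + f z * Y (fst z) (fst (snd z)))"
    by (auto simp: test_bulk_def X_def Y_def)
  then show ?thesis
    using bX bY qf by (auto intro!: bounded_borel_intros intro: bounded_borel_subset)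
qed

lemma bounded_borel_slice:
  fixes q :: "real \<times> (real \<times> real) \<Rightarrow> real"
  assumes "bounded_borel UNIV q" shows "bounded_borel A (\<lambda>x. q (\<tau>, x))"
proof -
  have "Pair \<tau> \<in> borel_measurable (borel :: (real \<times> real) measure)"
    by (intro borel_measurable_continuous_onI continuous_intros)
  from measurable_compose[OF this] show ?thesis
    using assms unfolding bounded_borel_def by (metis UNIV_I)
qed

lemma bounded_borel_fst:
  assumes "bounded_borel UNIV f" shows "bounded_borel A (\<lambda>x::real \<times> real. f (fst x))"
proof -
  have "fst \<in> borel_measurable (borel :: (real \<times> real) measure)"
    by (intro borel_measurable_continuous_onI continuous_intros)
  from measurable_compose[OF this] show ?thesis
    using assms unfolding bounded_borel_def by (metis UNIV_I)
qed

lemma bounded_borel_test_jump: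
  assumes q: "bounded_borel UNIV q" and q0: "bounded_borel UNIV q0"
    and \<psi>: "cutoff L \<psi> \<psi>'" and g: "C1_pair g g'"
  shows "bounded_borel (cell L) (test_jump \<tau> \<epsilon> q q0 \<psi> g)"
proof -
  have c: "continuous_on A \<psi>" "continuous_on A g" for A
    using C1_pair_continuous[of \<psi> \<psi>'] C1_pair_continuous[OF g] \<psi> unfolding cutoff_def by auto
  have b: "bounded_borel (cell L) (\<lambda>x. \<psi> (fst x) * g (fst x / e))" for e
    unfolding divide_inverse
    by (intro cell_continuous[of "\<lambda>x. \<psi> x * g (x * inverse e)"] continuous_intros c
        continuous_on_compose2[OF c(2)[of UNIV]]) auto
  have "test_jump \<tau> \<epsilon> q q0 \<psi> g = (\<lambda>x. q (\<tau>, x) * (\<psi> (fst x) * g (fst x / (\<tau> + \<epsilon>))) - q0 (fst x) * (\<psi> (fst x) * g (fst x / \<epsilon>)))"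
    by (auto simp: test_jump_def)
  then show ?thesis
    using bounded_borel_diff[OF bounded_borel_mult[OF bounded_borel_slice[OF q] b]
        bounded_borel_mult[OF bounded_borel_fst[OF q0] b]] by simp
qed

context euler_fields
begin

lemma fields_bounded:
  "bounded_borel A \<rho>" "bounded_borel A \<theta>" "bounded_borel A a" "bounded_borel A b"
  "bounded_borel A (\<lambda>z. entropy cv (\<rho> z) (\<theta> z))"
  "bounded_borel A (\<lambda>z. energy cv (\<rho> z) (\<theta> z) (a z, b z))"
proof -
  show *: "bounded_borel A \<rho>" "bounded_borel A \<theta>" "bounded_borel A a" "bounded_borel A b"
    using meas bounds by (auto intro!: bounded_borelI[where C = K] simp: abs_of_pos)
  show "bounded_borel A (\<lambda>z. entropy cv (\<rho> z) (\<theta> z))"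
    using bounds by (auto intro!: bounded_borelI[where C = K])
  have "(\<lambda>z. energy cv (\<rho> z) (\<theta> z) (a z, b z)) = (\<lambda>z. 1 / 2 * \<rho> z * ((a z)\<^sup>2 + (b z)\<^sup>2) + cv * \<rho> z * \<theta> z)"
    by (simp add: energy_def norm_Pair)
  then show "bounded_borel A (\<lambda>z. energy cv (\<rho> z) (\<theta> z) (a z, b z))"
    unfolding bounded_borel_def[symmetric] by (simp only:) (intro bounded_borel_intros *)
qed

text \<open>\<open>relative_bulk_identity\<close> writes the left-hand side as minus the dissipation
  of \<open>rarefaction_dissipation_nonneg\<close> plus two defect terms. The former is dropped; the
  constant collects bounds for the factors of \<open>e1\<close> and \<open>e2\<close>.\<close>

lemma relative_bulk_le:
  assumes sp: "smooth_profile cv \<delta> v c w w' k k'" and \<delta>: "\<delta> > 0"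
    and W: "\<bar>w \<xi>\<bar> \<le> W" "0 < k \<xi>" "k \<xi> \<le> W" and s: "S \<le> entropy cv (\<rho> z) (\<theta> z)"
  defines "h \<equiv> cv / (cv + 1) * (k \<xi>)\<^sup>2" and "h' \<equiv> cv / (cv + 1) * (2 * k \<xi> * k' \<xi>)"
  defines "R \<equiv> exp (- S) * h powr cv" and "d \<equiv> entropy cv (\<rho> z) (\<theta> z) - S"
  shows "\<rho> z * a z * w' \<xi> * \<xi> - (\<rho> z * (a z)\<^sup>2 + \<rho> z * \<theta> z) * w' \<xi>
           + \<rho> z * (a z - \<xi>) * (w \<xi> * w' \<xi> - (cv + 1) * h') - \<rho> z * d * (a z - \<xi>) * h'
           + (cv + 1) * R * h' * (w \<xi> - \<xi>) + R * h * w' \<xi>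
       \<le> (K * (K + W) + ((cv + 1) * (K + exp (- S) * (cv / (cv + 1) * W\<^sup>2) powr cv) + K * (K + \<bar>S\<bar>)) * (W / (cv + 1)))
           * ((2 + 1 / (2 * cv)) * \<delta>)"
proof -
  define C0 where "C0 = (2 + 1 / (2 * cv)) * \<delta>"
  define e1 e2 where "e1 = (w \<xi> - \<xi>) * w' \<xi> + (cv + 1) * h'" and "e2 = (w \<xi> - \<xi>) * h' + h * w' \<xi> / cv"
  have C0: "C0 \<ge> 0" using cv \<delta> by (simp add: C0_def)
  have W0: "W \<ge> 0" using W by linarith
  have hpos: "h > 0" using W cv by (simp add: h_def)
  have "e1 = (w \<xi> - \<xi>) * w' \<xi> + 2 * cv * k \<xi> * k' \<xi>"
    using cv by (simp add: e1_def h'_def)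
  then have e1: "\<bar>e1\<bar> \<le> C0"
    using sp unfolding smooth_profile_def C0_def by metis
  \<comment> \<open>The temperature form of the second wave equation is its sound speed form times
    \<open>k \<xi> / (cv + 1)\<close>, which explains the factor \<open>W / (cv + 1)\<close> in the
    final constant.\<close>
  have "e2 = k \<xi> / (cv + 1) * ((w \<xi> - \<xi>) * (2 * cv * k' \<xi>) + k \<xi> * w' \<xi>)"
  proof -
    have "h / cv = (k \<xi>)\<^sup>2 / (cv + 1)" using cv by (simp add: h_def)
    then have "e2 = (w \<xi> - \<xi>) * h' + (k \<xi>)\<^sup>2 / (cv + 1) * w' \<xi>"
      unfolding e2_def by (metis times_divide_eq_left mult.commute)
    then show ?thesis by (simp add: h'_def power2_eq_square add_divide_distrib diff_divide_distrib algebra_simps)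
  qed
  then have "\<bar>e2\<bar> = k \<xi> / (cv + 1) * \<bar>(w \<xi> - \<xi>) * (2 * cv * k' \<xi>) + k \<xi> * w' \<xi>\<bar>"
    using W cv by (simp add: abs_mult)
  also have "\<dots> \<le> W / (cv + 1) * C0"
    using sp W cv W0 unfolding smooth_profile_def C0_def by (intro mult_mono divide_right_mono) auto
  finally have e2: "\<bar>e2\<bar> \<le> W / (cv + 1) * C0" .
  have Rh: "R * h = exp (- S) * h powr (cv + 1)" using hpos by (simp add: R_def powr_add)
  have R: "0 \<le> R" "R \<le> exp (- S) * (cv / (cv + 1) * W\<^sup>2) powr cv"
    unfolding R_def h_def using W cv
    by (auto intro!: mult_left_mono powr_mono2 power_mono divide_right_mono)
  have "0 \<le> w' \<xi> * (\<rho> z * (a z - w \<xi>)\<^sup>2 + rel_internal cv S (\<rho> z) (\<theta> z) h / cv) + \<rho> z * d * (a z - w \<xi>) * h'"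
    unfolding h_def h'_def d_def
    by (rule rarefaction_dissipation_nonneg[OF cv])
       (use bounds W s sp in \<open>auto simp: smooth_profile_def\<close>)
  moreover have "rel_internal cv S (\<rho> z) (\<theta> z) h = cv * \<rho> z * \<theta> z - (cv + 1) * \<rho> z * h - \<rho> z * d * h + R * h"
    unfolding Rh rel_internal_def d_def by simp
  moreover have "- (\<rho> z * (a z - w \<xi>) * e1) \<le> K * (K + W) * C0"
  proof -
    have "\<bar>\<rho> z * (a z - w \<xi>) * e1\<bar> \<le> K * (K + W) * C0"
      unfolding abs_mult using bounds[of z] W e1 C0 K1 W0
      by (intro mult_mono) (auto simp: abs_of_pos)
    then show ?thesis by linarith
  qed
  moreover have "- (((cv + 1) * (\<rho> z - R) + \<rho> z * d) * e2) \<le>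
     ((cv + 1) * (K + exp (- S) * (cv / (cv + 1) * W\<^sup>2) powr cv) + K * (K + \<bar>S\<bar>)) * (W / (cv + 1) * C0)"
  proof -
    have "\<bar>\<rho> z - R\<bar> \<le> K + exp (- S) * (cv / (cv + 1) * W\<^sup>2) powr cv"
      using bounds(1,2)[of z] R by linarith
    then have 1: "\<bar>(cv + 1) * (\<rho> z - R)\<bar> \<le> (cv + 1) * (K + exp (- S) * (cv / (cv + 1) * W\<^sup>2) powr cv)"
      using cv by (simp add: abs_mult)
    have "\<bar>d\<bar> \<le> K + \<bar>S\<bar>" using bounds(5)[of z] unfolding d_def by linarith
    then have 2: "\<bar>\<rho> z * d\<bar> \<le> K * (K + \<bar>S\<bar>)"
      unfolding abs_mult using bounds(1,2)[of z] K1 by (intro mult_mono) (auto simp: abs_of_pos)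
    have "\<bar>((cv + 1) * (\<rho> z - R) + \<rho> z * d) * e2\<bar> \<le>
     ((cv + 1) * (K + exp (- S) * (cv / (cv + 1) * W\<^sup>2) powr cv) + K * (K + \<bar>S\<bar>)) * (W / (cv + 1) * C0)"
      unfolding abs_mult[of _ e2] using 1 2 e2 by (intro mult_mono) auto
    then show ?thesis by linarith
  qed
  ultimately show ?thesis
    unfolding relative_bulk_identity[OF less_imp_neq[OF cv, symmetric], of "\<rho> z" "a z" "w' \<xi>" \<xi> "\<theta> z" "w \<xi>" h' d R h]
      e1_def[symmetric] e2_def[symmetric] C0_def[symmetric]
    by (simp add: algebra_simps)
qed

end

lemma C1_pair_const: "C1_pair (\<lambda>_. c) (\<lambda>_. 0)"
  by (simp add: C1_pair_def)

text \<open>With the division written as a factor \<open>1 / (t + \<epsilon>)\<close>, this factor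
  can be named and treated as an atom, after which the summation of the balances is a polynomial
  identity.\<close>

lemma test_bulk_eq:
  "test_bulk \<epsilon> q f \<psi> \<psi>' g g' (t, x1, x2) =
     q (t, x1, x2) * (- \<psi> x1 * (g' (x1 / (t + \<epsilon>)) * (x1 / (t + \<epsilon>))) * (1 / (t + \<epsilon>)))
     + f (t, x1, x2) * (\<psi>' x1 * g (x1 / (t + \<epsilon>)) + \<psi> x1 * g' (x1 / (t + \<epsilon>)) * (1 / (t + \<epsilon>)))"
  by (simp add: test_bulk_def)

text \<open>\<open>slab_divergence\<close> for the density \<open>p * \<psi>\<close> and the flux
  \<open>p * w * \<psi>\<close>, where \<open>p\<close> and \<open>w\<close> are evaluated at
  \<open>x / (t + \<epsilon>)\<close>; in the application \<open>p\<close> is the pressure of the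
  profile.\<close>

lemma similarity_divergence:
  assumes \<tau>: "\<tau> > 0" and L: "L \<ge> 0" and \<epsilon>: "\<epsilon> > 0"
    and \<psi>: "cutoff L \<psi> \<psi>'" "\<psi> L = 0" "\<psi> (-L) = 0"
    and p: "C1_pair p p'" and w: "C1_pair w w'"
  defines "D \<equiv> \<lambda>t x. - \<psi> x * (p' (x / (t + \<epsilon>)) * (x / (t + \<epsilon>))) * (1 / (t + \<epsilon>))
          + (\<psi>' x * (p (x / (t + \<epsilon>)) * w (x / (t + \<epsilon>)))
             + \<psi> x * (p' (x / (t + \<epsilon>)) * w (x / (t + \<epsilon>)) + p (x / (t + \<epsilon>)) * w' (x / (t + \<epsilon>))) * (1 / (t + \<epsilon>)))"
  shows "(LINT x:cell L|lborel. p (fst x / (\<tau> + \<epsilon>)) * \<psi> (fst x) - p (fst x / \<epsilon>) * \<psi> (fst x))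
       = (LINT z:slab \<tau> L|lborel. D (fst z) (fst (snd z)))"
    and "bounded_borel (slab \<tau> L) (\<lambda>z. D (fst z) (fst (snd z)))"
    and "bounded_borel (cell L) (\<lambda>x. p (fst x / (\<tau> + \<epsilon>)) * \<psi> (fst x) - p (fst x / \<epsilon>) * \<psi> (fst x))"
proof -
  have \<psi>1: "C1_pair \<psi> \<psi>'" using \<psi> unfolding cutoff_def by blast
  have c: "continuous_on A \<psi>" "continuous_on A \<psi>'" "continuous_on A p" "continuous_on A p'"
      "continuous_on A w" "continuous_on A w'" for A
    using C1_pair_continuous[OF \<psi>1] C1_pair_continuous[OF p] C1_pair_continuous[OF w] by auto
  note cc = c[of UNIV, THEN continuous_on_compose2]
  have [measurable]: "\<psi> \<in> borel_measurable borel" "\<psi>' \<in> borel_measurable borel"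
    "p \<in> borel_measurable borel" "p' \<in> borel_measurable borel"
    "w \<in> borel_measurable borel" "w' \<in> borel_measurable borel"
    using c by (auto intro: borel_measurable_continuous_onI)
  have d\<psi>: "(\<psi> has_real_derivative \<psi>' x) (at x)" and dp: "(p has_real_derivative p' x) (at x)"
    and dw: "(w has_real_derivative w' x) (at x)" for x
    using \<psi>1 p w unfolding C1_pair_def by auto
  define A B A' B' where "A = (\<lambda>t x. p (x / (t + \<epsilon>)) * \<psi> x)"
    and "B = (\<lambda>t x. \<psi> x * (p (x / (t + \<epsilon>)) * w (x / (t + \<epsilon>))))"
    and "A' = (\<lambda>t x. - \<psi> x * (p' (x / (t + \<epsilon>)) * (x / (t + \<epsilon>))) * (1 / (t + \<epsilon>)))"
    and "B' = (\<lambda>t x. \<psi>' x * (p (x / (t + \<epsilon>)) * w (x / (t + \<epsilon>)))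
             + \<psi> x * (p' (x / (t + \<epsilon>)) * w (x / (t + \<epsilon>)) + p (x / (t + \<epsilon>)) * w' (x / (t + \<epsilon>))) * (1 / (t + \<epsilon>)))"
  have D: "D t x = A' t x + B' t x" for t x by (simp add: D_def A'_def B'_def)
  have cA: "continuous_on ({0..\<tau>} \<times> UNIV) (\<lambda>(t, x). A' t x)"
    unfolding A'_def case_prod_unfold using \<epsilon> by (intro continuous_intros cc) auto
  have cB: "continuous_on ({0..\<tau>} \<times> UNIV) (\<lambda>(t, x). B' t x)"
    unfolding B'_def case_prod_unfold using \<epsilon> by (intro continuous_intros cc) auto
  have mA: "(\<lambda>p. A' (fst p) (snd p)) \<in> borel_measurable borel"
    unfolding A'_def by (simp flip: borel_prod) measurable
  have mB: "(\<lambda>p. B' (fst p) (snd p)) \<in> borel_measurable borel"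
    unfolding B'_def by (simp flip: borel_prod) measurable
  have cA0: "continuous_on UNIV (A t)" if "t \<in> {0..\<tau>}" for t
    unfolding A_def using that \<epsilon> by (intro continuous_intros cc) auto
  have eq: "(LINT x:cell L|lborel. A \<tau> (fst x) - A 0 (fst x))
       = (LINT z:slab \<tau> L|lborel. A' (fst z) (fst (snd z)) + B' (fst z) (fst (snd z)))"
  proof (rule slab_divergence[OF \<tau> L _ _ cA cB mA mB cA0])
    fix t x assume t: "t \<in> {0..\<tau>}"
    have q: "t + \<epsilon> > 0" using t \<epsilon> by auto
    have "((\<lambda>t. p (x / (t + \<epsilon>))) has_real_derivative p' (x / (t + \<epsilon>)) * (- x / ((t + \<epsilon>) * (t + \<epsilon>)))) (at t)"
      by (rule DERIV_chain2[OF dp]) (use q in \<open>auto intro!: derivative_eq_intros\<close>)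
    then have "((\<lambda>t. A t x) has_real_derivative p' (x / (t + \<epsilon>)) * (- x / ((t + \<epsilon>) * (t + \<epsilon>))) * \<psi> x) (at t)"
      unfolding A_def by (rule DERIV_cmult_right)
    then show "((\<lambda>t. A t x) has_real_derivative A' t x) (at t)"
      by (simp add: A'_def mult_ac)
    have d: "((\<lambda>x. x / (t + \<epsilon>)) has_real_derivative 1 / (t + \<epsilon>)) (at x)"
      using q by (auto intro!: derivative_eq_intros)
    show "((\<lambda>x. B t x) has_real_derivative B' t x) (at x)"
      unfolding B_def
      by (rule DERIV_cong[OF DERIV_mult'[OF d\<psi> DERIV_mult'[OF DERIV_chain2[OF dp d] DERIV_chain2[OF dw d]]]])
         (simp add: B'_def algebra_simps add_divide_distrib)
  qed (use \<psi> in \<open>auto simp: B_def\<close>)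
  then show "(LINT x:cell L|lborel. p (fst x / (\<tau> + \<epsilon>)) * \<psi> (fst x) - p (fst x / \<epsilon>) * \<psi> (fst x))
       = (LINT z:slab \<tau> L|lborel. D (fst z) (fst (snd z)))"
    by (simp add: D A_def)
  show "bounded_borel (slab \<tau> L) (\<lambda>z. D (fst z) (fst (snd z)))"
    unfolding D by (intro bounded_borel_intros slab_continuous cA cB mA mB)
  have "bounded_borel (cell L) (\<lambda>x. A \<tau> (fst x) - A 0 (fst x))"
    by (rule cell_continuous) (use \<tau> cA0 in \<open>auto intro!: continuous_intros\<close>)
  then show "bounded_borel (cell L) (\<lambda>x. p (fst x / (\<tau> + \<epsilon>)) * \<psi> (fst x) - p (fst x / \<epsilon>) * \<psi> (fst x))"
    by (simp add: A_def)
qed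

context euler_fields
begin

text \<open>Energy minus momentum plus mass minus entropy, each with its weight, plus the profile
  pressure. The jumps add up to the difference of relative energies; in the bulk the coefficient of
  \<open>\<psi>'\<close> is the relative flux, and that of \<open>\<psi> / (t + \<epsilon>)\<close>
  is bounded by \<open>relative_bulk_le\<close>, which is where the division by
  \<open>\<epsilon>\<close> in \<open>C\<close> comes from.\<close>

lemma relative_energy_step:
  assumes \<tau>: "\<tau> \<in> {0<..<T}"
    and mass: "balanced \<tau> \<rho> (\<lambda>z. \<rho> z * a z) r0"
    and momentum: "balanced \<tau> (\<lambda>z. \<rho> z * a z) (\<lambda>z. \<rho> z * (a z)\<^sup>2 + \<rho> z * \<theta> z) (\<lambda>x. r0 x * u0 x)"
    and energy: "balanced \<tau> (\<lambda>z. energy cv (\<rho> z) (\<theta> z) (a z, b z))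
          (\<lambda>z. (energy cv (\<rho> z) (\<theta> z) (a z, b z) + \<rho> z * \<theta> z) * a z) (\<lambda>x. energy cv (r0 x) (t0 x) (u0 x, 0))"
    and entropy: "overbalanced \<tau> (\<lambda>z. \<rho> z * (entropy cv (\<rho> z) (\<theta> z) - S))
          (\<lambda>z. \<rho> z * (entropy cv (\<rho> z) (\<theta> z) - S) * a z) (\<lambda>x. r0 x * (entropy cv (r0 x) (t0 x) - S))"
    and init: "bounded_borel UNIV r0" "bounded_borel UNIV t0" "bounded_borel UNIV u0"
      "bounded_borel UNIV (\<lambda>x. entropy cv (r0 x) (t0 x))"
    and smin: "AE z in lborel. fst z \<in> {0<..<T} \<and> snd z \<in> period_cell \<longrightarrow> S \<le> entropy cv (\<rho> z) (\<theta> z)"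
    and L: "L \<ge> 0" and \<psi>: "cutoff L \<psi> \<psi>'" "\<psi> L = 0" "\<psi> (-L) = 0" "\<And>x. 0 \<le> \<psi> x" "\<And>x. \<psi> x \<le> 1"
    and sp: "smooth_profile cv \<delta> v c w w' k k'" and \<delta>: "\<delta> > 0" and \<epsilon>: "\<epsilon> > 0"
    and W: "\<And>\<xi>. \<bar>w \<xi>\<bar> \<le> W" "\<And>\<xi>. 0 < k \<xi>" "\<And>\<xi>. k \<xi> \<le> W"
  defines "h \<equiv> \<lambda>\<xi>. cv / (cv + 1) * (k \<xi>)\<^sup>2"
    and "C \<equiv> (K * (K + W) + ((cv + 1) * (K + exp (- S) * (cv / (cv + 1) * W\<^sup>2) powr cv) + K * (K + \<bar>S\<bar>)) * (W / (cv + 1)))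
           * ((2 + 1 / (2 * cv)) * \<delta>) / \<epsilon>"
  shows "(LINT x:cell L|lborel. \<psi> (fst x) *
            (rel_energy cv S (\<rho> (\<tau>, x)) (\<theta> (\<tau>, x)) (a (\<tau>, x)) (b (\<tau>, x)) (w (fst x / (\<tau> + \<epsilon>))) (h (fst x / (\<tau> + \<epsilon>)))
             - rel_energy cv S (r0 (fst x)) (t0 (fst x)) (u0 (fst x)) 0 (w (fst x / \<epsilon>)) (h (fst x / \<epsilon>))))
       \<le> (LINT z:slab \<tau> L|lborel. \<psi>' (fst (snd z)) *
             rel_flux cv S (\<rho> z) (\<theta> z) (a z) (b z) (w (fst (snd z) / (fst z + \<epsilon>))) (h (fst (snd z) / (fst z + \<epsilon>))) + C)"
proof -
  have \<psi>1: "C1_pair \<psi> \<psi>'" using \<psi> unfolding cutoff_def by blast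
  have Cw: "C1_pair w w'" and Ck: "C1_pair k k'"
    using sp unfolding smooth_profile_def C1_pair_def by auto
  have dw: "(w has_real_derivative w' x) (at x)" and dk: "(k has_real_derivative k' x) (at x)" for x
    using Cw Ck unfolding C1_pair_def by auto
  define h' where "h' = (\<lambda>\<xi>. cv / (cv + 1) * (2 * k \<xi> * k' \<xi>))"
  have dh: "(h has_real_derivative h' x) (at x)" for x
    unfolding h_def h'_def by (rule DERIV_cong[OF DERIV_cmult[OF DERIV_power[OF dk, of 2]]]) simp
  have cont: "continuous_on A w" "continuous_on A w'" "continuous_on A k" "continuous_on A k'" for A
    using C1_pair_continuous[OF Cw] C1_pair_continuous[OF Ck] by auto
  have hpos: "h \<xi> > 0" for \<xi> using W(2)[of \<xi>] cv by (simp add: h_def)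
  have Ch: "C1_pair h h'"
    unfolding C1_pair_def
  proof
    show "\<forall>x. (h has_real_derivative h' x) (at x)" using dh by blast
    show "continuous_on UNIV h'"
      unfolding h'_def by (intro continuous_on_mult continuous_on_const cont)
  qed
  have conth: "continuous_on A h" "continuous_on A h'" for A using C1_pair_continuous[OF Ch] by auto
  define g g' where "g = (\<lambda>\<xi>. (w \<xi>)\<^sup>2 / 2 - (cv + 1) * h \<xi>)" and "g' = (\<lambda>\<xi>. w \<xi> * w' \<xi> - (cv + 1) * h' \<xi>)"
  have Cg: "C1_pair g g'"
    unfolding C1_pair_def
  proof
    have "(g has_real_derivative g' x) (at x)" for x
      unfolding g_def g'_def by (rule derivative_eq_intros dw dh | simp)+
    then show "\<forall>x. (g has_real_derivative g' x) (at x)" by blast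
    show "continuous_on UNIV g'" unfolding g'_def by (intro continuous_intros cont conth)
  qed
  define R where "R = (\<lambda>\<xi>. exp (- S) * h \<xi> powr cv)"
  define p p' where "p = (\<lambda>\<xi>. exp (- S) * h \<xi> powr (cv + 1))" and "p' = (\<lambda>\<xi>. (cv + 1) * R \<xi> * h' \<xi>)"
  have pR: "p \<xi> = R \<xi> * h \<xi>" for \<xi> using hpos[of \<xi>] by (simp add: p_def R_def powr_add)
  have Cp: "C1_pair p p'"
    unfolding C1_pair_def
  proof
    have "(p has_real_derivative p' x) (at x)" for x
      unfolding p_def p'_def R_def
      by (rule DERIV_cong[OF DERIV_cmult[OF DERIV_chain2[OF has_real_derivative_powr[OF hpos] dh]]]) simp
    then show "\<forall>x. (p has_real_derivative p' x) (at x)" by blast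
    show "continuous_on UNIV p'" unfolding p'_def R_def
      using hpos by (intro continuous_intros cont conth) (auto simp: less_imp_neq[symmetric])
  qed
  define j1 j2 j3 j4 where
      "j1 = test_jump \<tau> \<epsilon> (\<lambda>z. energy cv (\<rho> z) (\<theta> z) (a z, b z)) (\<lambda>x. energy cv (r0 x) (t0 x) (u0 x, 0)) \<psi> (\<lambda>_. 1)"
    and "j2 = test_jump \<tau> \<epsilon> (\<lambda>z. \<rho> z * a z) (\<lambda>x. r0 x * u0 x) \<psi> w"
    and "j3 = test_jump \<tau> \<epsilon> \<rho> r0 \<psi> g"
    and "j4 = test_jump \<tau> \<epsilon> (\<lambda>z. \<rho> z * (entropy cv (\<rho> z) (\<theta> z) - S)) (\<lambda>x. r0 x * (entropy cv (r0 x) (t0 x) - S)) \<psi> h"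
  define b1 b2 b3 b4 where
      "b1 = test_bulk \<epsilon> (\<lambda>z. energy cv (\<rho> z) (\<theta> z) (a z, b z))
          (\<lambda>z. (energy cv (\<rho> z) (\<theta> z) (a z, b z) + \<rho> z * \<theta> z) * a z) \<psi> \<psi>' (\<lambda>_. 1) (\<lambda>_. 0)"
    and "b2 = test_bulk \<epsilon> (\<lambda>z. \<rho> z * a z) (\<lambda>z. \<rho> z * (a z)\<^sup>2 + \<rho> z * \<theta> z) \<psi> \<psi>' w w'"
    and "b3 = test_bulk \<epsilon> \<rho> (\<lambda>z. \<rho> z * a z) \<psi> \<psi>' g g'"
    and "b4 = test_bulk \<epsilon> (\<lambda>z. \<rho> z * (entropy cv (\<rho> z) (\<theta> z) - S))
          (\<lambda>z. \<rho> z * (entropy cv (\<rho> z) (\<theta> z) - S) * a z) \<psi> \<psi>' h h'"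
  define jp where "jp = (\<lambda>x::real \<times> real. p (fst x / (\<tau> + \<epsilon>)) * \<psi> (fst x) - p (fst x / \<epsilon>) * \<psi> (fst x))"
  define D where "D = (\<lambda>t x. - \<psi> x * (p' (x / (t + \<epsilon>)) * (x / (t + \<epsilon>))) * (1 / (t + \<epsilon>))
          + (\<psi>' x * (p (x / (t + \<epsilon>)) * w (x / (t + \<epsilon>)))
             + \<psi> x * (p' (x / (t + \<epsilon>)) * w (x / (t + \<epsilon>)) + p (x / (t + \<epsilon>)) * w' (x / (t + \<epsilon>))) * (1 / (t + \<epsilon>))))"
  define bp where "bp = (\<lambda>z::real \<times> (real \<times> real). D (fst z) (fst (snd z)))"
  have "\<tau> > 0" using \<tau> by auto
  note div_rule = similarity_divergence[OF \<open>\<tau> > 0\<close> L \<epsilon> \<psi>(1-3) Cp Cw]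
  have div: "(LINT x:cell L|lborel. jp x) = (LINT z:slab \<tau> L|lborel. bp z)"
    "bounded_borel (slab \<tau> L) bp" "bounded_borel (cell L) jp"
    unfolding jp_def bp_def D_def by (rule div_rule)+
  have e1: "(LINT x:cell L|lborel. j1 x) = (LINT z:slab \<tau> L|lborel. b1 z)"
    unfolding j1_def b1_def using energy \<psi>(1) \<epsilon> C1_pair_const[of 1] unfolding balanced_def by blast
  have e2: "(LINT x:cell L|lborel. j2 x) = (LINT z:slab \<tau> L|lborel. b2 z)"
    unfolding j2_def b2_def using momentum \<psi>(1) \<epsilon> Cw unfolding balanced_def by blast
  have e3: "(LINT x:cell L|lborel. j3 x) = (LINT z:slab \<tau> L|lborel. b3 z)"
    unfolding j3_def b3_def using mass \<psi>(1) \<epsilon> Cg unfolding balanced_def by blast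
  \<comment> \<open>The entropy inequality admits only nonnegative weights, which holds for the
    temperature \<open>h\<close>. It enters the sum with a minus sign, which turns it into the
    required upper bound.\<close>
  have e4: "(LINT x:cell L|lborel. j4 x) \<ge> (LINT z:slab \<tau> L|lborel. b4 z)"
    unfolding j4_def b4_def using entropy \<psi>(1,4) \<epsilon> Ch hpos unfolding overbalanced_def
    by (meson less_imp_le)
  have bE0: "bounded_borel UNIV (\<lambda>x. energy cv (r0 x) (t0 x) (u0 x, 0))"
  proof -
    have "(\<lambda>x. energy cv (r0 x) (t0 x) (u0 x, 0)) = (\<lambda>x. 1 / 2 * r0 x * (u0 x)\<^sup>2 + cv * r0 x * t0 x)"
      by (simp add: energy_def norm_Pair)
    then show ?thesis by (simp only:) (intro bounded_borel_intros init)
  qed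
  have bs: "bounded_borel UNIV (\<lambda>z. \<rho> z * (entropy cv (\<rho> z) (\<theta> z) - S))"
    by (intro bounded_borel_intros fields_bounded)
  have ij: "bounded_borel (cell L) j1" "bounded_borel (cell L) j2" "bounded_borel (cell L) j3" "bounded_borel (cell L) j4"
    unfolding j1_def j2_def j3_def j4_def
    by (rule bounded_borel_test_jump[OF _ _ \<psi>(1)], intro bounded_borel_intros fields_bounded init bE0,
        intro bounded_borel_intros fields_bounded init bE0, rule C1_pair_const Cw Cg Ch)+
  have ib: "bounded_borel (slab \<tau> L) b1" "bounded_borel (slab \<tau> L) b2" "bounded_borel (slab \<tau> L) b3" "bounded_borel (slab \<tau> L) b4"
    unfolding b1_def b2_def b3_def b4_def
    by (rule bounded_borel_test_bulk[OF \<epsilon> _ _ \<psi>(1)], intro bounded_borel_intros fields_bounded init,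
        intro bounded_borel_intros fields_bounded init, rule C1_pair_const Cw Cg Ch)+
  note ij' = ij[THEN cell_integrable] div(3)[THEN cell_integrable]
  note ib' = ib[THEN slab_integrable] div(2)[THEN slab_integrable]
  have "(LINT x:cell L|lborel. j1 x - j2 x + j3 x - j4 x + jp x)
      = (LINT x:cell L|lborel. j1 x) - (LINT x:cell L|lborel. j2 x) + (LINT x:cell L|lborel. j3 x)
        - (LINT x:cell L|lborel. j4 x) + (LINT x:cell L|lborel. jp x)"
    using ij' by simp
  also have "\<dots> \<le> (LINT z:slab \<tau> L|lborel. b1 z) - (LINT z:slab \<tau> L|lborel. b2 z) + (LINT z:slab \<tau> L|lborel. b3 z)
        - (LINT z:slab \<tau> L|lborel. b4 z) + (LINT z:slab \<tau> L|lborel. bp z)"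
    using e1 e2 e3 e4 div(1) by linarith
  also have "\<dots> = (LINT z:slab \<tau> L|lborel. b1 z - b2 z + b3 z - b4 z + bp z)"
    using ib' by simp
  also have "\<dots> \<le> (LINT z:slab \<tau> L|lborel. \<psi>' (fst (snd z)) *
             rel_flux cv S (\<rho> z) (\<theta> z) (a z) (b z) (w (fst (snd z) / (fst z + \<epsilon>))) (h (fst (snd z) / (fst z + \<epsilon>))) + C)"
  proof (rule set_integral_mono_AE)
    show "set_integrable lborel (slab \<tau> L) (\<lambda>z. b1 z - b2 z + b3 z - b4 z + bp z)"
      using ib' by simp
    have slabc: "bounded_borel (slab \<tau> L) (\<lambda>z. f (fst (snd z) / (fst z + \<epsilon>)))" if "continuous_on UNIV f" for f
    proof (rule slab_continuous)
      show "continuous_on ({0..\<tau>} \<times> UNIV) (\<lambda>(t, x). f (x / (t + \<epsilon>)))"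
        unfolding case_prod_unfold using \<epsilon>
        by (intro continuous_intros continuous_on_compose2[OF that]) auto
      have [measurable]: "f \<in> borel_measurable borel" using that by (rule borel_measurable_continuous_onI)
      show "(\<lambda>p. f (snd p / (fst p + \<epsilon>))) \<in> borel_measurable borel"
        by (simp flip: borel_prod) measurable
    qed
    have s\<psi>: "bounded_borel (slab \<tau> L) (\<lambda>z. \<psi>' (fst (snd z)))"
    proof (rule slab_continuous)
      have c: "continuous_on UNIV \<psi>'" using \<psi>1 C1_pair_def by blast
      then show "continuous_on ({0..\<tau>} \<times> UNIV) (\<lambda>(t, x). \<psi>' x)"
        unfolding case_prod_unfold by (intro continuous_on_compose2[OF c] continuous_intros) auto
      show "(\<lambda>p::real \<times> real. \<psi>' (snd p)) \<in> borel_measurable borel"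
        by (intro borel_measurable_continuous_onI continuous_on_compose2[OF c] continuous_intros) auto
    qed
    have cp: "continuous_on UNIV (\<lambda>\<xi>. exp (- S) * h \<xi> powr (cv + 1))"
      using C1_pair_continuous[OF Cp] unfolding p_def by blast
    show "set_integrable lborel (slab \<tau> L) (\<lambda>z. \<psi>' (fst (snd z)) *
             rel_flux cv S (\<rho> z) (\<theta> z) (a z) (b z) (w (fst (snd z) / (fst z + \<epsilon>))) (h (fst (snd z) / (fst z + \<epsilon>))) + C)"
      unfolding rel_flux_def
      by (intro slab_integrable bounded_borel_add bounded_borel_mult bounded_borel_diff bounded_borel_power
          bounded_borel_const s\<psi> fields_bounded slabc[OF cont(1)] slabc[OF conth(1)] slabc[OF cp])
    show "AE z\<in>slab \<tau> L in lborel. b1 z - b2 z + b3 z - b4 z + bp z \<le> \<psi>' (fst (snd z)) *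
             rel_flux cv S (\<rho> z) (\<theta> z) (a z) (b z) (w (fst (snd z) / (fst z + \<epsilon>))) (h (fst (snd z) / (fst z + \<epsilon>))) + C"
      using smin
    proof eventually_elim
      case (elim z)
      show ?case
      proof
        assume z: "z \<in> slab \<tau> L"
        obtain t x1 x2 where zt: "z = (t, x1, x2)" by (cases z) auto
        have t: "0 < t" "t < \<tau>" using z unfolding zt slab_def by auto
        have s: "S \<le> entropy cv (\<rho> z) (\<theta> z)" using elim t \<tau> z by (simp add: zt slab_def cell_def period_cell_def)
        define i \<xi> where "i = 1 / (t + \<epsilon>)" and "\<xi> = x1 / (t + \<epsilon>)"
        have i: "0 \<le> i" "i \<le> 1 / \<epsilon>" using t \<epsilon> by (auto simp: i_def intro!: divide_left_mono)
        define G where "G = \<rho> z * a z * w' \<xi> * \<xi> - (\<rho> z * (a z)\<^sup>2 + \<rho> z * \<theta> z) * w' \<xi>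
           + \<rho> z * (a z - \<xi>) * (w \<xi> * w' \<xi> - (cv + 1) * h' \<xi>) - \<rho> z * (entropy cv (\<rho> z) (\<theta> z) - S) * (a z - \<xi>) * h' \<xi>
           + (cv + 1) * R \<xi> * h' \<xi> * (w \<xi> - \<xi>) + R \<xi> * h \<xi> * w' \<xi>"
        define H where "H = (K * (K + W) + ((cv + 1) * (K + exp (- S) * (cv / (cv + 1) * W\<^sup>2) powr cv) + K * (K + \<bar>S\<bar>)) * (W / (cv + 1)))
           * ((2 + 1 / (2 * cv)) * \<delta>)"
        have G: "G \<le> H"
          unfolding G_def H_def h_def h'_def R_def
          by (rule relative_bulk_le[OF sp \<delta> W(1) W(2) W(3) s])
        have W0: "W \<ge> 0" using W(2,3)[of 0] by linarith
        have H: "0 \<le> H" unfolding H_def using K1 W0 cv \<delta>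
          by (intro mult_nonneg_nonneg add_nonneg_nonneg divide_nonneg_nonneg) auto
        \<comment> \<open>Collecting terms: \<open>G\<close> is the total coefficient of
          \<open>\<psi> x1 * i\<close>, and the bracket after \<open>\<psi>' x1\<close> is the
          combination of fluxes.\<close>
        have "b1 z - b2 z + b3 z - b4 z + bp z = \<psi>' x1 *
            ((energy cv (\<rho> z) (\<theta> z) (a z, b z) + \<rho> z * \<theta> z) * a z - (\<rho> z * (a z)\<^sup>2 + \<rho> z * \<theta> z) * w \<xi>
              + \<rho> z * a z * ((w \<xi>)\<^sup>2 / 2 - (cv + 1) * h \<xi>)
              - \<rho> z * (entropy cv (\<rho> z) (\<theta> z) - S) * a z * h \<xi> + p \<xi> * w \<xi>) + \<psi> x1 * i * G"
          unfolding b1_def b2_def b3_def b4_def bp_def D_def G_def zt test_bulk_eq fst_conv snd_conv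
            i_def[symmetric] \<xi>_def[symmetric] p'_def g_def g'_def pR
          by (simp add: algebra_simps power2_eq_square)
        also have "\<dots> = \<psi>' x1 * rel_flux cv S (\<rho> z) (\<theta> z) (a z) (b z) (w \<xi>) (h \<xi>) + \<psi> x1 * i * G"
          using rel_flux_combination[of cv "\<rho> z" "\<theta> z" "a z" "b z" "w \<xi>" "h \<xi>" S] unfolding p_def by simp
        \<comment> \<open>\<open>G\<close> may be negative, so it is first replaced by the
          nonnegative bound \<open>H\<close>; only then can \<open>\<psi> x1\<close> and
          \<open>i\<close> be estimated from above.\<close>
        also have "\<psi> x1 * i * G \<le> C"
        proof -
          have "\<psi> x1 * i * G \<le> \<psi> x1 * i * H" using G \<psi>(4) i by (intro mult_left_mono) auto
          also have "\<dots> \<le> 1 * (1 / \<epsilon>) * H" using \<psi>(4,5) i H by (intro mult_right_mono mult_mono) auto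
          also have "\<dots> = C" unfolding C_def H_def by simp
          finally show ?thesis .
        qed
        finally show "b1 z - b2 z + b3 z - b4 z + bp z \<le> \<psi>' (fst (snd z)) *
             rel_flux cv S (\<rho> z) (\<theta> z) (a z) (b z) (w (fst (snd z) / (fst z + \<epsilon>))) (h (fst (snd z) / (fst z + \<epsilon>))) + C"
          by (simp add: zt \<xi>_def)
      qed
    qed
  qed
  also have "(LINT x:cell L|lborel. j1 x - j2 x + j3 x - j4 x + jp x) = (LINT x:cell L|lborel. \<psi> (fst x) *
            (rel_energy cv S (\<rho> (\<tau>, x)) (\<theta> (\<tau>, x)) (a (\<tau>, x)) (b (\<tau>, x)) (w (fst x / (\<tau> + \<epsilon>))) (h (fst x / (\<tau> + \<epsilon>)))
             - rel_energy cv S (r0 (fst x)) (t0 (fst x)) (u0 (fst x)) 0 (w (fst x / \<epsilon>)) (h (fst x / \<epsilon>))))"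
  proof (rule set_lebesgue_integral_cong, simp, intro allI impI)
    fix x :: "real \<times> real"
    obtain x1 x2 where x: "x = (x1, x2)" by (cases x)
    show "j1 x - j2 x + j3 x - j4 x + jp x = \<psi> (fst x) *
            (rel_energy cv S (\<rho> (\<tau>, x)) (\<theta> (\<tau>, x)) (a (\<tau>, x)) (b (\<tau>, x)) (w (fst x / (\<tau> + \<epsilon>))) (h (fst x / (\<tau> + \<epsilon>)))
             - rel_energy cv S (r0 (fst x)) (t0 (fst x)) (u0 (fst x)) 0 (w (fst x / \<epsilon>)) (h (fst x / \<epsilon>)))"
      unfolding rel_energy_combination[symmetric] j1_def j2_def j3_def j4_def jp_def test_jump_def x p_def g_def
      by (simp add: algebra_simps)
  qed
  finally show ?thesis .
qed

end

section \<open>Behaviour at infinity\<close>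

text \<open>Squared positive parts make the cut-off \<open>C1\<close> without mollification. It is 1
  up to \<open>L\<close> and 0 beyond \<open>L + 1\<close>, and its derivative is bounded
  independently of \<open>L\<close>.\<close>

definition bump :: "real \<Rightarrow> real \<Rightarrow> real" where
  "bump L x = (max 0 (1 - ((max 0 (x - L))\<^sup>2 + (max 0 (- x - L))\<^sup>2)))\<^sup>2"

definition bump' :: "real \<Rightarrow> real \<Rightarrow> real" where
  "bump' L x = 2 * max 0 (1 - ((max 0 (x - L))\<^sup>2 + (max 0 (- x - L))\<^sup>2)) * (2 * max 0 (- x - L) - 2 * max 0 (x - L))"

lemma bump_has_real_derivative: "(bump L has_real_derivative bump' L x) (at x)"
proof -
  have 1: "((\<lambda>x. (max 0 (x - L))\<^sup>2) has_real_derivative 2 * max 0 (x - L) * 1) (at x)"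
    by (rule DERIV_chain2[OF max_0_square_has_real_derivative]) (auto intro!: derivative_eq_intros)
  have 2: "((\<lambda>x. (max 0 (- x - L))\<^sup>2) has_real_derivative 2 * max 0 (- x - L) * (-1)) (at x)"
    by (rule DERIV_chain2[OF max_0_square_has_real_derivative]) (auto intro!: derivative_eq_intros)
  have "(bump L has_real_derivative 2 * max 0 (1 - ((max 0 (x - L))\<^sup>2 + (max 0 (- x - L))\<^sup>2))
     * (0 - (2 * max 0 (x - L) * 1 + 2 * max 0 (- x - L) * (-1)))) (at x)"
    unfolding bump_def
    by (rule DERIV_chain2[OF max_0_square_has_real_derivative], intro DERIV_diff DERIV_const DERIV_add 1 2)
  then show ?thesis by (simp add: bump'_def)
qed

lemma bump_facts:
  assumes L: "L \<ge> 0"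
  shows "cutoff (L + 1) (bump L) (bump' L)" "bump L (L + 1) = 0" "bump L (- (L + 1)) = 0"
    "0 \<le> bump L x" "bump L x \<le> 1" "\<bar>x\<bar> \<le> L \<Longrightarrow> bump L x = 1"
    "\<bar>x\<bar> < L \<or> \<bar>x\<bar> > L + 1 \<Longrightarrow> bump' L x = 0" "\<bar>bump' L x\<bar> \<le> 4"
proof -
  have out: "1 - ((max 0 (x - L))\<^sup>2 + (max 0 (- x - L))\<^sup>2) \<le> 0" if "\<bar>x\<bar> \<ge> L + 1" for x
  proof -
    have "1 \<le> (max 0 (x - L))\<^sup>2 \<or> 1 \<le> (max 0 (- x - L))\<^sup>2"
      using that L power_mono[of 1 "max 0 (x - L)" 2] power_mono[of 1 "max 0 (- x - L)" 2] by (auto simp: abs_if split: if_splits)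
    then show ?thesis using zero_le_power2[of "max 0 (x - L)"] zero_le_power2[of "max 0 (- x - L)"] by linarith
  qed
  have "continuous_on UNIV (bump' L)" unfolding bump'_def by (intro continuous_intros)
  then show "cutoff (L + 1) (bump L) (bump' L)"
    unfolding cutoff_def C1_pair_def using bump_has_real_derivative out
    by (auto simp: bump_def bump'_def max_absorb1)
  show "bump L (L + 1) = 0" "bump L (- (L + 1)) = 0" using L by (auto simp: bump_def)
  show "0 \<le> bump L x" by (simp add: bump_def)
  have m: "0 \<le> max 0 (1 - ((max 0 (x - L))\<^sup>2 + (max 0 (- x - L))\<^sup>2))"
      "max 0 (1 - ((max 0 (x - L))\<^sup>2 + (max 0 (- x - L))\<^sup>2)) \<le> 1"
    using zero_le_power2[of "max 0 (x - L)"] zero_le_power2[of "max 0 (- x - L)"] by linarith+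
  then show "bump L x \<le> 1" unfolding bump_def by (rule power_le_one)
  show "\<bar>x\<bar> \<le> L \<Longrightarrow> bump L x = 1" by (simp add: bump_def max_absorb1)
  show "\<bar>x\<bar> < L \<or> \<bar>x\<bar> > L + 1 \<Longrightarrow> bump' L x = 0"
    using out[of x] by (auto simp: bump'_def max_absorb1)
  show "\<bar>bump' L x\<bar> \<le> 4"
  proof (cases "\<bar>x\<bar> \<ge> L + 1")
    case True
    then show ?thesis using out[of x] by (simp add: bump'_def max_absorb1)
  next
    case False
    \<comment> \<open>Since \<open>L \<ge> 0\<close>, at most one of the two positive parts is
      nonzero, and it is below 1 here.\<close>
    then have "\<bar>2 * max 0 (- x - L) - 2 * max 0 (x - L)\<bar> \<le> 2" using L by (auto simp: max_def)
    then have "2 * max 0 (1 - ((max 0 (x - L))\<^sup>2 + (max 0 (- x - L))\<^sup>2)) * \<bar>2 * max 0 (- x - L) - 2 * max 0 (x - L)\<bar> \<le> 2 * 1 * 2"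
      using m by (intro mult_mono) auto
    then show ?thesis using m by (simp add: bump'_def abs_mult)
  qed
qed

section \<open>Slices at fixed \<open>x1\<close>\<close>

text \<open>The far field condition concerns integrals over \<open>t\<close> and \<open>x2\<close>
  at fixed \<open>x1\<close>, whereas \<open>x1\<close> is the middle coordinate of space-time;
  Tonelli is applied so as to bring it outermost.\<close>

lemma nn_integral_lborel_middle_first:
  fixes f :: "real \<times> (real \<times> real) \<Rightarrow> ennreal"
  assumes [measurable]: "f \<in> borel_measurable borel"
  shows "(\<integral>\<^sup>+z. f z \<partial>lborel) = (\<integral>\<^sup>+y. (\<integral>\<^sup>+p. f (fst p, (y, snd p)) \<partial>lborel) \<partial>lborel)"
proof -
  have m[measurable]: "f \<in> borel_measurable (borel \<Otimes>\<^sub>M (borel \<Otimes>\<^sub>M borel))"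
    using assms by (simp add: borel_prod)
  have "(\<integral>\<^sup>+z. f z \<partial>lborel) = (\<integral>\<^sup>+t. \<integral>\<^sup>+x. f (t, x) \<partial>lborel \<partial>lborel)"
    unfolding lborel_prod[symmetric, where 'a = real and 'b = "real \<times> real"]
    by (rule lborel.nn_integral_fst[symmetric]) (use assms in \<open>simp add: lborel_prod\<close>)
  also have "\<dots> = (\<integral>\<^sup>+t. \<integral>\<^sup>+y. \<integral>\<^sup>+y2. f (t, (y, y2)) \<partial>lborel \<partial>lborel \<partial>lborel)"
  proof (rule nn_integral_cong)
    fix t :: real
    have "(\<lambda>x. f (t, x)) \<in> borel_measurable (borel \<Otimes>\<^sub>M borel)" by measurable
    then show "(\<integral>\<^sup>+x. f (t, x) \<partial>lborel) = (\<integral>\<^sup>+y. \<integral>\<^sup>+y2. f (t, (y, y2)) \<partial>lborel \<partial>lborel)"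
      unfolding lborel_prod[symmetric, where 'a = real and 'b = "real"]
      by (intro lborel.nn_integral_fst[symmetric]) (simp add: borel_prod)
  qed
  also have "\<dots> = (\<integral>\<^sup>+y. \<integral>\<^sup>+t. \<integral>\<^sup>+y2. f (t, (y, y2)) \<partial>lborel \<partial>lborel \<partial>lborel)"
    by (rule lborel_pair.Fubini'[symmetric]) measurable
  also have "\<dots> = (\<integral>\<^sup>+y. (\<integral>\<^sup>+p. f (fst p, (y, snd p)) \<partial>lborel) \<partial>lborel)"
  proof (rule nn_integral_cong)
    fix y :: real
    have "(\<lambda>p. f (fst p, (y, snd p))) \<in> borel_measurable (borel \<Otimes>\<^sub>M borel)" by measurable
    then have "(\<integral>\<^sup>+t. \<integral>\<^sup>+y2. (\<lambda>p. f (fst p, (y, snd p))) (t, y2) \<partial>lborel \<partial>lborel) = (\<integral>\<^sup>+p. f (fst p, (y, snd p)) \<partial>lborel)"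
      unfolding lborel_prod[symmetric, where 'a = real and 'b = "real"]
      by (intro lborel.nn_integral_fst) (simp add: borel_prod)
    then show "(\<integral>\<^sup>+t. \<integral>\<^sup>+y2. f (t, (y, y2)) \<partial>lborel \<partial>lborel) = (\<integral>\<^sup>+p. f (fst p, (y, snd p)) \<partial>lborel)"
      by simp
  qed
  finally show ?thesis .
qed

lemma AE_lborel_middle_first:
  assumes "AE z in (lborel :: (real \<times> (real \<times> real)) measure). P z"
  shows "AE y in lborel. AE p in lborel. P (fst p, (y, snd p))"
proof -
  obtain N where N: "\<And>z. z \<in> space lborel - N \<Longrightarrow> P z" "N \<in> null_sets lborel" using assms by (rule AE_E3) blast
  then have [measurable]: "N \<in> sets borel" by auto
  have "(\<integral>\<^sup>+z. indicator N z \<partial>lborel) = 0" using N(2) by auto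
  then have z: "(\<integral>\<^sup>+y. (\<integral>\<^sup>+p. indicator N (fst p, (y, snd p)) \<partial>lborel) \<partial>lborel) = (0 :: ennreal)"
    by (subst (asm) nn_integral_lborel_middle_first) auto
  have Nm[measurable]: "N \<in> sets (borel \<Otimes>\<^sub>M (borel \<Otimes>\<^sub>M borel))"
    using \<open>N \<in> sets borel\<close> unfolding borel_prod .
  have m: "(\<lambda>y. \<integral>\<^sup>+p. indicator N (fst p, (y, snd p)) \<partial>(lborel \<Otimes>\<^sub>M lborel)) \<in> borel_measurable (borel :: real measure)"
    by measurable
  then have "AE y in lborel. (\<integral>\<^sup>+p. indicator N (fst p, (y, snd p)) \<partial>lborel) = (0 :: ennreal)"
    using z by (subst (asm) nn_integral_0_iff_AE) (auto simp: lborel_prod)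
  then show ?thesis
  proof eventually_elim
    case (elim y)
    have "(\<lambda>p. indicator N (fst p, (y, snd p)) :: ennreal) \<in> borel_measurable (borel \<Otimes>\<^sub>M borel)" by measurable
    then have "AE p in lborel. indicator N (fst p, (y, snd p)) = (0 :: ennreal)"
      using elim by (subst (asm) nn_integral_0_iff_AE) (auto simp: borel_prod)
    then show ?case by eventually_elim (use N(1) in \<open>auto simp: indicator_def split: if_splits\<close>)
  qed
qed

section \<open>Linear control by the deviation from a constant state\<close>

definition dominated :: "('a \<Rightarrow> real) \<Rightarrow> ('a \<Rightarrow> real) \<Rightarrow> bool" where
  "dominated D f \<longleftrightarrow> (\<exists>C\<ge>0. \<forall>z. \<bar>f z\<bar> \<le> C * D z)"

lemma dominatedI: "0 \<le> C \<Longrightarrow> (\<And>z. \<bar>f z\<bar> \<le> C * D z) \<Longrightarrow> dominated D f"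
  unfolding dominated_def by blast

lemma dominated_add: "dominated D f \<Longrightarrow> dominated D g \<Longrightarrow> dominated D (\<lambda>z. f z + g z)"
  unfolding dominated_def
proof (elim exE conjE)
  fix A B assume *: "0 \<le> A" "0 \<le> B" "\<forall>z. \<bar>f z\<bar> \<le> A * D z" "\<forall>z. \<bar>g z\<bar> \<le> B * D z"
  have "\<bar>f z + g z\<bar> \<le> (A + B) * D z" for z
    using *(3,4)[rule_format, of z] unfolding distrib_right by linarith
  then show "\<exists>C\<ge>0. \<forall>z. \<bar>f z + g z\<bar> \<le> C * D z" using * by (intro exI[of _ "A + B"]) auto
qed

lemma dominated_mult:
  assumes "bounded_borel UNIV g" "dominated D f" "\<And>z. 0 \<le> D z" shows "dominated D (\<lambda>z. g z * f z)"
proof -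
  obtain B A where *: "\<And>z. \<bar>g z\<bar> \<le> B" "\<And>z. \<bar>f z\<bar> \<le> A * D z" "A \<ge> 0"
    using assms(1,2) unfolding bounded_borel_def dominated_def by auto
  have B: "B \<ge> 0" using *(1)[of undefined] by linarith
  have "\<bar>g z * f z\<bar> \<le> B * (A * D z)" for z
    unfolding abs_mult using * B assms(3) by (intro mult_mono) auto
  then show ?thesis using B * by (intro dominatedI[of "B * A"]) (auto simp: mult.assoc)
qed

text \<open>The logarithm has slope at most \<open>2 / y\<close> to the right of
  \<open>y / 2\<close>.\<close>

lemma ln_diff_le_near:
  fixes x y :: real assumes "y > 0" "x \<ge> y / 2"
  shows "\<bar>ln x - ln y\<bar> \<le> 2 / y * \<bar>x - y\<bar>"
proof -
  have x: "x > 0" using assms by linarith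
  show ?thesis
  proof (cases "x \<ge> y")
    case True
    have "ln x - ln y \<le> (x - y) / y" using ln_diff_le[OF x assms(1)] .
    also have "\<dots> \<le> 2 / y * (x - y)" using True assms(1) by (simp add: divide_right_mono)
    finally show ?thesis using True assms(1) by simp
  next
    case False
    have "ln y - ln x \<le> (y - x) / x" using ln_diff_le[OF assms(1) x] .
    also have "\<dots> \<le> (y - x) / (y / 2)" using False assms x by (intro divide_left_mono) auto
    also have "\<dots> = 2 / y * (y - x)" by simp
    finally have "ln y - ln x \<le> 2 / y * (y - x)" .
    moreover have "ln x \<le> ln y" using False x by simp
    ultimately show ?thesis using False by simp
  qed
qed

context euler_fields
begin

definition deviation :: "real \<Rightarrow> real \<Rightarrow> real \<Rightarrow> real \<times> (real \<times> real) \<Rightarrow> real" where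
  "deviation r t U z = \<bar>\<rho> z - r\<bar> + \<bar>\<theta> z - t\<bar> + \<bar>a z - U\<bar> + \<bar>b z\<bar>"

lemma deviation_nonneg: "0 \<le> deviation r t U z"
  by (simp add: deviation_def)

lemma deviation_bounded: "bounded_borel A (deviation r t U)"
proof (rule bounded_borelI)
  show "deviation r t U \<in> borel_measurable borel" unfolding deviation_def[abs_def] by measurable
  fix z show "\<bar>deviation r t U z\<bar> \<le> K + \<bar>r\<bar> + (K + \<bar>t\<bar>) + (K + \<bar>U\<bar>) + K"
  proof -
    have "\<bar>\<rho> z - r\<bar> \<le> K + \<bar>r\<bar>" using bounds(1,2)[of z] by linarith
    moreover have "\<bar>\<theta> z - t\<bar> \<le> K + \<bar>t\<bar>" using bounds(3,4)[of z] by linarith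
    moreover have "\<bar>a z - U\<bar> \<le> K + \<bar>U\<bar>" using bounds(6)[of z] by linarith
    ultimately have "deviation r t U z \<le> K + \<bar>r\<bar> + (K + \<bar>t\<bar>) + (K + \<bar>U\<bar>) + K"
      unfolding deviation_def by (intro add_mono bounds)
    then show ?thesis using deviation_nonneg[of r t U z] by simp
  qed
qed

text \<open>The logarithms are not Lipschitz near vacuum or zero temperature, but the entropy itself
  is bounded. If density or temperature falls below half its far value, the deviation is bounded
  from below and the crude bound \<open>B\<close> suffices; otherwise the logarithms are
  Lipschitz.\<close>

lemma entropy_dominated:
  assumes r: "r > 0" and t: "t > 0"
  shows "dominated (deviation r t U) (\<lambda>z. entropy cv (\<rho> z) (\<theta> z) - entropy cv r t)"
proof -
  let ?S = "entropy cv r t"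
  define B where "B = K + \<bar>?S\<bar>"
  have B: "B \<ge> 0" using K1 by (simp add: B_def)
  have bd: "\<bar>entropy cv (\<rho> z) (\<theta> z) - ?S\<bar> \<le> B" for z using bounds(5)[of z] unfolding B_def by linarith
  \<comment> \<open>Large enough for the two crude cases, with factor \<open>B\<close>, and for the
    logarithms of temperature and density, with factors \<open>cv\<close> and 1.\<close>
  define C where "C = (B + cv + 1) * (2 / t + 2 / r)"
  have C_ge: "x * (2 / y) \<le> C" if "0 \<le> x" "x \<le> B + cv + 1" "y = t \<or> y = r" for x y
  proof -
    have "2 / y \<le> 2 / t + 2 / r" "0 \<le> 2 / y" using that(3) r t by auto
    then show ?thesis unfolding C_def using that(1,2) by (intro mult_mono) auto
  qed
  have C1: "B * (2 / t) \<le> C" "B * (2 / r) \<le> C" "cv * (2 / t) \<le> C" "1 * (2 / r) \<le> C"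
    by (rule C_ge; use B cv in simp)+
  have C0: "C \<ge> 0" unfolding C_def using cv r t B by (intro mult_nonneg_nonneg add_nonneg_nonneg) auto
  show ?thesis
  proof (rule dominatedI[OF C0])
    fix z
    have pos: "\<rho> z > 0" "\<theta> z > 0" using bounds by auto
    have dev: "\<bar>\<theta> z - t\<bar> + \<bar>\<rho> z - r\<bar> \<le> deviation r t U z" by (simp add: deviation_def)
    consider "\<rho> z < r / 2" | "\<theta> z < t / 2" | "\<rho> z \<ge> r / 2" "\<theta> z \<ge> t / 2" by linarith
    then have "\<bar>entropy cv (\<rho> z) (\<theta> z) - ?S\<bar> \<le> C * (\<bar>\<theta> z - t\<bar> + \<bar>\<rho> z - r\<bar>)"
    proof cases
      case 1
      have "B \<le> B * (2 / r) * \<bar>\<rho> z - r\<bar>"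
      proof -
        have "1 \<le> 2 / r * \<bar>\<rho> z - r\<bar>" using 1 r by (simp add: pos_le_divide_eq)
        from mult_left_mono[OF this B] show ?thesis by (simp add: mult.assoc)
      qed
      also have "\<dots> \<le> C * (\<bar>\<theta> z - t\<bar> + \<bar>\<rho> z - r\<bar>)"
        using C1 C0 B r by (intro mult_mono) auto
      finally show ?thesis using bd[of z] by linarith
    next
      case 2
      have "B \<le> B * (2 / t) * \<bar>\<theta> z - t\<bar>"
      proof -
        have "1 \<le> 2 / t * \<bar>\<theta> z - t\<bar>" using 2 t by (simp add: pos_le_divide_eq)
        from mult_left_mono[OF this B] show ?thesis by (simp add: mult.assoc)
      qed
      also have "\<dots> \<le> C * (\<bar>\<theta> z - t\<bar> + \<bar>\<rho> z - r\<bar>)"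
        using C1 C0 B t by (intro mult_mono) auto
      finally show ?thesis using bd[of z] by linarith
    next
      case 3
      have "entropy cv (\<rho> z) (\<theta> z) - ?S = cv * (ln (\<theta> z) - ln t) - (ln (\<rho> z) - ln r)"
        using pos r t by (simp add: entropy_def ln_div ln_powr algebra_simps)
      also have "\<bar>\<dots>\<bar> \<le> cv * \<bar>ln (\<theta> z) - ln t\<bar> + \<bar>ln (\<rho> z) - ln r\<bar>"
        using abs_triangle_ineq4[of "cv * (ln (\<theta> z) - ln t)"] cv by (simp add: abs_mult)
      also have "\<dots> \<le> cv * (2 / t * \<bar>\<theta> z - t\<bar>) + 2 / r * \<bar>\<rho> z - r\<bar>"
        using 3 r t cv by (intro add_mono mult_left_mono ln_diff_le_near) auto
      also have "\<dots> \<le> C * \<bar>\<theta> z - t\<bar> + C * \<bar>\<rho> z - r\<bar>"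
        using mult_right_mono[OF C1(3), of "\<bar>\<theta> z - t\<bar>"] mult_right_mono[OF C1(4), of "\<bar>\<rho> z - r\<bar>"]
        by (simp add: mult.assoc)
      finally show ?thesis by (simp add: algebra_simps)
    qed
    also have "\<dots> \<le> C * deviation r t U z" using dev C0 by (intro mult_left_mono) auto
    finally show "\<bar>entropy cv (\<rho> z) (\<theta> z) - ?S\<bar> \<le> C * deviation r t U z" .
  qed
qed

text \<open>The far state lies on the isentrope, so its pressure is \<open>r * t\<close>. The flux
  can then be written as a sum of bounded functions times differences from the far state, including
  the entropy difference.\<close>

lemma rel_flux_dominated:
  assumes r: "r > 0" and t: "t > 0" and S: "entropy cv r t = S"
  shows "dominated (deviation r t U) (\<lambda>z. rel_flux cv S (\<rho> z) (\<theta> z) (a z) (b z) U t)"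
proof -
  have "exp S = t powr cv / r" unfolding S[symmetric] entropy_def using r t by simp
  then have rt: "exp (- S) * t powr (cv + 1) = r * t"
    using r t by (simp add: exp_minus powr_add field_simps)
  note D = deviation_nonneg[of r t U]
  have basic: "dominated (deviation r t U) (\<lambda>z. \<rho> z - r)" "dominated (deviation r t U) (\<lambda>z. \<theta> z - t)"
    "dominated (deviation r t U) (\<lambda>z. a z - U)" "dominated (deviation r t U) b"
    using dominatedI[of 1 _ "deviation r t U"] by (simp_all add: deviation_def)
  have "(\<lambda>z. rel_flux cv S (\<rho> z) (\<theta> z) (a z) (b z) U t) = (\<lambda>z. (1 / 2 * \<rho> z * a z * (a z - U)) * (a z - U)
     + (1 / 2 * \<rho> z * a z * b z) * b z + ((cv + 1) * \<rho> z * a z - U * \<rho> z) * (\<theta> z - t)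
     + (- (U * t)) * (\<rho> z - r) + (- (\<rho> z * t * a z)) * (entropy cv (\<rho> z) (\<theta> z) - S))"
    unfolding rel_flux_def rt
  proof (rule ext)
    fix z
    have 1: "1 / 2 * \<rho> z * a z * ((a z - U)\<^sup>2 + (b z)\<^sup>2)
        = (1 / 2 * \<rho> z * a z * (a z - U)) * (a z - U) + (1 / 2 * \<rho> z * a z * b z) * b z"
      by (simp only: power2_eq_square distrib_left mult.assoc)
    have 2: "(cv + 1) * \<rho> z * a z * (\<theta> z - t) - U * (\<rho> z * \<theta> z - r * t) - \<rho> z * d * t * a z
       = ((cv + 1) * \<rho> z * a z - U * \<rho> z) * (\<theta> z - t) + (- (U * t)) * (\<rho> z - r) + (- (\<rho> z * t * a z)) * d" for d
      by (simp add: algebra_simps)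
    show "1 / 2 * \<rho> z * a z * ((a z - U)\<^sup>2 + (b z)\<^sup>2) + (cv + 1) * \<rho> z * a z * (\<theta> z - t)
       - U * (\<rho> z * \<theta> z - r * t) - \<rho> z * (entropy cv (\<rho> z) (\<theta> z) - S) * t * a z
       = (1 / 2 * \<rho> z * a z * (a z - U)) * (a z - U)
     + (1 / 2 * \<rho> z * a z * b z) * b z + ((cv + 1) * \<rho> z * a z - U * \<rho> z) * (\<theta> z - t)
     + (- (U * t)) * (\<rho> z - r) + (- (\<rho> z * t * a z)) * (entropy cv (\<rho> z) (\<theta> z) - S)"
      using 1 2[of "entropy cv (\<rho> z) (\<theta> z) - S"] by linarith
  qed
  then show ?thesis
    by (simp only:) (intro dominated_add dominated_mult[OF _ _ D] basic bounded_borel_intros fields_bounded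
        entropy_dominated[OF r t, of U, unfolded S])
qed

end

section \<open>Far field and boundary terms in unit strips\<close>

definition strip :: "real \<Rightarrow> real \<Rightarrow> (real \<times> (real \<times> real)) set" where
  "strip T l = {0<..<T} \<times> ({l..l+1} \<times> {0..1})"

lemma strip_borel[measurable, simp]: "strip T l \<in> sets borel" and strip_bounded[simp]: "bounded (strip T l)"
  unfolding strip_def
  by (auto intro!: borel_closed closed_Times bounded_Times simp flip: borel_prod)

lemma AE_lborel_fst_neq: "AE p in (lborel :: (real \<times> real) measure). fst p \<noteq> c"
proof -
  have "negligible {x :: real \<times> real. x \<bullet> (1, 0) = c}"
    by (rule negligible_standard_hyperplane) (simp add: Basis_prod_def)
  then have "AE p in (lebesgue :: (real \<times> real) measure). p \<notin> {x. x \<bullet> (1, 0) = c}"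
    unfolding negligible_iff_null_sets by (rule AE_not_in)
  then show ?thesis
    unfolding AE_completion_iff by (auto elim!: eventually_mono simp: inner_prod_def)
qed

text \<open>A bound for almost every slice passes unchanged to the strip, since the strip has width
  1 in \<open>x1\<close>.\<close>

lemma set_integral_strip_le:
  assumes f: "bounded_borel UNIV f" and nn: "\<And>z. 0 \<le> f z" and e: "0 \<le> e"
    and le: "AE y in lborel. y \<in> {l..l+1} \<longrightarrow> (LINT p:{0<..<T} \<times> {0..1}|lborel. f (fst p, (y, snd p))) \<le> e"
  shows "(LINT z:strip T l|lborel. f z) \<le> e"
proof -
  have [measurable]: "f \<in> borel_measurable borel" using f unfolding bounded_borel_def by blast
  have int: "set_integrable lborel (strip T l) f"
    by (intro bounded_borel_set_integrable bounded_borel_subset[OF f]) auto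
  have rect: "{0<..<T} \<times> {0..1::real} \<in> sets borel" by (simp flip: borel_prod)
  have sl: "bounded_borel A (\<lambda>p. f (fst p, (y, snd p)))" for A y
  proof -
    have "(\<lambda>p::real \<times> real. (fst p, (y, snd p))) \<in> borel_measurable borel"
      by (intro borel_measurable_continuous_onI continuous_intros)
    from measurable_compose[OF this] show ?thesis
      using f unfolding bounded_borel_def by (metis UNIV_I)
  qed
  have sint: "set_integrable lborel ({0<..<T} \<times> {0..1}) (\<lambda>p. f (fst p, (y, snd p)))" for y
    by (intro bounded_borel_set_integrable sl rect bounded_Times) auto
  have "ennreal (LINT z:strip T l|lborel. f z) = (\<integral>\<^sup>+z. ennreal (indicator (strip T l) z *\<^sub>R f z) \<partial>lborel)"
    unfolding set_lebesgue_integral_def using int nn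
    by (intro nn_integral_eq_integral[symmetric]) (auto simp: set_integrable_def)
  also have "\<dots> = (\<integral>\<^sup>+y. (\<integral>\<^sup>+p. ennreal (indicator (strip T l) (fst p, (y, snd p)) *\<^sub>R f (fst p, (y, snd p))) \<partial>lborel) \<partial>lborel)"
    by (rule nn_integral_lborel_middle_first) simp
  also have "\<dots> \<le> (\<integral>\<^sup>+y. ennreal e * indicator {l..l+1} y \<partial>lborel)"
  proof (rule nn_integral_mono_AE)
    show "AE y in lborel. (\<integral>\<^sup>+p. ennreal (indicator (strip T l) (fst p, (y, snd p)) *\<^sub>R f (fst p, (y, snd p))) \<partial>lborel)
        \<le> ennreal e * indicator {l..l+1} y"
      using le
    proof eventually_elim
      case (elim y)
      show ?case
      proof (cases "y \<in> {l..l+1}")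
        case True
        have "(\<integral>\<^sup>+p. ennreal (indicator (strip T l) (fst p, (y, snd p)) *\<^sub>R f (fst p, (y, snd p))) \<partial>lborel)
            = (\<integral>\<^sup>+p. ennreal (indicator ({0<..<T} \<times> {0..1}) p *\<^sub>R f (fst p, (y, snd p))) \<partial>lborel)"
          using True by (intro nn_integral_cong) (auto simp: strip_def indicator_def)
        also have "\<dots> = ennreal (LINT p:{0<..<T} \<times> {0..1}|lborel. f (fst p, (y, snd p)))"
          unfolding set_lebesgue_integral_def using sint[of y] nn
          by (intro nn_integral_eq_integral) (auto simp: set_integrable_def)
        also have "\<dots> \<le> ennreal e" using elim True by (intro ennreal_leI) auto
        finally show ?thesis using True by simp
      qed (auto simp: strip_def indicator_def)
    qed
  qed
  also have "\<dots> = ennreal e" by (subst nn_integral_cmult_indicator) auto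
  finally show ?thesis using e by simp
qed

text \<open>For \<open>L \<ge> n\<close> the cut-off is 1 on \<open>cell n\<close> and
  \<open>F\<close> is nonnegative, so the integral over \<open>cell n\<close> is at most
  \<open>\<phi> L\<close> and hence at most the limit 0. Countably many cells cover the period
  cell.\<close>

lemma AE_zero_of_bump_integrals:
  assumes F: "\<And>L. bounded_borel (cell L) F" and nn: "\<And>x. 0 \<le> F x"
    and le: "\<forall>\<^sub>F L in at_top. (LINT x:cell (L + 1)|lborel. bump L (fst x) * F x) \<le> \<phi> L"
    and lim: "(\<phi> \<longlongrightarrow> 0) at_top"
  shows "AE x in lborel. x \<in> period_cell \<longrightarrow> F x = 0"
proof -
  have bumpb: "bounded_borel (cell L) (\<lambda>x. bump L' (fst x))" for L L'
    by (rule cell_continuous) (auto simp: bump_def[abs_def] intro!: continuous_intros)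
  have "AE x in lborel. x \<in> cell (real n) \<longrightarrow> F x = 0" for n :: nat
  proof -
    have int: "integrable lborel (\<lambda>x. indicator (cell (real n)) x *\<^sub>R F x)"
      using cell_integrable[OF F] unfolding set_integrable_def .
    have "\<forall>\<^sub>F L in at_top. (LINT x:cell n|lborel. F x) \<le> \<phi> L"
      using le eventually_ge_at_top[of "real n"]
    proof eventually_elim
      case (elim L)
      have L: "L \<ge> 0" using elim(2) by linarith
      have "(LINT x:cell n|lborel. F x) \<le> (LINT x:cell (L + 1)|lborel. bump L (fst x) * F x)"
        unfolding set_lebesgue_integral_def
      proof (rule integral_mono[OF int])
        show "integrable lborel (\<lambda>x. indicator (cell (L + 1)) x *\<^sub>R (bump L (fst x) * F x))"
          using cell_integrable[OF bounded_borel_mult[OF bumpb F]] unfolding set_integrable_def .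
        fix x :: "real \<times> real"
        show "indicator (cell n) x *\<^sub>R F x \<le> indicator (cell (L + 1)) x *\<^sub>R (bump L (fst x) * F x)"
        proof (cases "x \<in> cell n")
          case True
          then have "x \<in> cell (L + 1)" "\<bar>fst x\<bar> \<le> L" using elim(2) by (auto simp: cell_def)
          then show ?thesis using True bump_facts(6)[OF L] by simp
        next
          case False
          have "0 \<le> bump L (fst x)" by (rule bump_facts(4)[OF L])
          then show ?thesis using False nn[of x] by (simp add: indicator_def)
        qed
      qed
      then show ?case using elim(1) by linarith
    qed
    then have "(LINT x:cell n|lborel. F x) \<le> 0"
      using lim by (intro tendsto_lowerbound[of \<phi> 0 at_top]) auto
    moreover have "(LINT x:cell n|lborel. F x) \<ge> 0"
      unfolding set_lebesgue_integral_def using nn by (intro integral_nonneg_AE) auto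
    ultimately have "(LINT x|lborel. indicator (cell n) x *\<^sub>R F x) = 0"
      unfolding set_lebesgue_integral_def by linarith
    then have "AE x in lborel. indicator (cell n) x *\<^sub>R F x = 0"
      by (subst (asm) integral_nonneg_eq_0_iff_AE[OF int]) (use nn in auto)
    then show ?thesis by eventually_elim (auto simp: indicator_def split: if_splits)
  qed
  then have "AE x in lborel. \<forall>n::nat. x \<in> cell (real n) \<longrightarrow> F x = 0"
    unfolding AE_all_countable by blast
  then show ?thesis
  proof eventually_elim
    case (elim x)
    show ?case
    proof
      assume "x \<in> period_cell"
      obtain n :: nat where "\<bar>fst x\<bar> \<le> real n" using real_arch_simple by blast
      then have "x \<in> cell (real n)" using \<open>x \<in> period_cell\<close> by (auto simp: cell_def period_cell_def abs_le_iff)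
      then show "F x = 0" using elim by blast
    qed
  qed
qed

context euler_fields
begin

definition far_slice where
  "far_slice r t U rho theta u x1 = (LINT p:({0..T} \<times> {0..1})|lebesgue.
          (let t' = fst p; x = (x1, snd p) in
             \<bar>rho t' x - r\<bar> + \<bar>theta t' x - t\<bar> + \<bar>fst (u t' x) - U\<bar> + \<bar>snd (u t' x)\<bar>))"

text \<open>Only for almost every \<open>x1\<close> do the fields agree with their representatives
  on the slice; this is enough because the slices are integrated over strips afterwards.\<close>

lemma far_slice_AE:
  assumes rep: "represents rho theta u"
  shows "AE y in lborel. far_slice r t U rho theta u y = (LINT p:{0<..<T} \<times> {0..1}|lborel. deviation r t U (fst p, (y, snd p)))"
  using AE_lborel_middle_first[OF rep[unfolded represents_def]]
proof eventually_elim
  case (elim y)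
  have m: "(\<lambda>p::real \<times> real. (fst p, (y, snd p))) \<in> borel_measurable borel"
    by (intro borel_measurable_continuous_onI continuous_intros)
  show ?case
    unfolding far_slice_def
  proof (rule set_integral_lebesgue_AE_eq)
    show "{0..T} \<times> {0..1::real} \<in> sets borel" "{0<..<T} \<times> {0..1::real} \<in> sets borel"
      by (simp_all flip: borel_prod)
    show "(\<lambda>p. deviation r t U (fst p, (y, snd p))) \<in> borel_measurable borel"
      using measurable_compose[OF m] deviation_bounded[of UNIV r t U] unfolding bounded_borel_def by blast
    show "AE p in lborel. indicator ({0..T} \<times> {0..1}) p * (let t' = fst p; x = (y, snd p) in
             \<bar>rho t' x - r\<bar> + \<bar>theta t' x - t\<bar> + \<bar>fst (u t' x) - U\<bar> + \<bar>snd (u t' x)\<bar>) =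
           indicator ({0<..<T} \<times> {0..1}) p * deviation r t U (fst p, (y, snd p))"
      using elim AE_lborel_fst_neq[of 0] AE_lborel_fst_neq[of T]
      by eventually_elim (auto simp: indicator_def deviation_def Let_def)
  qed
qed

lemma far_field_strip:
  assumes rep: "represents rho theta u" and e: "e > 0"
    and X: "\<And>y. y \<in> {l..l+1} \<Longrightarrow> \<bar>far_slice r t U rho theta u y\<bar> \<le> e"
  shows "\<bar>LINT z:strip T l|lborel. deviation r t U z\<bar> \<le> e"
proof -
  have "(LINT z:strip T l|lborel. deviation r t U z) \<le> e"
  proof (rule set_integral_strip_le[OF deviation_bounded deviation_nonneg])
    show "AE y in lborel. y \<in> {l..l+1} \<longrightarrow> (LINT p:{0<..<T} \<times> {0..1}|lborel. deviation r t U (fst p, (y, snd p))) \<le> e"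
      using far_slice_AE[OF rep, of r t U] by eventually_elim (use X in \<open>metis abs_le_D1\<close>)
  qed (use e in simp)
  moreover have "0 \<le> (LINT z:strip T l|lborel. deviation r t U z)"
    unfolding set_lebesgue_integral_def using deviation_nonneg by (intro integral_nonneg_AE) auto
  ultimately show ?thesis by simp
qed

text \<open>The limit holds for slices and is uniform over a strip far enough out. The left strip
  starts at \<open>- L - 1\<close>, so that it ends at \<open>- L\<close> and mirrors the right
  one.\<close>

lemma far_field_strip_tendsto:
  assumes rep: "represents rho theta u"
  shows "far_field T at_top r t U rho theta u \<Longrightarrow> ((\<lambda>L. LINT z:strip T L|lborel. deviation r t U z) \<longlongrightarrow> 0) at_top"
    and "far_field T at_bot r t U rho theta u \<Longrightarrow> ((\<lambda>L. LINT z:strip T (- L - 1)|lborel. deviation r t U z) \<longlongrightarrow> 0) at_top"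
proof -
  assume "far_field T at_top r t U rho theta u"
  then have lim: "(far_slice r t U rho theta u \<longlongrightarrow> 0) at_top"
    unfolding far_field_def far_slice_def[abs_def] .
  show "((\<lambda>L. LINT z:strip T L|lborel. deviation r t U z) \<longlongrightarrow> 0) at_top"
  proof (rule tendstoI)
    fix e :: real assume e: "e > 0"
    obtain X where X: "\<And>y. y \<ge> X \<Longrightarrow> \<bar>far_slice r t U rho theta u y\<bar> < e / 2"
      using tendstoD[OF lim, of "e / 2"] e by (auto simp: eventually_at_top_linorder dist_real_def)
    show "\<forall>\<^sub>F L in at_top. dist (LINT z:strip T L|lborel. deviation r t U z) 0 < e"
      using eventually_ge_at_top[of X]
    proof eventually_elim
      case (elim L)
      have "\<bar>LINT z:strip T L|lborel. deviation r t U z\<bar> \<le> e / 2"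
        by (rule far_field_strip[OF rep]) (use X elim e in \<open>auto intro!: less_imp_le\<close>)
      then show ?case using e by simp
    qed
  qed
next
  assume "far_field T at_bot r t U rho theta u"
  then have lim: "(far_slice r t U rho theta u \<longlongrightarrow> 0) at_bot"
    unfolding far_field_def far_slice_def[abs_def] .
  show "((\<lambda>L. LINT z:strip T (- L - 1)|lborel. deviation r t U z) \<longlongrightarrow> 0) at_top"
  proof (rule tendstoI)
    fix e :: real assume e: "e > 0"
    obtain X where X: "\<And>y. y \<le> X \<Longrightarrow> \<bar>far_slice r t U rho theta u y\<bar> < e / 2"
      using tendstoD[OF lim, of "e / 2"] e by (auto simp: eventually_at_bot_linorder dist_real_def)
    show "\<forall>\<^sub>F L in at_top. dist (LINT z:strip T (- L - 1)|lborel. deviation r t U z) 0 < e"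
      using eventually_ge_at_top[of "- X"]
    proof eventually_elim
      case (elim L)
      have "\<bar>LINT z:strip T (- L - 1)|lborel. deviation r t U z\<bar> \<le> e / 2"
        by (rule far_field_strip[OF rep]) (use X elim e in \<open>auto intro!: less_imp_le\<close>)
      then show ?case using e by simp
    qed
  qed
qed

text \<open>Made for integrands that carry the derivative of the cut-off: they vanish for
  \<open>\<bar>x1\<bar> < L\<close>, and on either side they are compared with the far state of that
  side.\<close>

lemma slab_boundary_le:
  assumes \<tau>: "\<tau> \<le> T" and f: "bounded_borel (slab \<tau> (L + 1)) f" and C: "C \<ge> 0"
    and right: "\<And>z. z \<in> slab \<tau> (L + 1) \<Longrightarrow> fst (snd z) \<ge> L \<Longrightarrow> f z \<le> C * deviation r1 t1 U1 z"
    and left: "\<And>z. z \<in> slab \<tau> (L + 1) \<Longrightarrow> fst (snd z) \<le> - L \<Longrightarrow> f z \<le> C * deviation r0 t0 U0 z"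
    and mid: "\<And>z. z \<in> slab \<tau> (L + 1) \<Longrightarrow> \<bar>fst (snd z)\<bar> < L \<Longrightarrow> f z \<le> 0"
  shows "(LINT z:slab \<tau> (L + 1)|lborel. f z)
     \<le> C * ((LINT z:strip T L|lborel. deviation r1 t1 U1 z) + (LINT z:strip T (- L - 1)|lborel. deviation r0 t0 U0 z))"
proof -
  have i: "integrable lborel (\<lambda>z. indicator (strip T l) z *\<^sub>R deviation r t U z)" for l r t U
    using bounded_borel_set_integrable[OF deviation_bounded strip_borel strip_bounded] unfolding set_integrable_def by blast
  have "(LINT z:slab \<tau> (L + 1)|lborel. f z) \<le>
     (LINT z|lborel. C * (indicator (strip T L) z *\<^sub>R deviation r1 t1 U1 z + indicator (strip T (- L - 1)) z *\<^sub>R deviation r0 t0 U0 z))"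
    unfolding set_lebesgue_integral_def
  proof (rule integral_mono)
    show "integrable lborel (\<lambda>z. indicator (slab \<tau> (L + 1)) z *\<^sub>R f z)"
      using slab_integrable[OF f] unfolding set_integrable_def .
    show "integrable lborel (\<lambda>z. C * (indicator (strip T L) z *\<^sub>R deviation r1 t1 U1 z
        + indicator (strip T (- L - 1)) z *\<^sub>R deviation r0 t0 U0 z))"
      by (intro integrable_mult_right Bochner_Integration.integrable_add i)
    fix z :: "real \<times> (real \<times> real)"
    have nn: "0 \<le> C * (indicator (strip T L) z *\<^sub>R deviation r1 t1 U1 z)"
      "0 \<le> C * (indicator (strip T (- L - 1)) z *\<^sub>R deviation r0 t0 U0 z)"
      using C deviation_nonneg by auto
    show "indicator (slab \<tau> (L + 1)) z *\<^sub>R f z \<le> C * (indicator (strip T L) z *\<^sub>R deviation r1 t1 U1 z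
        + indicator (strip T (- L - 1)) z *\<^sub>R deviation r0 t0 U0 z)"
    proof (cases "z \<in> slab \<tau> (L + 1)")
      case True
      consider "fst (snd z) \<ge> L" | "fst (snd z) \<le> - L" | "\<bar>fst (snd z)\<bar> < L" by linarith
      then show ?thesis
      proof cases
        case 1
        then have "z \<in> strip T L" using True \<tau> by (auto simp: slab_def cell_def strip_def)
        then show ?thesis using right[OF True 1] nn True by (simp add: distrib_left)
      next
        case 2
        then have "z \<in> strip T (- L - 1)" using True \<tau> by (auto simp: slab_def cell_def strip_def)
        then show ?thesis using left[OF True 2] nn True by (simp add: distrib_left)
      next
        case 3
        then show ?thesis using mid[OF True 3] nn True unfolding distrib_left by simp
      qed
    next
      case False
      then show ?thesis using nn unfolding distrib_left by simp
    qed
  qed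
  also have "\<dots> = C * ((LINT z:strip T L|lborel. deviation r1 t1 U1 z) + (LINT z:strip T (- L - 1)|lborel. deviation r0 t0 U0 z))"
    unfolding set_lebesgue_integral_def using i by simp
  finally show ?thesis .
qed

text \<open>The renormalised entropy inequality with
  \<open>b(s) = - (max 0 (S - s))\<^sup>2\<close>, which is \<open>C1\<close>, nondecreasing and 0
  on the Riemann data, whose entropy is \<open>S\<close>. With a cut-off in space as the only test
  function, the deficit of entropy at time \<open>\<tau>\<close> is bounded by a boundary flux,
  which tends to 0 because the deficit is controlled by the deviation from the far states.\<close>

lemma minimum_entropy:
  assumes \<tau>: "\<tau> \<in> {0<..<T}"
    and over: "overbalanced \<tau> (\<lambda>z. \<rho> z * - (max 0 (S - entropy cv (\<rho> z) (\<theta> z)))\<^sup>2)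
        (\<lambda>z. \<rho> z * - (max 0 (S - entropy cv (\<rho> z) (\<theta> z)))\<^sup>2 * a z) (\<lambda>x. 0)"
    and data: "r0 > 0" "t0 > 0" "entropy cv r0 t0 = S" "r1 > 0" "t1 > 0" "entropy cv r1 t1 = S"
    and lim1: "((\<lambda>L. LINT z:strip T L|lborel. deviation r1 t1 U1 z) \<longlongrightarrow> 0) at_top"
    and lim0: "((\<lambda>L. LINT z:strip T (- L - 1)|lborel. deviation r0 t0 U0 z) \<longlongrightarrow> 0) at_top"
  shows "AE x in lborel. x \<in> period_cell \<longrightarrow> S \<le> entropy cv (\<rho> (\<tau>, x)) (\<theta> (\<tau>, x))"
proof -
  define m where "m = (\<lambda>z. max 0 (S - entropy cv (\<rho> z) (\<theta> z)))"
  have mb: "bounded_borel A m" for A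
  proof (rule bounded_borelI)
    show "m \<in> borel_measurable borel" unfolding m_def by measurable
    show "\<bar>m z\<bar> \<le> K + \<bar>S\<bar>" for z using bounds(5)[of z] unfolding m_def by linarith
  qed
  define F where "F = (\<lambda>z. \<rho> z * - (m z)\<^sup>2)"
  have Fb: "bounded_borel A F" "bounded_borel A (\<lambda>z. F z * a z)" for A
    unfolding F_def by (intro bounded_borel_intros fields_bounded mb)+
  have over': "overbalanced \<tau> F (\<lambda>z. F z * a z) (\<lambda>x. 0)"
    using over unfolding F_def m_def .
  have dom: "dominated (deviation r t U) (\<lambda>z. F z * a z)" if rt: "r > 0" "t > 0" "entropy cv r t = S" for r t U
  proof -
    have "dominated (deviation r t U) m"
    proof -
      obtain C where C: "C \<ge> 0" "\<And>z. \<bar>entropy cv (\<rho> z) (\<theta> z) - S\<bar> \<le> C * deviation r t U z"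
        using entropy_dominated[OF rt(1,2), of U] unfolding rt(3) dominated_def by blast
      show ?thesis
      proof (rule dominatedI[OF C(1)])
        fix z
        have "\<bar>m z\<bar> \<le> \<bar>entropy cv (\<rho> z) (\<theta> z) - S\<bar>" unfolding m_def by linarith
        with C(2)[of z] show "\<bar>m z\<bar> \<le> C * deviation r t U z" by (rule order_trans[rotated])
      qed
    qed
    then have "dominated (deviation r t U) (\<lambda>z. (\<rho> z * - m z * a z) * m z)"
      by (intro dominated_mult deviation_nonneg bounded_borel_intros fields_bounded mb)
    moreover have "(\<rho> z * - m z * a z) * m z = F z * a z" for z
      by (simp add: F_def power2_eq_square)
    ultimately show ?thesis by simp
  qed
  obtain C1 where C1: "C1 \<ge> 0" "\<And>z. \<bar>F z * a z\<bar> \<le> C1 * deviation r1 t1 U1 z"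
    using dom[OF data(4-6), of U1] unfolding dominated_def by blast
  obtain C0 where C0: "C0 \<ge> 0" "\<And>z. \<bar>F z * a z\<bar> \<le> C0 * deviation r0 t0 U0 z"
    using dom[OF data(1-3), of U0] unfolding dominated_def by blast
  define C where "C = 4 * max C0 C1"
  have C: "C \<ge> 0" using C0 by (simp add: C_def)
  have Cle: "4 * \<bar>F z * a z\<bar> \<le> C * deviation r1 t1 U1 z" "4 * \<bar>F z * a z\<bar> \<le> C * deviation r0 t0 U0 z" for z
  proof -
    have "C1 * deviation r1 t1 U1 z \<le> max C0 C1 * deviation r1 t1 U1 z"
      "C0 * deviation r0 t0 U0 z \<le> max C0 C1 * deviation r0 t0 U0 z"
      by (intro mult_right_mono deviation_nonneg; simp)+
    then show "4 * \<bar>F z * a z\<bar> \<le> C * deviation r1 t1 U1 z" "4 * \<bar>F z * a z\<bar> \<le> C * deviation r0 t0 U0 z"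
      using C1(2)[of z] C0(2)[of z] unfolding C_def by linarith+
  qed
  have "AE x in lborel. x \<in> period_cell \<longrightarrow> - F (\<tau>, x) = 0"
  proof (rule AE_zero_of_bump_integrals)
    show "bounded_borel (cell L) (\<lambda>x. - F (\<tau>, x))" for L
      by (intro bounded_borel_minus bounded_borel_slice Fb)
    show "0 \<le> - F (\<tau>, x)" for x using bounds(1)[of "(\<tau>, x)"] by (simp add: F_def)
    show "((\<lambda>L. C * ((LINT z:strip T L|lborel. deviation r1 t1 U1 z) + (LINT z:strip T (- L - 1)|lborel. deviation r0 t0 U0 z)))
       \<longlongrightarrow> 0) at_top"
      using tendsto_mult[OF tendsto_const[of C] tendsto_add[OF lim1 lim0]] by simp
    show "\<forall>\<^sub>F L in at_top. (LINT x:cell (L + 1)|lborel. bump L (fst x) * - F (\<tau>, x))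
        \<le> C * ((LINT z:strip T L|lborel. deviation r1 t1 U1 z) + (LINT z:strip T (- L - 1)|lborel. deviation r0 t0 U0 z))"
      using eventually_ge_at_top[of 0]
    proof eventually_elim
      case (elim L)
      note B = bump_facts[OF elim]
      \<comment> \<open>The self-similar factor is the constant 1, so the value chosen for the time
        shift has no influence.\<close>
      have jump: "test_jump \<tau> 1 F (\<lambda>x. 0) (bump L) (\<lambda>_. 1) = (\<lambda>x. F (\<tau>, x) * bump L (fst x))"
        by (auto simp: test_jump_def)
      have bulk: "test_bulk 1 F (\<lambda>z. F z * a z) (bump L) (bump' L) (\<lambda>_. 1) (\<lambda>_. 0) = (\<lambda>z. F z * a z * bump' L (fst (snd z)))"
        by (auto simp: test_bulk_def)
      have bulkb: "bounded_borel (slab \<tau> (L + 1)) (\<lambda>z. F z * a z * bump' L (fst (snd z)))"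
        using bounded_borel_test_bulk[OF zero_less_one Fb B(1) C1_pair_const[of 1]] unfolding bulk .
      have "(LINT z:slab \<tau> (L + 1)|lborel. F z * a z * bump' L (fst (snd z))) \<le> (LINT x:cell (L + 1)|lborel. F (\<tau>, x) * bump L (fst x))"
        using over'[unfolded overbalanced_def, rule_format, of "L + 1" "bump L" "bump' L" "\<lambda>_. 1" "\<lambda>_. 0" 1]
          B(1,4) C1_pair_const[of 1] unfolding jump bulk by simp
      moreover have "(LINT x:cell (L + 1)|lborel. bump L (fst x) * - F (\<tau>, x)) = - (LINT x:cell (L + 1)|lborel. F (\<tau>, x) * bump L (fst x))"
        by (simp add: set_lebesgue_integral_def mult_ac)
      moreover have "(LINT z:slab \<tau> (L + 1)|lborel. - (F z * a z * bump' L (fst (snd z)))) = - (LINT z:slab \<tau> (L + 1)|lborel. F z * a z * bump' L (fst (snd z)))"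
        by (simp add: set_lebesgue_integral_def)
      moreover have "(LINT z:slab \<tau> (L + 1)|lborel. - (F z * a z * bump' L (fst (snd z))))
         \<le> C * ((LINT z:strip T L|lborel. deviation r1 t1 U1 z) + (LINT z:strip T (- L - 1)|lborel. deviation r0 t0 U0 z))"
      proof (rule slab_boundary_le[OF _ bounded_borel_minus[OF bulkb] C])
        have *: "- (F z * a z * bump' L (fst (snd z))) \<le> 4 * \<bar>F z * a z\<bar>" for z
        proof -
          have "\<bar>F z * a z * bump' L (fst (snd z))\<bar> \<le> \<bar>F z * a z\<bar> * 4"
            unfolding abs_mult[of "F z * a z"] by (intro mult_left_mono B(8)) auto
          then show ?thesis by linarith
        qed
        show "- (F z * a z * bump' L (fst (snd z))) \<le> C * deviation r1 t1 U1 z"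
          "- (F z * a z * bump' L (fst (snd z))) \<le> C * deviation r0 t0 U0 z" for z
          using *[of z] Cle[of z] by linarith+
        show "- (F z * a z * bump' L (fst (snd z))) \<le> 0" if "\<bar>fst (snd z)\<bar> < L" for z
          using B(7)[of "fst (snd z)"] that by simp
      qed (use \<tau> in auto)
      ultimately show ?case by linarith
    qed
  qed
  then show ?thesis
  proof eventually_elim
    case (elim x)
    show ?case
    proof
      assume "x \<in> period_cell"
      then have "m (\<tau>, x) = 0" using elim bounds(1)[of "(\<tau>, x)"] by (simp add: F_def)
      then show "S \<le> entropy cv (\<rho> (\<tau>, x)) (\<theta> (\<tau>, x))" by (simp add: m_def max_def split: if_splits)
    qed
  qed
qed

end

section \<open>Uniqueness\<close>

text \<open>A bound independent of the smoothing parameter, the majorant for dominated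
  convergence.\<close>

lemma rel_energy_bound:
  assumes cv: "cv > 0" and K: "K \<ge> 0" "H \<ge> 0" "W \<ge> 0"
    and b: "\<bar>r\<bar> \<le> K" "\<bar>t\<bar> \<le> K" "\<bar>entropy cv r t\<bar> \<le> K" "\<bar>a\<bar> \<le> K" "\<bar>b\<bar> \<le> K"
    and U: "\<bar>U\<bar> \<le> W" and h: "0 \<le> h" "h \<le> H"
  shows "\<bar>rel_energy cv S r t a b U h\<bar> \<le> 1 / 2 * K * ((K + W)\<^sup>2 + K\<^sup>2)
     + (cv * K * K + (cv + 1) * K * H + K * (K + \<bar>S\<bar>) * H + exp (- S) * H powr (cv + 1))"
proof -
  have "\<bar>a - U\<bar> \<le> K + W" using b(4) U by linarith
  then have "(a - U)\<^sup>2 \<le> (K + W)\<^sup>2" "b\<^sup>2 \<le> K\<^sup>2"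
    using b(5) by (simp_all add: abs_le_square_iff[symmetric] power2_le_iff_abs_le K)
  then have "\<bar>(a - U)\<^sup>2 + b\<^sup>2\<bar> \<le> (K + W)\<^sup>2 + K\<^sup>2" by (simp add: abs_of_nonneg)
  then have "\<bar>1 / 2 * r * ((a - U)\<^sup>2 + b\<^sup>2)\<bar> \<le> 1 / 2 * K * ((K + W)\<^sup>2 + K\<^sup>2)"
    unfolding abs_mult using b(1) K by (intro mult_mono) auto
  moreover have "\<bar>cv * r * t\<bar> \<le> cv * K * K"
    unfolding abs_mult using b cv K by (intro mult_mono) auto
  moreover have "\<bar>(cv + 1) * r * h\<bar> \<le> (cv + 1) * K * H"
    unfolding abs_mult using b h cv K by (intro mult_mono) auto
  moreover have "\<bar>r * (entropy cv r t - S) * h\<bar> \<le> K * (K + \<bar>S\<bar>) * H"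
  proof -
    have "\<bar>entropy cv r t - S\<bar> \<le> K + \<bar>S\<bar>" using b(3) by linarith
    then show ?thesis unfolding abs_mult using b h K by (intro mult_mono) auto
  qed
  moreover have "\<bar>exp (- S) * h powr (cv + 1)\<bar> \<le> exp (- S) * H powr (cv + 1)"
    using h cv by (simp add: abs_mult powr_mono2)
  ultimately show ?thesis unfolding rel_energy_def rel_internal_def by linarith
qed

lemma rel_energy_self:
  assumes "r > 0" "t > 0" "entropy cv r t = S"
  shows "rel_energy cv S r t U 0 U t = 0"
proof -
  have "exp S = t powr cv / r" unfolding assms(3)[symmetric] entropy_def using assms by simp
  then have "exp (- S) * t powr (cv + 1) = r * t"
    using assms by (simp add: exp_minus powr_add field_simps)
  then show ?thesis unfolding rel_energy_def rel_internal_def assms(3) by (simp add: algebra_simps)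
qed

text \<open>The sampling points are squeezed to \<open>l\<close> because the windows shrink and move
  there; continuity of \<open>f\<close> does the rest. This replaces any estimate of the distance
  between an average and its profile.\<close>

lemma sample_tendsto:
  fixes f :: "real \<Rightarrow> real"
  assumes "continuous_on UNIV f" and y: "\<And>n. \<exists>z\<in>{x n..x n + d n}. y n = f z"
    and lim: "x \<longlonglongrightarrow> l" "d \<longlonglongrightarrow> 0"
  shows "y \<longlonglongrightarrow> f l"
proof -
  obtain z where z: "\<And>n. z n \<in> {x n..x n + d n}" "\<And>n. y n = f (z n)" using y by metis
  have "z \<longlonglongrightarrow> l"
  proof (rule tendsto_sandwich[OF _ _ lim(1)])
    show "(\<lambda>n. x n + d n) \<longlonglongrightarrow> l" using tendsto_add[OF lim] by simp
  qed (use z(1) in auto)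
  then have "(\<lambda>n. f (z n)) \<longlonglongrightarrow> f l"
    using assms(1) by (intro isCont_tendsto_compose[of _ f]) (simp_all add: continuous_on_eq_continuous_at)
  moreover have "y = (\<lambda>n. f (z n))" using z(2) by blast
  ultimately show ?thesis by simp
qed

lemma wave_profile_bounded:
  assumes prof: "wave_profile cv v c" and M: "M > 0"
    and right: "\<And>\<xi>. \<xi> > M \<Longrightarrow> v \<xi> = U1 \<and> c \<xi> = c1" and left: "\<And>\<xi>. \<xi> < -M \<Longrightarrow> v \<xi> = U0 \<and> c \<xi> = c0"
  shows "\<exists>W\<ge>0. \<forall>\<xi>. \<bar>v \<xi>\<bar> \<le> W \<and> c \<xi> \<le> W"
proof -
  have "compact (v ` {-M..M})" "compact (c ` {-M..M})"
    using prof continuous_on_subset unfolding wave_profile_def by (blast intro: compact_continuous_image)+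
  then have "bounded (v ` {-M..M})" "bounded (c ` {-M..M})" using compact_imp_bounded by blast+
  then obtain A B where A: "\<And>\<xi>. \<xi> \<in> {-M..M} \<Longrightarrow> \<bar>v \<xi>\<bar> \<le> A" and B: "\<And>\<xi>. \<xi> \<in> {-M..M} \<Longrightarrow> \<bar>c \<xi>\<bar> \<le> B"
    unfolding bounded_iff real_norm_def by (metis imageI)
  define W where "W = \<bar>A\<bar> + \<bar>B\<bar> + \<bar>U1\<bar> + \<bar>U0\<bar> + \<bar>c1\<bar> + \<bar>c0\<bar>"
  have "\<bar>v \<xi>\<bar> \<le> W \<and> c \<xi> \<le> W" for \<xi>
  proof -
    consider "\<xi> > M" | "\<xi> < -M" | "\<xi> \<in> {-M..M}" by fastforce
    then show ?thesis
    proof cases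
      case 1 then show ?thesis using right[OF 1] unfolding W_def by auto
    next
      case 2 then show ?thesis using left[OF 2] unfolding W_def by auto
    next
      case 3 then show ?thesis using A[OF 3] B[OF 3] unfolding W_def by auto
    qed
  qed
  moreover have "W \<ge> 0" by (simp add: W_def)
  ultimately show ?thesis by blast
qed

context euler_fields
begin

text \<open>Two limits in a fixed order. At fixed \<open>L\<close> the smoothing is removed: the
  defect is \<open>C * \<epsilon> n\<close> times the measure of the slab, which grows with
  \<open>L\<close>, and the initial relative energy disappears. Then \<open>L\<close> tends to
  infinity and the far field condition removes the boundary flux.\<close>

lemma relative_energy_vanishes:
  assumes \<tau>: "\<tau> \<in> {0<..<T}"
    and pos: "R_L > 0" "R_R > 0" "Theta_L > 0" "Theta_R > 0"
    and data: "entropy cv R_L Theta_L = S" "entropy cv R_R Theta_R = S"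
    and mass: "balanced \<tau> \<rho> (\<lambda>z. \<rho> z * a z) (riemann R_L R_R)"
    and momentum: "balanced \<tau> (\<lambda>z. \<rho> z * a z) (\<lambda>z. \<rho> z * (a z)\<^sup>2 + \<rho> z * \<theta> z) (\<lambda>x. riemann R_L R_R x * riemann U_L U_R x)"
    and energy: "balanced \<tau> (\<lambda>z. energy cv (\<rho> z) (\<theta> z) (a z, b z)) (\<lambda>z. (energy cv (\<rho> z) (\<theta> z) (a z, b z) + \<rho> z * \<theta> z) * a z)
          (\<lambda>x. energy cv (riemann R_L R_R x) (riemann Theta_L Theta_R x) (riemann U_L U_R x, 0))"
    and entropy: "overbalanced \<tau> (\<lambda>z. \<rho> z * (entropy cv (\<rho> z) (\<theta> z) - S)) (\<lambda>z. \<rho> z * (entropy cv (\<rho> z) (\<theta> z) - S) * a z)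
          (\<lambda>x. riemann R_L R_R x * (entropy cv (riemann R_L R_R x) (riemann Theta_L Theta_R x) - S))"
    and smin: "AE z in lborel. fst z \<in> {0<..<T} \<and> snd z \<in> period_cell \<longrightarrow> S \<le> entropy cv (\<rho> z) (\<theta> z)"
    and lim1: "((\<lambda>L. LINT z:strip T L|lborel. deviation R_R Theta_R U_R z) \<longlongrightarrow> 0) at_top"
    and lim0: "((\<lambda>L. LINT z:strip T (- L - 1)|lborel. deviation R_L Theta_L U_L z) \<longlongrightarrow> 0) at_top"
    and prof: "wave_profile cv v c" and M: "M > 0"
    and right: "\<And>\<xi>. \<xi> > M \<Longrightarrow> v \<xi> = U_R \<and> c \<xi> = c_R" and left: "\<And>\<xi>. \<xi> < -M \<Longrightarrow> v \<xi> = U_L \<and> c \<xi> = c_L"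
    and Theta: "Theta_L = cv / (cv + 1) * c_L\<^sup>2" "Theta_R = cv / (cv + 1) * c_R\<^sup>2"
  shows "AE x in lborel. x \<in> period_cell \<longrightarrow>
     rel_energy cv S (\<rho> (\<tau>, x)) (\<theta> (\<tau>, x)) (a (\<tau>, x)) (b (\<tau>, x)) (v (fst x / \<tau>)) (cv / (cv + 1) * (c (fst x / \<tau>))\<^sup>2) = 0"
proof -
  have \<tau>0: "0 < \<tau>" "\<tau> < T" using \<tau> by auto
  obtain W where W: "W \<ge> 0" "\<And>\<xi>. \<bar>v \<xi>\<bar> \<le> W" "\<And>\<xi>. c \<xi> \<le> W"
    using wave_profile_bounded[OF prof M right left] by auto
  have vc: "continuous_on UNIV v" "continuous_on UNIV c" and cpos: "\<And>\<xi>. 0 < c \<xi>"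
    using prof unfolding wave_profile_def by auto
  define \<kappa> where "\<kappa> = cv / (cv + 1)"
  have \<kappa>: "\<kappa> > 0" using cv by (simp add: \<kappa>_def)
  define \<epsilon> \<delta> where "\<epsilon> = (\<lambda>n. inverse (real (Suc n)))" and "\<delta> = (\<lambda>n. (\<epsilon> n)\<^sup>2)"
  have \<epsilon>: "0 < \<epsilon> n" "\<epsilon> n \<le> 1" and \<delta>: "0 < \<delta> n" "\<delta> n \<le> 1" for n
    by (auto simp: \<epsilon>_def \<delta>_def inverse_le_1_iff power_le_one)
  have \<epsilon>0: "\<epsilon> \<longlonglongrightarrow> 0" unfolding \<epsilon>_def by (rule LIMSEQ_inverse_real_of_nat)
  have \<delta>0: "\<delta> \<longlonglongrightarrow> 0" unfolding \<delta>_def using tendsto_power[OF \<epsilon>0, of 2] by simp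
  obtain w w' k k' where sp: "\<And>n. smooth_profile cv (\<delta> n) v c (w n) (w' n) (k n) (k' n)"
    using smooth_profile_exists[OF cv \<delta>(1) prof] by metis
  have ws: "\<exists>z\<in>{\<xi>..\<xi> + \<delta> n}. w n \<xi> = v z" and ks: "\<exists>z\<in>{\<xi>..\<xi> + \<delta> n}. k n \<xi> = c z" for n \<xi>
    using sp[of n] unfolding smooth_profile_def by blast+
  have wk: "\<bar>w n \<xi>\<bar> \<le> W" "0 < k n \<xi>" "k n \<xi> \<le> W" for n \<xi>
    using ws[of \<xi> n] ks[of \<xi> n] W cpos by auto
  \<comment> \<open>The averages look forward by at most 1, which costs one more unit on the left
    than on the right.\<close>
  have far: "\<xi> \<ge> M + 1 \<Longrightarrow> w n \<xi> = U_R \<and> k n \<xi> = c_R" "\<xi> \<le> - M - 2 \<Longrightarrow> w n \<xi> = U_L \<and> k n \<xi> = c_L" for n \<xi>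
  proof -
    obtain z1 z2 where z: "z1 \<in> {\<xi>..\<xi> + \<delta> n}" "w n \<xi> = v z1" "z2 \<in> {\<xi>..\<xi> + \<delta> n}" "k n \<xi> = c z2"
      using ws[of \<xi> n] ks[of \<xi> n] by blast
    show "\<xi> \<ge> M + 1 \<Longrightarrow> w n \<xi> = U_R \<and> k n \<xi> = c_R" using z right[of z1] right[of z2] by auto
    show "\<xi> \<le> - M - 2 \<Longrightarrow> w n \<xi> = U_L \<and> k n \<xi> = c_L"
      using z left[of z1] left[of z2] \<delta>(2)[of n] by auto
  qed
  define h where "h = (\<lambda>n \<xi>. cv / (cv + 1) * (k n \<xi>)\<^sup>2)"
  have h: "0 < h n \<xi>" "h n \<xi> \<le> \<kappa> * W\<^sup>2" for n \<xi>
    using wk(2,3)[of n \<xi>] \<kappa> by (auto simp: h_def \<kappa>_def[symmetric] intro!: mult_left_mono power_mono)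
  have wc: "continuous_on UNIV (w n)" "continuous_on UNIV (k n)" for n
  proof -
    have "C1_pair (w n) (w' n)" "C1_pair (k n) (k' n)"
      using sp[of n] unfolding smooth_profile_def C1_pair_def by blast+
    then show "continuous_on UNIV (w n)" "continuous_on UNIV (k n)" using C1_pair_continuous by blast+
  qed
  define r0 t0 u0 where "r0 = riemann R_L R_R" and "t0 = riemann Theta_L Theta_R" and "u0 = riemann U_L U_R"
  have s0: "entropy cv (r0 x) (t0 x) = S" for x using data by (simp add: r0_def t0_def riemann_def)
  have rb: "bounded_borel UNIV (riemann l r)" for l r :: real
    by (rule bounded_borelI[of _ _ "max \<bar>l\<bar> \<bar>r\<bar>", OF riemann_measurable]) (auto simp: riemann_def)
  define X where "X = (\<lambda>n x. rel_energy cv S (\<rho> (\<tau>, x)) (\<theta> (\<tau>, x)) (a (\<tau>, x)) (b (\<tau>, x))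
      (w n (fst x / (\<tau> + \<epsilon> n))) (h n (fst x / (\<tau> + \<epsilon> n))))"
  define Y where "Y = (\<lambda>n x::real \<times> real. rel_energy cv S (r0 (fst x)) (t0 (fst x)) (u0 (fst x)) 0
      (w n (fst x / \<epsilon> n)) (h n (fst x / \<epsilon> n)))"
  define E where "E = (\<lambda>x. rel_energy cv S (\<rho> (\<tau>, x)) (\<theta> (\<tau>, x)) (a (\<tau>, x)) (b (\<tau>, x))
      (v (fst x / \<tau>)) (\<kappa> * (c (fst x / \<tau>))\<^sup>2))"
  define C where "C = (K * (K + W) + ((cv + 1) * (K + exp (- S) * (cv / (cv + 1) * W\<^sup>2) powr cv) + K * (K + \<bar>S\<bar>)) * (W / (cv + 1)))
           * (2 + 1 / (2 * cv))"
  have slice: "(\<lambda>x. q (\<tau>, x)) \<in> borel_measurable borel" if "q \<in> borel_measurable borel" for q :: "real \<times> (real \<times> real) \<Rightarrow> real"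
  proof -
    have "Pair \<tau> \<in> borel_measurable (borel :: (real \<times> real) measure)"
      by (intro borel_measurable_continuous_onI continuous_intros)
    from measurable_compose[OF this that] show ?thesis .
  qed
  have [measurable]: "w n \<in> borel_measurable borel" "k n \<in> borel_measurable borel" "v \<in> borel_measurable borel"
     "c \<in> borel_measurable borel" for n
    using wc vc by (auto intro: borel_measurable_continuous_onI)
  have [measurable]: "r0 \<in> borel_measurable borel" "t0 \<in> borel_measurable borel" "u0 \<in> borel_measurable borel"
    by (simp_all add: r0_def t0_def u0_def)
  have fst_m[measurable]: "(fst :: real \<times> real \<Rightarrow> real) \<in> borel_measurable borel"
    by (intro borel_measurable_continuous_onI continuous_intros)
  have sl[measurable]: "(\<lambda>x. \<rho> (\<tau>, x)) \<in> borel_measurable borel" "(\<lambda>x. \<theta> (\<tau>, x)) \<in> borel_measurable borel"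
    "(\<lambda>x. a (\<tau>, x)) \<in> borel_measurable borel" "(\<lambda>x. b (\<tau>, x)) \<in> borel_measurable borel"
    by (intro slice meas)+
  have Xm[measurable]: "X n \<in> borel_measurable borel" "Y n \<in> borel_measurable borel" "E \<in> borel_measurable borel" for n
    unfolding X_def Y_def E_def rel_energy_def rel_internal_def h_def by measurable
  \<comment> \<open>Enlarges \<open>K\<close> to bound the Riemann data and their entropy too, so
    that \<open>B\<close> majorises the initial relative energy \<open>Y\<close> as well as
    \<open>X\<close>.\<close>
  define K' where "K' = K + \<bar>S\<bar> + \<bar>R_L\<bar> + \<bar>R_R\<bar> + \<bar>Theta_L\<bar> + \<bar>Theta_R\<bar> + \<bar>U_L\<bar> + \<bar>U_R\<bar>"
  have K': "K' \<ge> 0" "K \<le> K'" using K1 by (auto simp: K'_def)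
  define B where "B = 1 / 2 * K' * ((K' + W)\<^sup>2 + K'\<^sup>2)
     + (cv * K' * K' + (cv + 1) * K' * (\<kappa> * W\<^sup>2) + K' * (K' + \<bar>S\<bar>) * (\<kappa> * W\<^sup>2) + exp (- S) * (\<kappa> * W\<^sup>2) powr (cv + 1))"
  have fb: "\<bar>\<rho> z\<bar> \<le> K'" "\<bar>\<theta> z\<bar> \<le> K'" "\<bar>entropy cv (\<rho> z) (\<theta> z)\<bar> \<le> K'" "\<bar>a z\<bar> \<le> K'" "\<bar>b z\<bar> \<le> K'" for z
    using bounds(1,2)[of z] bounds(3,4)[of z] bounds(5)[of z] bounds(6)[of z] bounds(7)[of z] K'(2) by linarith+
  have H0: "0 \<le> \<kappa> * W\<^sup>2" using \<kappa> by simp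
  have XB: "\<bar>X n x\<bar> \<le> B" for n x
    unfolding X_def B_def by (rule rel_energy_bound[OF cv K'(1) H0 W(1) fb wk(1) less_imp_le[OF h(1)] h(2)])
  have EB: "\<bar>E x\<bar> \<le> B" for x
    unfolding E_def B_def
    by (rule rel_energy_bound[OF cv K'(1) H0 W(1) fb W(2)])
       (use \<kappa> W(3) cpos in \<open>auto intro!: mult_left_mono power_mono less_imp_le[OF cpos]\<close>)
  have YB: "\<bar>Y n x\<bar> \<le> B" for n x
    unfolding Y_def B_def
    by (rule rel_energy_bound[OF cv K'(1) H0 W(1) _ _ _ _ _ wk(1) less_imp_le[OF h(1)] h(2)])
       (use K1 data in \<open>auto simp: r0_def t0_def u0_def riemann_def K'_def\<close>)
  have B0: "0 \<le> B" using YB[of 0 0] by linarith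
  obtain C1 where C1: "C1 \<ge> 0" "\<And>z. \<bar>rel_flux cv S (\<rho> z) (\<theta> z) (a z) (b z) U_R Theta_R\<bar> \<le> C1 * deviation R_R Theta_R U_R z"
    using rel_flux_dominated[OF pos(2,4) data(2)] unfolding dominated_def by blast
  obtain C0 where C0: "C0 \<ge> 0" "\<And>z. \<bar>rel_flux cv S (\<rho> z) (\<theta> z) (a z) (b z) U_L Theta_L\<bar> \<le> C0 * deviation R_L Theta_L U_L z"
    using rel_flux_dominated[OF pos(1,3) data(1)] unfolding dominated_def by blast
  define Cf where "Cf = 4 * max C0 C1"
  have Cf: "Cf \<ge> 0" using C0 by (simp add: Cf_def)
  have Cle: "4 * \<bar>rel_flux cv S (\<rho> z) (\<theta> z) (a z) (b z) U_R Theta_R\<bar> \<le> Cf * deviation R_R Theta_R U_R z"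
    "4 * \<bar>rel_flux cv S (\<rho> z) (\<theta> z) (a z) (b z) U_L Theta_L\<bar> \<le> Cf * deviation R_L Theta_L U_L z" for z
  proof -
    have "C1 * deviation R_R Theta_R U_R z \<le> max C0 C1 * deviation R_R Theta_R U_R z"
      "C0 * deviation R_L Theta_L U_L z \<le> max C0 C1 * deviation R_L Theta_L U_L z"
      by (intro mult_right_mono deviation_nonneg; simp)+
    then show "4 * \<bar>rel_flux cv S (\<rho> z) (\<theta> z) (a z) (b z) U_R Theta_R\<bar> \<le> Cf * deviation R_R Theta_R U_R z"
      "4 * \<bar>rel_flux cv S (\<rho> z) (\<theta> z) (a z) (b z) U_L Theta_L\<bar> \<le> Cf * deviation R_L Theta_L U_L z"
      using C1(2)[of z] C0(2)[of z] unfolding Cf_def by linarith+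
  qed
  define tail where "tail = (\<lambda>L. (LINT z:strip T L|lborel. deviation R_R Theta_R U_R z)
      + (LINT z:strip T (- L - 1)|lborel. deviation R_L Theta_L U_L z))"
  \<comment> \<open>Since \<open>t + \<epsilon> n \<le> T + 1\<close>, the threshold for
    \<open>L\<close> ensures \<open>\<bar>x1\<bar> / (t + \<epsilon> n) \<ge> M + 2\<close> wherever
    \<open>bump'\<close> is nonzero, so the smoothed profile takes its far values there and the flux
    is controlled by the deviation.\<close>
  have step: "(LINT x:cell (L + 1)|lborel. bump L (fst x) * (X n x - Y n x))
       \<le> Cf * tail L + C * \<epsilon> n * measure lborel (slab \<tau> (L + 1))"
    if L: "L \<ge> (M + 2) * (T + 1)" for L n
  proof -
    have L0: "L \<ge> 0" using L M T by (meson add_nonneg_nonneg less_imp_le mult_nonneg_nonneg order_trans zero_le_numeral zero_le_one)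
    note B = bump_facts[OF L0]
    define fl where "fl = (\<lambda>z::real \<times> (real \<times> real). bump' L (fst (snd z)) *
             rel_flux cv S (\<rho> z) (\<theta> z) (a z) (b z) (w n (fst (snd z) / (fst z + \<epsilon> n))) (h n (fst (snd z) / (fst z + \<epsilon> n))))"
    define Cn where "Cn = (K * (K + W) + ((cv + 1) * (K + exp (- S) * (cv / (cv + 1) * W\<^sup>2) powr cv) + K * (K + \<bar>S\<bar>)) * (W / (cv + 1)))
           * ((2 + 1 / (2 * cv)) * \<delta> n) / \<epsilon> n"
    \<comment> \<open>One of the two factors \<open>\<epsilon> n\<close> in
      \<open>\<delta> n\<close> cancels against the division by \<open>\<epsilon> n\<close>.\<close>
    have Cn: "Cn = C * \<epsilon> n" using \<epsilon>(1)[of n] by (simp add: Cn_def C_def \<delta>_def power2_eq_square)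
    have main: "(LINT x:cell (L + 1)|lborel. bump L (fst x) * (X n x - Y n x)) \<le> (LINT z:slab \<tau> (L + 1)|lborel. fl z + Cn)"
      unfolding X_def Y_def h_def fl_def Cn_def
      by (rule relative_energy_step[OF \<tau>, where ?r0.0 = r0 and ?t0.0 = t0 and ?u0.0 = u0])
         (use mass momentum energy entropy rb smin L0 B sp \<delta> \<epsilon> wk s0 bounded_borel_const[of UNIV S] in
            \<open>auto simp: r0_def t0_def u0_def\<close>)
    have flb: "bounded_borel (slab \<tau> (L + 1)) fl"
    proof (rule bounded_borelI)
      have "(\<lambda>z::real \<times> (real \<times> real). fst (snd z)) \<in> borel_measurable borel" "(\<lambda>z::real \<times> (real \<times> real). fst z) \<in> borel_measurable borel"
        by (intro borel_measurable_continuous_onI continuous_intros)+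
      note [measurable] = this
      have [measurable]: "bump' L \<in> borel_measurable borel"
        unfolding bump'_def[abs_def] by measurable
      show "fl \<in> borel_measurable borel"
        unfolding fl_def rel_flux_def h_def by measurable
      fix z assume z: "z \<in> slab \<tau> (L + 1)"
      define y where "y = fst (snd z) / (fst z + \<epsilon> n)"
      have "\<bar>fl z\<bar> \<le> 4 * \<bar>rel_flux cv S (\<rho> z) (\<theta> z) (a z) (b z) (w n y) (h n y)\<bar>"
        unfolding fl_def abs_mult y_def using B(8) by (intro mult_right_mono) auto
      also have "\<bar>rel_flux cv S (\<rho> z) (\<theta> z) (a z) (b z) (w n y) (h n y)\<bar> \<le>
         1 / 2 * K * K * ((K + W)\<^sup>2 + K\<^sup>2) + (cv + 1) * K * K * (K + \<kappa> * W\<^sup>2)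
         + W * (K * K + exp (- S) * (\<kappa> * W\<^sup>2) powr (cv + 1)) + K * (K + \<bar>S\<bar>) * (\<kappa> * W\<^sup>2) * K"
      proof -
        have r: "\<bar>\<rho> z\<bar> \<le> K" "\<bar>\<theta> z\<bar> \<le> K" and ab: "\<bar>a z\<bar> \<le> K" "\<bar>b z\<bar> \<le> K" using bounds[of z] by auto
        have K0: "K \<ge> 0" using K1 by simp
        have "\<bar>a z - w n y\<bar> \<le> K + W" using ab(1) wk(1)[of n y] by linarith
        then have "(a z - w n y)\<^sup>2 \<le> (K + W)\<^sup>2" "(b z)\<^sup>2 \<le> K\<^sup>2"
          using ab(2) by (simp_all add: power2_le_iff_abs_le K0 W(1))
        then have "\<bar>(a z - w n y)\<^sup>2 + (b z)\<^sup>2\<bar> \<le> (K + W)\<^sup>2 + K\<^sup>2" by (simp add: abs_of_nonneg)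
        then have 1: "\<bar>1 / 2 * \<rho> z * a z * ((a z - w n y)\<^sup>2 + (b z)\<^sup>2)\<bar> \<le> 1 / 2 * K * K * ((K + W)\<^sup>2 + K\<^sup>2)"
          unfolding abs_mult using r ab K0 by (intro mult_mono) auto
        have "\<bar>\<theta> z - h n y\<bar> \<le> K + \<kappa> * W\<^sup>2" using r(2) h[of n y] by linarith
        then have 2: "\<bar>(cv + 1) * \<rho> z * a z * (\<theta> z - h n y)\<bar> \<le> (cv + 1) * K * K * (K + \<kappa> * W\<^sup>2)"
          unfolding abs_mult using r ab K0 cv by (intro mult_mono) auto
        have "h n y powr (cv + 1) \<le> (\<kappa> * W\<^sup>2) powr (cv + 1)" using h[of n y] cv by (intro powr_mono2) auto
        then have "\<bar>exp (- S) * h n y powr (cv + 1)\<bar> \<le> exp (- S) * (\<kappa> * W\<^sup>2) powr (cv + 1)" by (simp add: abs_mult)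
        moreover have "\<bar>\<rho> z * \<theta> z\<bar> \<le> K * K" unfolding abs_mult using r K0 by (intro mult_mono) auto
        ultimately have "\<bar>\<rho> z * \<theta> z - exp (- S) * h n y powr (cv + 1)\<bar> \<le> K * K + exp (- S) * (\<kappa> * W\<^sup>2) powr (cv + 1)"
          by linarith
        then have 3: "\<bar>w n y * (\<rho> z * \<theta> z - exp (- S) * h n y powr (cv + 1))\<bar> \<le> W * (K * K + exp (- S) * (\<kappa> * W\<^sup>2) powr (cv + 1))"
          unfolding abs_mult[of "w n y"] using wk(1)[of n y] W(1) by (intro mult_mono) auto
        have "\<bar>entropy cv (\<rho> z) (\<theta> z) - S\<bar> \<le> K + \<bar>S\<bar>" using bounds(5)[of z] by linarith
        then have 4: "\<bar>\<rho> z * (entropy cv (\<rho> z) (\<theta> z) - S) * h n y * a z\<bar> \<le> K * (K + \<bar>S\<bar>) * (\<kappa> * W\<^sup>2) * K"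
          unfolding abs_mult using r ab K0 h[of n y] H0 by (intro mult_mono) auto
        show ?thesis unfolding rel_flux_def using 1 2 3 4 by linarith
      qed
      finally show "\<bar>fl z\<bar> \<le> 4 * (1 / 2 * K * K * ((K + W)\<^sup>2 + K\<^sup>2) + (cv + 1) * K * K * (K + \<kappa> * W\<^sup>2)
         + W * (K * K + exp (- S) * (\<kappa> * W\<^sup>2) powr (cv + 1)) + K * (K + \<bar>S\<bar>) * (\<kappa> * W\<^sup>2) * K)" by simp
    qed
    have bnd: "\<bar>bump' L y * f\<bar> \<le> 4 * \<bar>f\<bar>" for y f
      unfolding abs_mult using B(8) by (intro mult_right_mono) auto
    have q: "0 < fst z + \<epsilon> n" "fst z + \<epsilon> n \<le> T + 1" if "z \<in> slab \<tau> (L + 1)" for z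
      using that \<tau>0 \<epsilon>[of n] by (auto simp: slab_def)
    have Mq: "(M + 2) * q \<le> L" if "q \<le> T + 1" for q :: real
      using L mult_left_mono[OF that, of "M + 2"] M by linarith
    have "(LINT z:slab \<tau> (L + 1)|lborel. fl z) \<le> Cf * tail L"
      unfolding tail_def
    proof (rule slab_boundary_le[OF less_imp_le[OF \<tau>0(2)] flb Cf])
      fix z assume z: "z \<in> slab \<tau> (L + 1)"
      define y where "y = fst (snd z) / (fst z + \<epsilon> n)"
      show "fl z \<le> Cf * deviation R_R Theta_R U_R z" if "fst (snd z) \<ge> L"
      proof -
        have "M + 2 \<le> y" unfolding y_def using q[OF z] Mq[OF q(2)[OF z]] that by (simp add: pos_le_divide_eq)
        then have "w n y = U_R" "h n y = Theta_R" using far(1)[of y n] Theta by (auto simp: h_def)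
        then have "\<bar>fl z\<bar> \<le> 4 * \<bar>rel_flux cv S (\<rho> z) (\<theta> z) (a z) (b z) U_R Theta_R\<bar>"
          unfolding fl_def y_def[symmetric] using bnd by simp
        then show ?thesis using Cle(1)[of z] by linarith
      qed
      show "fl z \<le> Cf * deviation R_L Theta_L U_L z" if "fst (snd z) \<le> - L"
      proof -
        have "fst (snd z) \<le> - (M + 2) * (fst z + \<epsilon> n)"
          using Mq[OF q(2)[OF z]] that unfolding mult_minus_left by linarith
        then have "y \<le> - (M + 2)" unfolding y_def using q[OF z] by (simp only: pos_divide_le_eq)
        then have "w n y = U_L" "h n y = Theta_L" using far(2)[of y n] Theta by (auto simp: h_def)
        then have "\<bar>fl z\<bar> \<le> 4 * \<bar>rel_flux cv S (\<rho> z) (\<theta> z) (a z) (b z) U_L Theta_L\<bar>"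
          unfolding fl_def y_def[symmetric] using bnd by simp
        then show ?thesis using Cle(2)[of z] by linarith
      qed
      show "fl z \<le> 0" if "\<bar>fst (snd z)\<bar> < L" using B(7)[of "fst (snd z)"] that by (simp add: fl_def)
    qed
    moreover have "(LINT z:slab \<tau> (L + 1)|lborel. fl z + Cn) = (LINT z:slab \<tau> (L + 1)|lborel. fl z) + (LINT z:slab \<tau> (L + 1)|lborel. Cn)"
      by (rule set_integral_add(2)) (intro slab_integrable flb bounded_borel_const)+
    moreover have "(LINT z:slab \<tau> (L + 1)|lborel. Cn) = Cn * measure lborel (slab \<tau> (L + 1))"
      using emeasure_bounded_finite[OF slab_bounded[of \<tau> "L + 1"]]
      by (simp add: set_lebesgue_integral_def mult.commute less_top)
    ultimately show ?thesis using main unfolding Cn by linarith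
  qed
  have limit: "(LINT x:cell (L + 1)|lborel. bump L (fst x) * E x) \<le> Cf * tail L" if L: "L \<ge> (M + 2) * (T + 1)" for L
  proof -
    have L0: "L \<ge> 0" using L M T by (meson add_nonneg_nonneg less_imp_le mult_nonneg_nonneg order_trans zero_le_numeral zero_le_one)
    note B = bump_facts[OF L0]
    have [measurable]: "bump L \<in> borel_measurable borel" unfolding bump_def[abs_def] by measurable
    have "(\<lambda>n. LINT x|lborel. indicator (cell (L + 1)) x *\<^sub>R (bump L (fst x) * (X n x - Y n x)))
       \<longlonglongrightarrow> (LINT x|lborel. indicator (cell (L + 1)) x *\<^sub>R (bump L (fst x) * E x))"
    proof (rule integral_dominated_convergence[where w = "\<lambda>x. indicator (cell (L + 1)) x *\<^sub>R (2 * B)"])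
      show "(\<lambda>x. indicator (cell (L + 1)) x *\<^sub>R (bump L (fst x) * E x)) \<in> borel_measurable lborel"
        "(\<lambda>x. indicator (cell (L + 1)) x *\<^sub>R (bump L (fst x) * (X n x - Y n x))) \<in> borel_measurable lborel" for n
        by measurable
      show "integrable lborel (\<lambda>x. indicator (cell (L + 1)) x *\<^sub>R (2 * B))"
        using cell_integrable[OF bounded_borel_const] unfolding set_integrable_def .
      show "AE x in lborel. norm (indicator (cell (L + 1)) x *\<^sub>R (bump L (fst x) * (X n x - Y n x)))
          \<le> indicator (cell (L + 1)) x *\<^sub>R (2 * B)" for n
      proof (rule AE_I2)
        fix x
        have "\<bar>X n x - Y n x\<bar> \<le> 2 * B" using XB[of n x] YB[of n x] by linarith
        then have "\<bar>bump L (fst x)\<bar> * \<bar>X n x - Y n x\<bar> \<le> 1 * (2 * B)"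
          using B(4,5)[of "fst x"] by (intro mult_mono) auto
        then show "norm (indicator (cell (L + 1)) x *\<^sub>R (bump L (fst x) * (X n x - Y n x)))
          \<le> indicator (cell (L + 1)) x *\<^sub>R (2 * B)"
          by (simp add: indicator_def abs_mult)
      qed
      show "AE x in lborel. (\<lambda>n. indicator (cell (L + 1)) x *\<^sub>R (bump L (fst x) * (X n x - Y n x)))
          \<longlonglongrightarrow> indicator (cell (L + 1)) x *\<^sub>R (bump L (fst x) * E x)"
        \<comment> \<open>At \<open>x1 = 0\<close> the argument \<open>x1 / \<epsilon> n\<close>
          stays at 0, possibly inside the wave, so the initial relative energy need not tend to 0
          there.\<close>
        using AE_lborel_fst_neq[of 0]
      proof eventually_elim
        case (elim x)
        have lx: "(\<lambda>n. fst x / (\<tau> + \<epsilon> n)) \<longlonglongrightarrow> fst x / (\<tau> + 0)"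
          using \<tau>0 by (intro tendsto_intros \<epsilon>0) auto
        have lw: "(\<lambda>n. w n (fst x / (\<tau> + \<epsilon> n))) \<longlonglongrightarrow> v (fst x / (\<tau> + 0))"
          by (rule sample_tendsto[OF vc(1) ws lx \<delta>0])
        have lk: "(\<lambda>n. k n (fst x / (\<tau> + \<epsilon> n))) \<longlonglongrightarrow> c (fst x / (\<tau> + 0))"
          by (rule sample_tendsto[OF vc(2) ks lx \<delta>0])
        have lh: "(\<lambda>n. h n (fst x / (\<tau> + \<epsilon> n))) \<longlonglongrightarrow> \<kappa> * (c (fst x / (\<tau> + 0)))\<^sup>2"
          unfolding h_def \<kappa>_def[symmetric] by (intro tendsto_intros lk)
        have XE: "(\<lambda>n. X n x) \<longlonglongrightarrow> E x"
        proof -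
          have "\<kappa> * (c (fst x / (\<tau> + 0)))\<^sup>2 > 0" using \<kappa> cpos[of "fst x / (\<tau> + 0)"] by simp
          then have "(\<lambda>n. X n x) \<longlonglongrightarrow> rel_energy cv S (\<rho> (\<tau>, x)) (\<theta> (\<tau>, x)) (a (\<tau>, x)) (b (\<tau>, x))
              (v (fst x / (\<tau> + 0))) (\<kappa> * (c (fst x / (\<tau> + 0)))\<^sup>2)"
            unfolding X_def rel_energy_def rel_internal_def by (intro tendsto_intros lw lh) auto
          then show ?thesis by (simp add: E_def)
        qed
        \<comment> \<open>For fixed nonzero \<open>x1\<close> the argument
          \<open>x1 / \<epsilon> n\<close> eventually leaves the wave; from then on the smoothed
          initial state equals the Riemann data exactly.\<close>
        have Yev: "\<forall>\<^sub>F n in sequentially. Y n x = 0"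
        proof -
          have "(\<lambda>n. (M + 2) * \<epsilon> n) \<longlonglongrightarrow> (M + 2) * 0" by (intro tendsto_intros \<epsilon>0)
          then have "\<forall>\<^sub>F n in sequentially. (M + 2) * \<epsilon> n < \<bar>fst x\<bar>"
            by (rule order_tendstoD) (use elim in auto)
          then show ?thesis
          proof eventually_elim
            case (elim n)
            show ?case
            proof (cases "fst x > 0")
              case True
              then have "M + 2 \<le> fst x / \<epsilon> n" using elim \<epsilon>(1)[of n] by (simp add: pos_le_divide_eq)
              then have "w n (fst x / \<epsilon> n) = U_R" "h n (fst x / \<epsilon> n) = Theta_R"
                using far(1)[of "fst x / \<epsilon> n" n] Theta by (auto simp: h_def)
              then show ?thesis
                using True rel_energy_self[OF pos(2,4) data(2)] by (simp add: Y_def r0_def t0_def u0_def riemann_def)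
            next
              case False
              then have "fst x \<le> - (M + 2) * \<epsilon> n" using elim unfolding mult_minus_left by linarith
              then have "fst x / \<epsilon> n \<le> - (M + 2)" using \<epsilon>(1)[of n] by (simp only: pos_divide_le_eq)
              then have "w n (fst x / \<epsilon> n) = U_L" "h n (fst x / \<epsilon> n) = Theta_L"
                using far(2)[of "fst x / \<epsilon> n" n] Theta by (auto simp: h_def)
              then show ?thesis
                using False rel_energy_self[OF pos(1,3) data(1)] by (simp add: Y_def r0_def t0_def u0_def riemann_def)
            qed
          qed
        qed
        have "(\<lambda>n. X n x - Y n x) \<longlonglongrightarrow> E x - 0"
          by (intro tendsto_diff XE tendsto_eventually Yev)
        then show ?case by (intro tendsto_intros) simp
      qed
    qed
    moreover have "(\<lambda>n. Cf * tail L + C * \<epsilon> n * measure lborel (slab \<tau> (L + 1))) \<longlonglongrightarrow> Cf * tail L + C * 0 * measure lborel (slab \<tau> (L + 1))"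
      by (intro tendsto_intros \<epsilon>0)
    ultimately have "(LINT x|lborel. indicator (cell (L + 1)) x *\<^sub>R (bump L (fst x) * E x)) \<le> Cf * tail L + C * 0 * measure lborel (slab \<tau> (L + 1))"
      by (rule LIMSEQ_le) (use step[OF L] in \<open>auto simp: set_lebesgue_integral_def\<close>)
    then show ?thesis by (simp add: set_lebesgue_integral_def)
  qed
  have "AE x in lborel. x \<in> period_cell \<longrightarrow> E x = 0"
  proof (rule AE_zero_of_bump_integrals)
    show "bounded_borel (cell L) E" for L by (rule bounded_borelI[OF Xm(3) EB])
    show "0 \<le> E x" for x
    proof -
      have "0 \<le> rel_internal cv S (\<rho> (\<tau>, x)) (\<theta> (\<tau>, x)) (\<kappa> * (c (fst x / \<tau>))\<^sup>2)"
        by (rule rel_internal_nonneg) (use cv bounds \<kappa> cpos[of "fst x / \<tau>"] in auto)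
      then show ?thesis unfolding E_def rel_energy_def using bounds(1)[of "(\<tau>, x)"] by simp
    qed
    show "\<forall>\<^sub>F L in at_top. (LINT x:cell (L + 1)|lborel. bump L (fst x) * E x) \<le> Cf * tail L"
      using eventually_ge_at_top[of "(M + 2) * (T + 1)"] by eventually_elim (rule limit)
    show "((\<lambda>L. Cf * tail L) \<longlongrightarrow> 0) at_top"
      unfolding tail_def using tendsto_mult[OF tendsto_const[of Cf] tendsto_add[OF lim1 lim0]] by simp
  qed
  then show ?thesis unfolding E_def \<kappa>_def .
qed

end

section \<open>From one period and single times to space-time\<close>

text \<open>By periodicity every bad point is an integer translate, in \<open>x2\<close>, of a bad
  point of the period cell, so the bad set lies in a countable union of translates of a null set.
  \<open>P\<close> is not assumed measurable, hence the passage through the complete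
  measure.\<close>

lemma AE_periodic_extension:
  assumes ae: "AE z in (lborel :: (real \<times> (real \<times> real)) measure).
      fst z \<in> {0<..<T} \<and> snd z \<in> period_cell \<longrightarrow> P (fst z) (snd z)"
    and per: "\<And>t y x2. t \<in> {0<..<T} \<Longrightarrow> P t (y, x2 + 1) = P t (y, x2)"
  shows "AE z in (lborel :: (real \<times> (real \<times> real)) measure). fst z \<in> {0<..<T} \<longrightarrow> P (fst z) (snd z)"
proof -
  have per_nat: "P t (y, x2 + real n) = P t (y, x2)" if "t \<in> {0<..<T}" for t y x2 n
  proof (induction n)
    case (Suc n)
    have "P t (y, x2 + real (Suc n)) = P t (y, (x2 + real n) + 1)" by (simp add: add_ac)
    then show ?case using per[OF that] Suc by simp
  qed simp
  have per_int: "P t (y, x2 + of_int j) = P t (y, x2)" if "t \<in> {0<..<T}" for t y x2 j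
  proof (cases j)
    case (nonneg n)
    then show ?thesis using per_nat[OF that, of y x2 n] by simp
  next
    case (neg n)
    have "P t (y, (x2 + of_int j) + real (Suc n)) = P t (y, x2 + of_int j)" by (rule per_nat[OF that])
    then show ?thesis using neg by simp
  qed
  define N where "N = {z :: real \<times> (real \<times> real). \<not> (fst z \<in> {0<..<T} \<and> snd z \<in> period_cell \<longrightarrow> P (fst z) (snd z))}"
  have "AE z in lebesgue. z \<notin> N" using ae unfolding AE_completion_iff N_def mem_Collect_eq not_not .
  then have "N \<in> null_sets lebesgue"
    using completion.complete2[of N] by (auto simp: eventually_ae_filter)
  then have "negligible N" by (simp add: negligible_iff_null_sets)
  then have "negligible ((+) (0, (0, of_int j)) ` N)" for j :: int by (rule negligible_translation)
  then have "negligible (\<Union>j::int. (+) (0, (0, of_int j)) ` N)"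
    by (intro negligible_countable_Union) auto
  moreover have "{z. \<not> (fst z \<in> {0<..<T} \<longrightarrow> P (fst z) (snd z))} \<subseteq> (\<Union>j::int. (+) (0, (0, of_int j)) ` N)"
  proof
    fix z assume "z \<in> {z. \<not> (fst z \<in> {0<..<T} \<longrightarrow> P (fst z) (snd z))}"
    then have z: "fst z \<in> {0<..<T}" "\<not> P (fst z) (snd z)" by auto
    obtain t y x2 where zt: "z = (t, (y, x2))" by (cases z) auto
    have "P t (y, frac x2 + of_int \<lfloor>x2\<rfloor>) = P t (y, frac x2)" using per_int[of t] z zt by simp
    then have "\<not> P t (y, frac x2)" using z zt by (simp add: frac_def)
    then have "(t, (y, frac x2)) \<in> N"
      using z zt frac_ge_0[of x2] frac_lt_1[of x2] by (auto simp: N_def period_cell_def)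
    moreover have "z = (0, (0, of_int \<lfloor>x2\<rfloor>)) + (t, (y, frac x2))" by (simp add: zt frac_def)
    ultimately show "z \<in> (\<Union>j::int. (+) (0, (0, of_int j)) ` N)" by blast
  qed
  ultimately have "negligible {z. \<not> (fst z \<in> {0<..<T} \<longrightarrow> P (fst z) (snd z))}"
    by (rule negligible_subset)
  then have "AE z in lebesgue. z \<notin> {z. \<not> (fst z \<in> {0<..<T} \<longrightarrow> P (fst z) (snd z))}"
    unfolding negligible_iff_null_sets by (rule AE_not_in)
  then show ?thesis unfolding AE_completion_iff mem_Collect_eq not_not .
qed

text \<open>The converse direction of Fubini for null sets, which requires a measurable predicate;
  statements are therefore put in terms of the Borel representatives and transferred to the weak
  solution only afterwards.\<close>

lemma (in euler_fields) AE_time_to_spacetime: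
  assumes [measurable]: "Measurable.pred borel Q"
    and ae: "AE \<tau> in lborel. \<tau> \<in> {0<..<T} \<longrightarrow> (AE x in lborel. x \<in> period_cell \<longrightarrow> Q (\<tau>, x))"
  shows "AE z in lborel. fst z \<in> {0<..<T} \<and> snd z \<in> period_cell \<longrightarrow> Q z"
proof -
  have [measurable]: "period_cell \<in> sets borel"
    unfolding period_cell_def by (auto intro!: borel_closed closed_Times)
  have "AE z in lborel \<Otimes>\<^sub>M lborel. fst z \<in> {0<..<T} \<and> snd z \<in> period_cell \<longrightarrow> Q z"
  proof (rule lborel_pair.AE_pair_measure)
    have [measurable]: "Measurable.pred (borel \<Otimes>\<^sub>M borel) Q" using assms(1) by (simp add: borel_prod)
    have "Measurable.pred (borel \<Otimes>\<^sub>M borel) (\<lambda>z::real \<times> (real \<times> real). fst z \<in> {0<..<T} \<and> snd z \<in> period_cell \<longrightarrow> Q z)"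
      by measurable
    then show "{z \<in> space (lborel \<Otimes>\<^sub>M lborel). fst z \<in> {0<..<T} \<and> snd z \<in> period_cell \<longrightarrow> Q z} \<in> sets (lborel \<Otimes>\<^sub>M lborel)"
      unfolding lborel_prod borel_prod pred_def by simp
    show "AE x in lborel. AE y in lborel. fst (x, y) \<in> {0<..<T} \<and> snd (x, y) \<in> period_cell \<longrightarrow> Q (x, y)"
      using ae
    proof eventually_elim
      case (elim \<tau>)
      show ?case
      proof (cases "\<tau> \<in> {0<..<T}")
        case True
        then have "AE x in lborel. x \<in> period_cell \<longrightarrow> Q (\<tau>, x)" using elim by blast
        then show ?thesis by eventually_elim auto
      next
        case False
        then show ?thesis by (intro AE_I2) auto
      qed
    qed
  qed
  then show ?thesis unfolding lborel_prod .
qed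

lemma negative_part_square_C1:
  fixes S :: real
  shows "(\<lambda>y. - (max 0 (S - y))\<^sup>2) C1_differentiable_on UNIV" "deriv (\<lambda>y. - (max 0 (S - y))\<^sup>2) y \<ge> 0"
proof -
  have d: "((\<lambda>y. - (max 0 (S - y))\<^sup>2) has_real_derivative 2 * max 0 (S - y)) (at y)" for y
  proof -
    have "((\<lambda>y. (max 0 (S - y))\<^sup>2) has_real_derivative 2 * max 0 (S - y) * (-1)) (at y)"
      by (rule DERIV_chain2[OF max_0_square_has_real_derivative]) (auto intro!: derivative_eq_intros)
    from DERIV_minus[OF this] show ?thesis by simp
  qed
  show "deriv (\<lambda>y. - (max 0 (S - y))\<^sup>2) y \<ge> 0" using DERIV_imp_deriv[OF d] by simp
  show "(\<lambda>y. - (max 0 (S - y))\<^sup>2) C1_differentiable_on UNIV"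
    unfolding C1_differentiable_on_def
    by (rule exI[of _ "\<lambda>y. 2 * max 0 (S - y)"])
       (use d in \<open>auto simp: has_real_derivative_iff_has_vector_derivative intro!: continuous_intros\<close>)
qed

theorem theorem2p1:
  fixes T cv R_L R_R Theta_L Theta_R U_L U_R :: real
    and rho theta :: "real \<Rightarrow> real \<times> real \<Rightarrow> real"
    and u :: "real \<Rightarrow> real \<times> real \<Rightarrow> real \<times> real"
    and R Theta U :: "real \<Rightarrow> real \<Rightarrow> real"
  assumes "T > 0" and "cv > 0"
    and "R_L > 0" and "R_R > 0" and "Theta_L > 0" and "Theta_R > 0"
    and weak: "weak_solution T cv
                 (\<lambda>x. riemann R_L R_R (fst x))
                 (\<lambda>x. riemann Theta_L Theta_R (fst x))
                 (\<lambda>x. (riemann U_L U_R (fst x), 0))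
                 rho theta u"
    and far_left: "far_field T at_bot R_L Theta_L U_L rho theta u"
    and far_right: "far_field T at_top R_R Theta_R U_R rho theta u"
    and shock_free: "shock_free_solution T cv
                       (riemann R_L R_R) (riemann Theta_L Theta_R) (riemann U_L U_R) R Theta U"
  shows "AE (t, x) in lebesgue_on ({0<..<T} \<times> UNIV).
           rho t x = R t (fst x) \<and> theta t x = Theta t (fst x) \<and> u t x = (U t (fst x), 0)"
proof -
  note T = \<open>T > 0\<close> and cv = \<open>cv > 0\<close>
  note pos = \<open>R_L > 0\<close> \<open>R_R > 0\<close> \<open>Theta_L > 0\<close> \<open>Theta_R > 0\<close>
  obtain S v c M c_L c_R where prof: "wave_profile cv v c" and M: "M > 0"
    and right: "\<And>\<xi>. \<xi> > M \<Longrightarrow> v \<xi> = U_R \<and> c \<xi> = c_R" and left: "\<And>\<xi>. \<xi> < -M \<Longrightarrow> v \<xi> = U_L \<and> c \<xi> = c_L"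
    and Theta: "Theta_L = cv / (cv + 1) * c_L\<^sup>2" "Theta_R = cv / (cv + 1) * c_R\<^sup>2"
    and data: "entropy cv R_L Theta_L = S" "entropy cv R_R Theta_R = S"
    and sol: "\<And>t x. t \<in> {0<..T} \<Longrightarrow> U t x = v (x / t) \<and> Theta t x = cv / (cv + 1) * (c (x / t))\<^sup>2
        \<and> R t x = exp (- S) * Theta t x powr cv"
    by (rule shock_free_wave_profile[OF T cv pos(1,2) shock_free]) blast
  obtain K \<rho> \<theta> a b where "euler_fields T cv K \<rho> \<theta> a b" and "euler_fields.represents T \<rho> \<theta> a b rho theta u"
    using weak_solution_fields[OF T cv weak] by blast
  then interpret euler_fields T cv K \<rho> \<theta> a b by blast
  have rep: "represents rho theta u" by fact
  note lim1 = far_field_strip_tendsto(1)[OF rep far_right] and lim0 = far_field_strip_tendsto(2)[OF rep far_left]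
  have s0: "entropy cv (riemann R_L R_R x) (riemann Theta_L Theta_R x) = S" for x
    using data by (simp add: riemann_def)
  note good = represents_at_AE[OF rep]
  \<comment> \<open>Proved in space-time before the energy estimate, because the dissipation at time
    \<open>\<tau>\<close> uses the minimum principle at all earlier times.\<close>
  have smin: "AE z in lborel. fst z \<in> {0<..<T} \<and> snd z \<in> period_cell \<longrightarrow> S \<le> entropy cv (\<rho> z) (\<theta> z)"
  proof (rule AE_time_to_spacetime)
    show "Measurable.pred borel (\<lambda>z. S \<le> entropy cv (\<rho> z) (\<theta> z))" by measurable
    show "AE \<tau> in lborel. \<tau> \<in> {0<..<T} \<longrightarrow> (AE x in lborel. x \<in> period_cell \<longrightarrow> S \<le> entropy cv (\<rho> (\<tau>, x)) (\<theta> (\<tau>, x)))"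
      using good
    proof eventually_elim
      case (elim \<tau>)
      show ?case
      proof
        assume \<tau>: "\<tau> \<in> {0<..<T}"
        have "overbalanced \<tau> (\<lambda>z. \<rho> z * - (max 0 (S - entropy cv (\<rho> z) (\<theta> z)))\<^sup>2)
          (\<lambda>z. \<rho> z * - (max 0 (S - entropy cv (\<rho> z) (\<theta> z)))\<^sup>2 * a z) (\<lambda>x. 0)"
          using weak_balances(4)[OF rep \<tau> elim[rule_format, OF \<tau>] weak negative_part_square_C1(1)[of S]] negative_part_square_C1(2)[of S]
          by (simp add: s0)
        then show "AE x in lborel. x \<in> period_cell \<longrightarrow> S \<le> entropy cv (\<rho> (\<tau>, x)) (\<theta> (\<tau>, x))"
          by (rule minimum_entropy[OF \<tau> _ pos(1,3) data(1) pos(2,4) data(2) lim1 lim0])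
      qed
    qed
  qed
  \<comment> \<open>The entropy is measured from \<open>S\<close>, so its initial density vanishes
    and the excess controlled by the minimum principle appears directly.\<close>
  have C1id: "(\<lambda>y. y - S) C1_differentiable_on UNIV" "\<forall>y. deriv (\<lambda>y. y - S) y \<ge> 0"
  proof -
    have d: "((\<lambda>y. y - S) has_real_derivative 1) (at y)" for y by (auto intro!: derivative_eq_intros)
    show "\<forall>y. deriv (\<lambda>y. y - S) y \<ge> 0" using DERIV_imp_deriv[OF d] by simp
    show "(\<lambda>y. y - S) C1_differentiable_on UNIV"
      unfolding C1_differentiable_on_def
      by (rule exI[of _ "\<lambda>y. 1"]) (use d in \<open>auto simp: has_real_derivative_iff_has_vector_derivative\<close>)
  qed
  \<comment> \<open>Expressed through the continuous \<open>v\<close> and \<open>c\<close> instead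
    of \<open>R\<close>, \<open>Theta\<close> and \<open>U\<close>, which makes the predicate
    Borel.\<close>
  let ?eq = "\<lambda>z. \<theta> z = cv / (cv + 1) * (c (fst (snd z) / fst z))\<^sup>2 \<and>
      \<rho> z = exp (- S) * (cv / (cv + 1) * (c (fst (snd z) / fst z))\<^sup>2) powr cv \<and>
      a z = v (fst (snd z) / fst z) \<and> b z = 0"
  have vc: "continuous_on UNIV v" "continuous_on UNIV c" and cpos: "\<And>\<xi>. 0 < c \<xi>"
    using prof unfolding wave_profile_def by auto
  have "AE z in lborel. fst z \<in> {0<..<T} \<and> snd z \<in> period_cell \<longrightarrow> ?eq z"
  proof (rule AE_time_to_spacetime)
    have [measurable]: "v \<in> borel_measurable borel" "c \<in> borel_measurable borel"
      using vc by (auto intro: borel_measurable_continuous_onI)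
    have [measurable]: "(\<lambda>z::real \<times> (real \<times> real). fst (snd z)) \<in> borel_measurable borel"
       "(\<lambda>z::real \<times> (real \<times> real). fst z) \<in> borel_measurable borel"
      by (intro borel_measurable_continuous_onI continuous_intros)+
    show "Measurable.pred borel ?eq" by measurable
    show "AE \<tau> in lborel. \<tau> \<in> {0<..<T} \<longrightarrow> (AE x in lborel. x \<in> period_cell \<longrightarrow> ?eq (\<tau>, x))"
      using good
    proof eventually_elim
      case (elim \<tau>)
      show ?case
      proof
        assume \<tau>: "\<tau> \<in> {0<..<T}"
        note wb = weak_balances[OF rep \<tau> elim[rule_format, OF \<tau>] weak]
        have "AE x in lborel. x \<in> period_cell \<longrightarrow>
          rel_energy cv S (\<rho> (\<tau>, x)) (\<theta> (\<tau>, x)) (a (\<tau>, x)) (b (\<tau>, x)) (v (fst x / \<tau>)) (cv / (cv + 1) * (c (fst x / \<tau>))\<^sup>2) = 0"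
          by (rule relative_energy_vanishes[OF \<tau> pos data wb(1-3) wb(4)[OF C1id] smin lim1 lim0 prof M right left Theta])
        then show "AE x in lborel. x \<in> period_cell \<longrightarrow> ?eq (\<tau>, x)"
        proof eventually_elim
          case (elim x)
          show ?case
          proof
            assume "x \<in> period_cell"
            let ?h = "cv / (cv + 1) * (c (fst x / \<tau>))\<^sup>2" and ?z = "(\<tau>, x)"
            have h: "?h > 0" using cv cpos[of "fst x / \<tau>"] by simp
            have zero: "1 / 2 * \<rho> ?z * ((a ?z - v (fst x / \<tau>))\<^sup>2 + (b ?z)\<^sup>2) + rel_internal cv S (\<rho> ?z) (\<theta> ?z) ?h = 0"
              using elim \<open>x \<in> period_cell\<close> unfolding rel_energy_def by blast
            have kin: "0 \<le> 1 / 2 * \<rho> ?z * ((a ?z - v (fst x / \<tau>))\<^sup>2 + (b ?z)\<^sup>2)"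
              using bounds(1)[of ?z] by simp
            have int: "0 \<le> rel_internal cv S (\<rho> ?z) (\<theta> ?z) ?h"
              by (rule rel_internal_nonneg[OF cv bounds(1,3) h])
            have "rel_internal cv S (\<rho> ?z) (\<theta> ?z) ?h \<le> 0" using zero kin by linarith
            note th = rel_internal_eq_0[OF cv bounds(1,3) h this]
            \<comment> \<open>Kinetic and internal parts are both nonnegative with sum 0. The
              internal part fixes temperature and density; the kinetic part fixes the velocity,
              since the density is positive.\<close>
            have "1 / 2 * \<rho> ?z * ((a ?z - v (fst x / \<tau>))\<^sup>2 + (b ?z)\<^sup>2) = 0" using zero kin int by linarith
            then have "a ?z = v (fst x / \<tau>)" "b ?z = 0"
              using bounds(1)[of ?z] by (auto simp: sum_power2_eq_zero_iff)
            then show "?eq (\<tau>, x)" using th by simp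
          qed
        qed
      qed
    qed
  qed
  then have "AE z in lborel. fst z \<in> {0<..<T} \<and> snd z \<in> period_cell \<longrightarrow>
     rho (fst z) (snd z) = R (fst z) (fst (snd z)) \<and> theta (fst z) (snd z) = Theta (fst z) (fst (snd z))
       \<and> u (fst z) (snd z) = (U (fst z) (fst (snd z)), 0)"
    using rep[unfolded represents_def]
  proof eventually_elim
    case (elim z)
    show ?case
    proof
      assume z: "fst z \<in> {0<..<T} \<and> snd z \<in> period_cell"
      then have "fst z \<in> {0<..T}" by auto
      from sol[OF this, of "fst (snd z)"]
      show "rho (fst z) (snd z) = R (fst z) (fst (snd z)) \<and> theta (fst z) (snd z) = Theta (fst z) (fst (snd z))
       \<and> u (fst z) (snd z) = (U (fst z) (fst (snd z)), 0)"
        using elim z by simp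
    qed
  qed
  then have "AE z in (lborel :: (real \<times> (real \<times> real)) measure). fst z \<in> {0<..<T} \<longrightarrow>
     rho (fst z) (snd z) = R (fst z) (fst (snd z)) \<and> theta (fst z) (snd z) = Theta (fst z) (fst (snd z))
       \<and> u (fst z) (snd z) = (U (fst z) (fst (snd z)), 0)"
  proof (rule AE_periodic_extension)
    fix t y x2 assume t: "t \<in> {0<..<T}"
    have "periodic_x2 (rho t)" "periodic_x2 (theta t)" "periodic_x2 (u t)"
      using weak t unfolding weak_solution_def bounded_field_def by auto
    then show "(rho t (y, x2 + 1) = R t (fst (y, x2 + 1)) \<and> theta t (y, x2 + 1) = Theta t (fst (y, x2 + 1))
         \<and> u t (y, x2 + 1) = (U t (fst (y, x2 + 1)), 0)) =
       (rho t (y, x2) = R t (fst (y, x2)) \<and> theta t (y, x2) = Theta t (fst (y, x2)) \<and> u t (y, x2) = (U t (fst (y, x2)), 0))"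
      by (simp add: periodic_x2_def)
  qed
  then have "AE z in (lebesgue :: (real \<times> (real \<times> real)) measure). z \<in> {0<..<T} \<times> UNIV \<longrightarrow>
     (case z of (t, x) \<Rightarrow> rho t x = R t (fst x) \<and> theta t x = Theta t (fst x) \<and> u t x = (U t (fst x), 0))"
    by (intro AE_completion) (auto elim!: eventually_mono simp: case_prod_unfold)
  then show ?thesis
    by (subst AE_restrict_space_iff) (auto intro!: sets_completionI_sets borel_open open_Times)
qed

end
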